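(* Assume (H1), (H2), (H3), (H4), (G2), and that there are $r>\frac{2N}{N+2}$, $a\in L^r(\Omega)$ and $b\ge0$ with $$|g(x,s)|\le a(x)+b|s|^{\frac{N+2}{N-2}}\quad\text{for a.e. }x\in\Omega,\ \forall s\in\mathbb{R}.$$ Let $u\in H_0^1(\Omega)$ be a generalized solution of $-\operatorname{div}(j_\xi(x,u,\nabla u))+j_s(x,u,\nabla u)=g(x,u)$ in $\Omega$, $u=0$ on $\partial\Omega$. Then: (a) if $\frac{2N}{N+2}<r<\frac N2$, then $u\in L^{r^{**}}(\Omega)$ with $r^{**}=\frac{Nr}{N-2r}$; (b) if $r>\frac N2$, then $u\in L^\infty(\Omega)$.
   Context: $\Omega\subset\mathbb{R}^N$ bounded open, $N\ge3$. $j:\Omega\times\mathbb{R}\times\mathbb{R}^N\to\mathbb{R}$ measurable in $x$, $C^1$ in $(s,\xi)$ for a.e. $x$, partial derivatives $j_s,j_\xi$. (H1) $\xi\mapsto j(x,s,\xi)$ strictly convex; (H2) $\alpha_0|\xi|^2\le j(x,s,\xi)\le\alpha(|s|)|\xi|^2$ ($\alpha_0>0$, $\alpha$ positive increasing continuous); (H3) $|j_s(x,s,\xi)|\le\beta(|s|)|\xi|^2$ ($\beta$ positive increasing continuous); (H4) $j_s(x,s,\xi)s\ge0$ for $|s|\ge R$, some $R>0$. $g$ Carathéodory; (G2) for every $\varepsilon>0$ there is $a_\varepsilon\in L^{2N/(N+2)}(\Omega)$ with $|g(x,s)|\le a_\varepsilon(x)+\varepsilon|s|^{(N+2)/(N-2)}$.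 $W_u=\{v\in H_0^1(\Omega): j_\xi(x,u,\nabla u)\cdot\nabla v\in L^1,\ j_s(x,u,\nabla u)v\in L^1\}$. $u$ is a generalized solution of the stated problem if $u\in H_0^1(\Omega)$, $j_\xi(x,u,\nabla u)\cdot\nabla u\in L^1$, $j_s(x,u,\nabla u)u\in L^1$ and $\int_\Omega j_\xi(x,u,\nabla u)\cdot\nabla v+\int_\Omega j_s(x,u,\nabla u)v=\int_\Omega g(x,u)v$ for all $v\in W_u$. *)

theory Defs
  imports "HOL-Analysis.Analysis"
begin

definition Lp_mem :: "(real^'n) set \<Rightarrow> real \<Rightarrow> (real^'n \<Rightarrow> real) \<Rightarrow> bool" where
  "Lp_mem \<Omega> p f \<longleftrightarrow> f \<in> borel_measurable (lebesgue_on \<Omega>) \<and>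
     integrable (lebesgue_on \<Omega>) (\<lambda>x. \<bar>f x\<bar> powr p)"

definition Linf_mem :: "(real^'n) set \<Rightarrow> (real^'n \<Rightarrow> real) \<Rightarrow> bool" where
  "Linf_mem \<Omega> f \<longleftrightarrow> f \<in> borel_measurable (lebesgue_on \<Omega>) \<and>
     (\<exists>C. AE x in lebesgue_on \<Omega>. \<bar>f x\<bar> \<le> C)"

definition test_fun :: "(real^'n) set \<Rightarrow> (real^'n \<Rightarrow> real) \<Rightarrow> (real^'n \<Rightarrow> real^'n) \<Rightarrow> bool" where
  "test_fun \<Omega> \<phi> D \<longleftrightarrow>
     (\<forall>x. (\<phi> has_derivative (\<lambda>h. D x \<bullet> h)) (at x)) \<and> continuous_on UNIV D \<and>
     compact (closure {x. \<phi> x \<noteq> 0}) \<and> closure {x. \<phi> x \<noteq> 0} \<subseteq> \<Omega>"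

definition weak_grad :: "(real^'n) set \<Rightarrow> (real^'n \<Rightarrow> real) \<Rightarrow> (real^'n \<Rightarrow> real^'n) \<Rightarrow> bool" where
  "weak_grad \<Omega> u G \<longleftrightarrow>
     (\<forall>\<phi> D. test_fun \<Omega> \<phi> D \<longrightarrow> (\<forall>i.
        integral\<^sup>L (lebesgue_on \<Omega>) (\<lambda>x. u x * D x $ i)
        = - integral\<^sup>L (lebesgue_on \<Omega>) (\<lambda>x. G x $ i * \<phi> x)))"

text \<open>u \<in> H_0^1(\<Omega>) with weak gradient G: u, |G| \<in> L^2(\<Omega>), and u is the H^1-limit of
  compactly supported C^1 functions in \<Omega> (closure of C_c^1(\<Omega>) = closure of C_c^\<infinity>(\<Omega>)).\<close>
definition H01 :: "(real^'n) set \<Rightarrow> (real^'n \<Rightarrow> real) \<Rightarrow> (real^'n \<Rightarrow> real^'n) \<Rightarrow> bool" where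
  "H01 \<Omega> u G \<longleftrightarrow>
     Lp_mem \<Omega> 2 u \<and> G \<in> borel_measurable (lebesgue_on \<Omega>) \<and>
     integrable (lebesgue_on \<Omega>) (\<lambda>x. (norm (G x))\<^sup>2) \<and> weak_grad \<Omega> u G \<and>
     (\<exists>\<phi> D. (\<forall>k. test_fun \<Omega> (\<phi> k) (D k)) \<and>
        (\<lambda>k. integral\<^sup>L (lebesgue_on \<Omega>) (\<lambda>x. (\<phi> k x - u x)\<^sup>2)) \<longlonglongrightarrow> 0 \<and>
        (\<lambda>k. integral\<^sup>L (lebesgue_on \<Omega>) (\<lambda>x. (norm (D k x - G x))\<^sup>2)) \<longlonglongrightarrow> 0)"

text \<open>Generalized solution of -div(j_\<xi>(x,u,\<nabla>u)) + j_s(x,u,\<nabla>u) = g(x,u), u = 0 on \<partial>\<Omega>.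
  The test class W_u consists of v \<in> H_0^1 with j_\<xi>(x,u,\<nabla>u)\<cdot>\<nabla>v, j_s(x,u,\<nabla>u) v \<in> L^1.\<close>
definition gen_solution ::
  "(real^'n) set \<Rightarrow> (real^'n \<Rightarrow> real \<Rightarrow> real^'n \<Rightarrow> real) \<Rightarrow> (real^'n \<Rightarrow> real \<Rightarrow> real^'n \<Rightarrow> real^'n)
   \<Rightarrow> (real^'n \<Rightarrow> real \<Rightarrow> real) \<Rightarrow> (real^'n \<Rightarrow> real) \<Rightarrow> bool" where
  "gen_solution \<Omega> js jxi g u \<longleftrightarrow>
     (\<exists>G. H01 \<Omega> u G \<and>
        integrable (lebesgue_on \<Omega>) (\<lambda>x. jxi x (u x) (G x) \<bullet> G x) \<and>
        integrable (lebesgue_on \<Omega>) (\<lambda>x. js x (u x) (G x) * u x) \<and>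
        (\<forall>v H. H01 \<Omega> v H \<and>
           integrable (lebesgue_on \<Omega>) (\<lambda>x. jxi x (u x) (G x) \<bullet> H x) \<and>
           integrable (lebesgue_on \<Omega>) (\<lambda>x. js x (u x) (G x) * v x) \<longrightarrow>
           integral\<^sup>L (lebesgue_on \<Omega>) (\<lambda>x. jxi x (u x) (G x) \<bullet> H x)
           + integral\<^sup>L (lebesgue_on \<Omega>) (\<lambda>x. js x (u x) (G x) * v x)
           = integral\<^sup>L (lebesgue_on \<Omega>) (\<lambda>x. g x (u x) * v x)))"

end

theory Submission
  imports Defs
begin

text \<open>
  Only test functions that vanish for \<open>\<bar>u\<bar> \<le> R\<close> are used. If \<open>\<phi>\<close> is continuous, bounded and
  nondecreasing with \<open>\<phi> = 0\<close> on \<open>(-\<infinity>, R]\<close> and \<open>\<Phi>' = \<phi>\<close>, \<open>\<Phi> 0 = 0\<close>, test the equation with \<open>T u\<close>,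
  where \<open>T\<close> is odd and \<open>T' = \<phi>\<^sup>2\<close> on the half line. The \<open>j\<^sub>s\<close> term is then nonnegative by (H4), convexity
  gives \<open>j\<^sub>\<xi> \<bullet> \<xi> \<ge> \<alpha>0 \<bar>\<xi>\<bar>\<^sup>2\<close>, and \<open>T \<le> \<phi> \<Phi>\<close>; with the Sobolev inequality for \<open>\<Phi> \<bar>u\<bar>\<close> this yields
  \<open>\<parallel>\<Phi> \<bar>u\<bar>\<parallel>\<^sup>2 \<le> K \<integral> (\<bar>a\<bar> + b \<bar>u\<bar> powr (2* - 1)) \<phi> \<bar>u\<bar> \<Phi> \<bar>u\<bar>\<close> with the norm of \<open>L\<close> to the critical exponent \<open>2*\<close>.

  For (a), \<open>\<Phi>\<close> is a truncated power of \<open>\<bar>u\<bar> - R\<close>. The critical term is split at \<open>\<bar>u\<bar> = m\<close>: below, it is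
  bounded; above, the factor \<open>\<bar>u\<bar> powr (2* - 2)\<close> has small norm in \<open>L\<close> to the \<open>N/2\<close> and the term is absorbed
  (Brezis-Kato). For (b), part (a) puts the right-hand side in \<open>L\<close> to the \<open>r\<close> with \<open>r > N/2\<close>, and Stampacchia's
  level-set iteration applies.

  The Sobolev inequality is obtained from the Gagliardo-Nirenberg inequality for \<open>C\<^sup>1\<close> functions of compact
  support.
\<close>

section \<open>Inequalities for powers and the Hoelder inequality\<close>

text \<open>The growth functions \<open>\<alpha>\<close> and \<open>\<beta>\<close> may be unbounded
  along \<open>u\<close>, so of the coefficients of the equation only the products
  \<open>jxi \<bullet> G\<close> and \<open>js * u\<close> are known to be integrable. A test
  function is therefore safe when its gradient is a bounded multiple of the gradient of
  \<open>u\<close> and its size at most a multiple of |u|. This rules out genuine powers of |u| and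
  forces truncation; all constants must then be independent of the truncation level, which Fatou's
  lemma removes at the end. The exponent in (a) comes from one relation: data in L^\<rho> give
  \<open>u\<close> in L^q when 1/q = 1/\<rho> - 2/N. Every q above the critical exponent is reached
  in a single application, without iterating over exponents. For \<rho> = r this q is r**. For (b),
  every finite q corresponds to some \<rho> below N/2, hence below r, so \<open>u\<close> lies in
  all L^q and the critical term can be treated as data. The Sobolev inequality is first proved on a
  box by integrating out the coordinates one by one, with functions bounded away from 0 so that no
  degenerate powers occur.\<close>

lemma powr_le_one_add_powr:
  fixes x :: real
  assumes "0 \<le> x" "0 \<le> p" "p \<le> q"
  shows "x powr p \<le> 1 + x powr q"
proof (cases "x \<le> 1")
  case True
  then have "x powr p \<le> 1" using assms by (simp add: powr_le1)
  then show ?thesis by (simp add: add_increasing2)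
next
  case False
  then have "x powr p \<le> x powr q" using assms by (intro powr_mono) auto
  then show ?thesis by simp
qed

lemma add_powr_le:
  fixes x y :: real
  assumes "0 \<le> x" "0 \<le> y" "0 \<le> r"
  shows "(x + y) powr r \<le> 2 powr r * (x powr r + y powr r)"
proof -
  have "(x + y) powr r \<le> (2 * max x y) powr r"
    using assms by (intro powr_mono2) auto
  also have "\<dots> = 2 powr r * max x y powr r"
    by (simp add: powr_mult)
  also have "max x y powr r \<le> x powr r + y powr r"
    by (simp add: max_def)
  finally show ?thesis by simp
qed

lemma divide_le_self:
  fixes x c :: real
  assumes "0 \<le> x" "1 \<le> c"
  shows "x / c \<le> x"
  using assms mult_left_mono[of 1 c x] by (simp add: divide_le_eq)

lemma weighted_arith_geom_mean:
  fixes x w :: "'a \<Rightarrow> real"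
  assumes "finite I" "\<And>i. i \<in> I \<Longrightarrow> 0 \<le> x i" "\<And>i. i \<in> I \<Longrightarrow> 0 \<le> w i" "sum w I = 1"
  shows "(\<Prod>i\<in>I. x i powr w i) \<le> (\<Sum>i\<in>I. w i * x i)"
proof (cases "\<exists>i\<in>I. x i = 0")
  case True
  \<comment> \<open>\<open>0 powr w\<close> is 0 for every \<open>w\<close>, also for
    \<open>w = 0\<close>, so one zero entry makes the whole product vanish.\<close>
  then have "(\<Prod>i\<in>I. x i powr w i) = 0"
    using assms(1) by (auto intro!: prod_zero)
  moreover have "0 \<le> (\<Sum>i\<in>I. w i * x i)"
    using assms by (intro sum_nonneg) auto
  ultimately show ?thesis
    by simp
next
  case False
  then have pos: "\<And>i. i \<in> I \<Longrightarrow> 0 < x i"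
    using assms(2) by (metis less_eq_real_def)
  have "I \<noteq> {}"
    using assms(4) by auto
  have "(\<Prod>i\<in>I. x i powr w i) = exp (\<Sum>i\<in>I. w i *\<^sub>R ln (x i))"
    using assms(1) pos by (simp add: exp_sum powr_def) (intro prod.cong, auto dest: pos)
  also have "\<dots> \<le> (\<Sum>i\<in>I. w i * exp (ln (x i)))"
    using assms(1,3,4) \<open>I \<noteq> {}\<close> by (intro convex_on_sum[OF _ _ exp_convex]) auto
  also have "\<dots> = (\<Sum>i\<in>I. w i * x i)"
    using pos by (intro sum.cong) auto
  finally show ?thesis .
qed

text \<open>The weighted mean inequality is applied to the functions divided by their integrals
  \<open>c i\<close>; its right-hand side then integrates to the sum of the weights, which is 1. The
  number of factors is left open because the marginals need one per coordinate and the level sets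
  need three.\<close>

lemma Holder_prod:
  fixes f :: "'i \<Rightarrow> 'a \<Rightarrow> real" and w :: "'i \<Rightarrow> real"
  assumes I: "finite I" and w: "\<And>i. i \<in> I \<Longrightarrow> 0 \<le> w i" "sum w I = 1"
    and f: "\<And>i. i \<in> I \<Longrightarrow> integrable M (f i)" and nn: "\<And>i x. i \<in> I \<Longrightarrow> 0 \<le> f i x"
  shows "integrable M (\<lambda>x. \<Prod>i\<in>I. f i x powr w i)"
    and "(\<integral>x. (\<Prod>i\<in>I. f i x powr w i) \<partial>M) \<le> (\<Prod>i\<in>I. (\<integral>x. f i x \<partial>M) powr w i)"
proof -
  have meas: "(\<lambda>x. \<Prod>i\<in>I. f i x powr w i) \<in> borel_measurable M"
    using f by (intro borel_measurable_prod powr_real_measurable) auto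
  show int: "integrable M (\<lambda>x. \<Prod>i\<in>I. f i x powr w i)"
  proof (rule Bochner_Integration.integrable_bound[OF _ meas])
    show "integrable M (\<lambda>x. \<Sum>i\<in>I. w i * f i x)"
      using f by auto
    show "AE x in M. norm (\<Prod>i\<in>I. f i x powr w i) \<le> norm (\<Sum>i\<in>I. w i * f i x)"
    proof (rule AE_I2)
      fix x
      have "(\<Prod>i\<in>I. f i x powr w i) \<le> (\<Sum>i\<in>I. w i * f i x)"
        using I w nn by (intro weighted_arith_geom_mean) auto
      then show "norm (\<Prod>i\<in>I. f i x powr w i) \<le> norm (\<Sum>i\<in>I. w i * f i x)"
        by (simp add: abs_of_nonneg prod_nonneg)
    qed
  qed
  define c where "c i = (\<integral>x. f i x \<partial>M)" for i
  have c0: "0 \<le> c i" if "i \<in> I" for i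
    using nn[OF that] by (auto simp: c_def intro: integral_nonneg)
  show "(\<integral>x. (\<Prod>i\<in>I. f i x powr w i) \<partial>M) \<le> (\<Prod>i\<in>I. (\<integral>x. f i x \<partial>M) powr w i)"
  proof (cases "\<exists>i\<in>I. c i = 0")
    case True
    then obtain i where i: "i \<in> I" "c i = 0" by auto
    have "AE x in M. f i x = 0"
      using i f nn integral_nonneg_eq_0_iff_AE[of M "f i"] by (auto simp: c_def)
    then have "AE x in M. (\<Prod>i\<in>I. f i x powr w i) = 0"
      by eventually_elim (use I i in \<open>auto intro!: prod_zero\<close>)
    then have "(\<integral>x. (\<Prod>i\<in>I. f i x powr w i) \<partial>M) = 0"
      by (rule integral_eq_zero_AE)
    then show ?thesis
      by (auto intro!: prod_nonneg)
  next
    case False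
    with c0 have c: "0 < c i" if "i \<in> I" for i
      using that by (metis less_eq_real_def)
    let ?P = "\<Prod>i\<in>I. c i powr w i"
    have le: "(\<Prod>i\<in>I. f i x powr w i) \<le> ?P * (\<Sum>i\<in>I. w i * (f i x / c i))" for x
    proof -
      have "(\<Prod>i\<in>I. f i x powr w i) = (\<Prod>i\<in>I. c i powr w i * (f i x / c i) powr w i)"
        using c nn by (intro prod.cong) (auto simp: powr_divide less_imp_le dest: c)
      also have "\<dots> = ?P * (\<Prod>i\<in>I. (f i x / c i) powr w i)"
        by (simp add: prod.distrib)
      also have "\<dots> \<le> ?P * (\<Sum>i\<in>I. w i * (f i x / c i))"
        using I w nn c by (intro mult_left_mono weighted_arith_geom_mean prod_nonneg)
          (auto intro!: divide_nonneg_nonneg c0)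
      finally show ?thesis .
    qed
    have "(\<integral>x. (\<Prod>i\<in>I. f i x powr w i) \<partial>M) \<le> (\<integral>x. ?P * (\<Sum>i\<in>I. w i * (f i x / c i)) \<partial>M)"
      using int f le by (intro integral_mono) auto
    also have "\<dots> = ?P * (\<Sum>i\<in>I. w i * ((\<integral>x. f i x \<partial>M) / c i))"
      using f by simp
    also have "(\<Sum>i\<in>I. w i * ((\<integral>x. f i x \<partial>M) / c i)) = sum w I"
      by (intro sum.cong) (auto simp: c_def dest!: c)
    finally show ?thesis
      using w by (simp add: c_def)
  qed
qed

lemma Holder_two:
  fixes f g :: "'a \<Rightarrow> real"
  assumes "integrable M f" "integrable M g" "\<And>x. 0 \<le> f x" "\<And>x. 0 \<le> g x"
    and "0 \<le> p" "0 \<le> q" "p + q = 1"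
  shows "integrable M (\<lambda>x. f x powr p * g x powr q)"
    and "(\<integral>x. f x powr p * g x powr q \<partial>M) \<le> (\<integral>x. f x \<partial>M) powr p * (\<integral>x. g x \<partial>M) powr q"
  using Holder_prod[of "UNIV::bool set" "\<lambda>i. if i then p else q" M "\<lambda>i. if i then f else g"] assms
  by (auto simp: UNIV_bool mult.commute)

section \<open>Coordinate marginals and the Gagliardo-Nirenberg inequality\<close>

text \<open>Points are functions on the index set, so that a coordinate is replaced by
  \<open>x(i := t)\<close> and Fubini can be applied one coordinate at a time. The result does not
  depend on \<open>x i\<close>.\<close>

definition marg :: "real \<Rightarrow> 'i \<Rightarrow> (('i \<Rightarrow> real) \<Rightarrow> real) \<Rightarrow> ('i \<Rightarrow> real) \<Rightarrow> real" where
  "marg m i f x = (\<integral>t. indicator {-m..m} t * f (x(i := t)) \<partial>lborel)"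

definition margs :: "real \<Rightarrow> 'i list \<Rightarrow> (('i \<Rightarrow> real) \<Rightarrow> real) \<Rightarrow> ('i \<Rightarrow> real) \<Rightarrow> real" where
  "margs m xs f = fold (marg m) xs f"

lemma margs_Nil [simp]: "margs m [] f = f"
  and margs_Cons [simp]: "margs m (i # xs) f = margs m xs (marg m i f)"
  by (simp_all add: margs_def)

text \<open>This class is closed under \<open>marg\<close>, products and nonnegative powers, and
  integrability over the box is automatic in it. The positive lower bound ensures
  \<open>f x powr 0 = 1\<close>, the case that occurs when \<open>margs_prod_le\<close> is
  applied.\<close>

definition pos_bdd :: "(('i \<Rightarrow> real) \<Rightarrow> real) \<Rightarrow> bool" where
  "pos_bdd f \<longleftrightarrow> f \<in> borel_measurable (PiM UNIV (\<lambda>_. borel)) \<and> (\<exists>c>0. \<exists>C. \<forall>x. c \<le> f x \<and> f x \<le> C)"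

lemma pos_bdd_pos: "pos_bdd f \<Longrightarrow> 0 < f x"
  unfolding pos_bdd_def by (meson less_le_trans)

lemma measurable_update_UNIV [measurable]:
  "(\<lambda>t. x(i := t)) \<in> borel \<rightarrow>\<^sub>M PiM UNIV (\<lambda>_. borel :: real measure)"
  by (intro measurable_PiM_single') (auto simp: fun_upd_def)

lemma integrable_Icc_bounded:
  fixes h :: "real \<Rightarrow> real"
  assumes "h \<in> borel_measurable borel" "\<And>t. \<bar>h t\<bar> \<le> C"
  shows "integrable lborel (\<lambda>t. indicator {-m..m} t * h t)"
proof (rule Bochner_Integration.integrable_bound)
  show "integrable lborel (\<lambda>t. indicator {-m..m} t * C :: real)"
    by (intro integrable_mult_left integrable_real_indicator) (auto simp: emeasure_lborel_Icc_eq)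
  show "AE t in lborel. norm (indicator {-m..m} t * h t) \<le> norm (indicator {-m..m} t * C :: real)"
    using assms(2) by (auto simp: indicator_def intro!: AE_I2 order_trans[OF _ abs_ge_self])
qed (use assms in measurable)

lemma pos_bdd_slice:
  assumes "pos_bdd f"
  shows "integrable lborel (\<lambda>t. indicator {-m..m} t * f (x(i := t)))"
proof -
  obtain c C where "c > 0" "\<And>x. c \<le> f x" "\<And>x. f x \<le> C" and [measurable]: "f \<in> borel_measurable (PiM UNIV (\<lambda>_. borel))"
    using assms by (auto simp: pos_bdd_def)
  then have "\<bar>f y\<bar> \<le> C" for y by (smt (verit))
  then show ?thesis by (intro integrable_Icc_bounded) auto
qed

lemma marg_mono:
  assumes "pos_bdd f" "pos_bdd g" "\<And>x. f x \<le> g x"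
  shows "marg m i f x \<le> marg m i g x"
  unfolding marg_def using assms
  by (intro integral_mono pos_bdd_slice mult_left_mono) auto

lemma pos_bdd_marg:
  assumes "pos_bdd f" "0 < m"
  shows "pos_bdd (marg m i f)"
proof -
  obtain c C where c: "c > 0" "\<And>x. c \<le> f x" "\<And>x. f x \<le> C"
    and [measurable]: "f \<in> borel_measurable (PiM UNIV (\<lambda>_. borel))"
    using assms by (auto simp: pos_bdd_def)
  have [measurable]: "(\<lambda>p. (fst p)(i := snd p)) \<in> PiM UNIV (\<lambda>_. borel :: real measure) \<Otimes>\<^sub>M lborel \<rightarrow>\<^sub>M PiM UNIV (\<lambda>_. borel)"
    by (intro measurable_PiM_single') (auto simp: fun_upd_def)
  have "marg m i f \<in> borel_measurable (PiM UNIV (\<lambda>_. borel))"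
    unfolding marg_def by (intro sigma_finite_measure.borel_measurable_lebesgue_integral) (auto simp: split_beta lborel.sigma_finite_measure_axioms)
  moreover have "2 * m * c \<le> marg m i f x \<and> marg m i f x \<le> 2 * m * C" for x
  proof -
    have J: "integrable lborel (\<lambda>t. indicator {-m..m} t * d)" for d :: real
      by (rule integrable_Icc_bounded) auto
    have I: "(\<integral>t. indicator {-m..m} t * d \<partial>lborel) = 2 * m * d" for d :: real
      using assms(2) by simp
    have "(\<integral>t. indicator {-m..m} t * c \<partial>lborel) \<le> marg m i f x"
      unfolding marg_def using c by (intro integral_mono pos_bdd_slice assms mult_left_mono J) auto
    moreover have "marg m i f x \<le> (\<integral>t. indicator {-m..m} t * C \<partial>lborel)"
      unfolding marg_def using c by (intro integral_mono pos_bdd_slice assms mult_left_mono J) auto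
    ultimately show ?thesis unfolding I by simp
  qed
  moreover have "0 < 2 * m * c" using assms c by simp
  ultimately show ?thesis unfolding pos_bdd_def by blast
qed

lemma pos_bdd_mult:
  assumes "pos_bdd f" "pos_bdd g" shows "pos_bdd (\<lambda>x. f x * g x)"
proof -
  obtain c C where c: "c > 0" "\<And>x. c \<le> f x" "\<And>x. f x \<le> C"
    and [measurable]: "f \<in> borel_measurable (PiM UNIV (\<lambda>_. borel))"
    using assms by (auto simp: pos_bdd_def)
  obtain d D where d: "d > 0" "\<And>x. d \<le> g x" "\<And>x. g x \<le> D"
    and [measurable]: "g \<in> borel_measurable (PiM UNIV (\<lambda>_. borel))"
    using assms by (auto simp: pos_bdd_def)
  have "c * d \<le> f x * g x \<and> f x * g x \<le> C * D" for x
    using c d by (auto intro!: mult_mono intro: order_trans less_imp_le) (meson c d less_imp_le order_trans)+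
  moreover have "0 < c * d" using c d by simp
  moreover have "(\<lambda>x. f x * g x) \<in> borel_measurable (PiM UNIV (\<lambda>_. borel))" by measurable
  ultimately show ?thesis unfolding pos_bdd_def by blast
qed

lemma pos_bdd_powr:
  assumes "pos_bdd f" "0 \<le> q" shows "pos_bdd (\<lambda>x. f x powr q)"
proof -
  obtain c C where c: "c > 0" "\<And>x. c \<le> f x" "\<And>x. f x \<le> C"
    and [measurable]: "f \<in> borel_measurable (PiM UNIV (\<lambda>_. borel))"
    using assms by (auto simp: pos_bdd_def)
  have "c powr q \<le> f x powr q \<and> f x powr q \<le> C powr q" for x
    using c(1) c(2)[of x] c(3)[of x] assms(2) by (auto intro!: powr_mono2)
  moreover have "0 < c powr q" using c by simp
  moreover have "(\<lambda>x. f x powr q) \<in> borel_measurable (PiM UNIV (\<lambda>_. borel))" by measurable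
  ultimately show ?thesis unfolding pos_bdd_def by blast
qed

lemma pos_bdd_prod:
  assumes "finite J" "\<And>j. j \<in> J \<Longrightarrow> pos_bdd (f j)" shows "pos_bdd (\<lambda>x. \<Prod>j\<in>J. f j x)"
  using assms
proof (induction J)
  case empty
  show ?case unfolding pos_bdd_def by (auto intro!: exI[of _ 1])
qed (auto intro: pos_bdd_mult)

lemma marg_commute:
  assumes "pos_bdd f"
  shows "marg m i (marg m j f) x = marg m j (marg m i f) x"
proof (cases "i = j")
  case False
  obtain c C where c: "c > 0" "\<And>x. c \<le> f x" "\<And>x. f x \<le> C"
    and [measurable]: "f \<in> borel_measurable (PiM UNIV (\<lambda>_. borel))"
    using assms by (auto simp: pos_bdd_def)
  have [measurable]: "(\<lambda>p. x(i := fst p, j := snd p)) \<in> lborel \<Otimes>\<^sub>M lborel \<rightarrow>\<^sub>M PiM UNIV (\<lambda>_. borel :: real measure)"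
    by (intro measurable_PiM_single') (auto simp: fun_upd_def)
  let ?F = "\<lambda>s t. indicator {-m..m} s * (indicator {-m..m} t * f (x(i := s, j := t)))"
  have box: "integrable (lborel \<Otimes>\<^sub>M lborel) (\<lambda>p. indicator ({-m..m} \<times> {-m..m}) p * C :: real)"
    by (intro integrable_mult_left integrable_real_indicator)
       (auto simp: lborel.emeasure_pair_measure_Times ennreal_mult_less_top emeasure_lborel_Icc_eq)
  have int: "integrable (lborel \<Otimes>\<^sub>M lborel) (case_prod ?F)"
  proof (rule Bochner_Integration.integrable_bound[OF box])
    show "case_prod ?F \<in> borel_measurable (lborel \<Otimes>\<^sub>M lborel)" by (simp add: split_beta) 
    have "\<bar>f y\<bar> \<le> \<bar>C\<bar>" for y using c(1) c(2)[of y] c(3)[of y] by simp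
    then show "AE p in lborel \<Otimes>\<^sub>M lborel. norm (case_prod ?F p) \<le> norm (indicator ({-m..m} \<times> {-m..m}) p * C :: real)"
      by (auto simp: indicator_def)
  qed
  have "marg m i (marg m j f) x = (\<integral>s. \<integral>t. ?F s t \<partial>lborel \<partial>lborel)"
    by (simp add: marg_def)
  also have "\<dots> = (\<integral>t. \<integral>s. ?F s t \<partial>lborel \<partial>lborel)"
    using lborel_pair.Fubini_integral[OF int] by simp
  also have "\<dots> = (\<integral>t. \<integral>s. indicator {-m..m} t * (indicator {-m..m} s * f (x(j := t, i := s))) \<partial>lborel \<partial>lborel)"
    using False by (simp add: fun_upd_twist mult.left_commute)
  also have "\<dots> = marg m j (marg m i f) x"
    by (simp add: marg_def)
  finally show ?thesis .
qed simp

lemma margs_mono: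
  assumes "pos_bdd f" "pos_bdd g" "\<And>x. f x \<le> g x" "0 < m"
  shows "margs m xs f x \<le> margs m xs g x"
  using assms by (induction xs arbitrary: f g) (auto intro: marg_mono pos_bdd_marg)

text \<open>Hoelder's inequality in the single variable \<open>t\<close> with
  \<open>card J + 1\<close> factors. An option type indexes them: \<open>None\<close> stands for
  \<open>f\<close>, \<open>Some j\<close> for \<open>h j\<close>.\<close>

lemma marg_Holder:
  assumes f: "pos_bdd f" and h: "\<And>j. j \<in> J \<Longrightarrow> pos_bdd (h j)" and J: "finite J"
    and p: "0 \<le> p" "real (card J) * p \<le> 1" and m: "0 < m"
  shows "marg m i (\<lambda>x. f x powr (1 - real (card J) * p) * (\<Prod>j\<in>J. h j x powr p)) x
    \<le> marg m i f x powr (1 - real (card J) * p) * (\<Prod>j\<in>J. marg m i (h j) x powr p)"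
proof -
  let ?I = "insert None (Some ` J)"
  define F where "F k t = indicator {-m..m} t * (case k of None \<Rightarrow> f (x(i := t)) | Some j \<Rightarrow> h j (x(i := t)))" for k t
  define w where "w k = (case k of None \<Rightarrow> 1 - real (card J) * p | Some j \<Rightarrow> p)" for k :: "'b option"
  have split: "(\<Prod>k\<in>?I. G k powr w k) = G None powr (1 - real (card J) * p) * (\<Prod>j\<in>J. G (Some j) powr p)" for G
    using J by (simp add: prod.reindex w_def image_iff)
  have ws: "sum w ?I = 1"
    using J by (simp add: sum.reindex w_def image_iff)
  have "(\<integral>t. (\<Prod>k\<in>?I. F k t powr w k) \<partial>lborel) \<le> (\<Prod>k\<in>?I. (\<integral>t. F k t \<partial>lborel) powr w k)"
  proof (rule Holder_prod(2))
    show "integrable lborel (F k)" if "k \<in> ?I" for k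
      using that f h by (auto simp: F_def[abs_def] intro!: pos_bdd_slice)
    show "0 \<le> F k t" if "k \<in> ?I" for k t
      using that less_imp_le[OF pos_bdd_pos[OF f]] less_imp_le[OF pos_bdd_pos[OF h]] by (auto simp: F_def)
    show "0 \<le> w k" if "k \<in> ?I" for k
      using p by (auto simp: w_def split: option.splits)
  qed (use J ws in auto)
  also have "(\<Prod>k\<in>?I. (\<integral>t. F k t \<partial>lborel) powr w k) =
     marg m i f x powr (1 - real (card J) * p) * (\<Prod>j\<in>J. marg m i (h j) x powr p)"
    by (simp add: split F_def marg_def)
  also have "(\<integral>t. (\<Prod>k\<in>?I. F k t powr w k) \<partial>lborel) = 
      marg m i (\<lambda>x. f x powr (1 - real (card J) * p) * (\<Prod>j\<in>J. h j x powr p)) x"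
    unfolding marg_def split by (intro Bochner_Integration.integral_cong refl) (auto simp: F_def indicator_def)
  finally show ?thesis .
qed

text \<open>
  Integrating out one coordinate at a time trades \<open>f\<close> for its marginal: the weights
  \<open>1 - card p\<close> and \<open>p, ..., p\<close> in \<open>marg_Holder\<close> add up to 1, which keeps the shape of the left-hand side.
\<close>
lemma margs_prod_le:
  assumes "pos_bdd f" "distinct xs" "0 \<le> p" "(real (length xs) - 1) * p \<le> 1" "0 < m"
  shows "margs m xs (\<lambda>x. f x powr (1 - (real (length xs) - 1) * p) * (\<Prod>j\<in>set xs. marg m j f x powr p)) x
    \<le> margs m xs f x powr (1 + p)"
  using assms
proof (induction xs arbitrary: f)
  case Nil
  then show ?case by simp
next
  case (Cons i xs)
  let ?k = "real (length xs)"
  have card: "card (set xs) = length xs"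
    using Cons.prems by (simp add: distinct_card)
  let ?g = "\<lambda>x. f x powr (1 - ?k * p) * (\<Prod>j\<in>set xs. marg m j f x powr p)"
  let ?A = "marg m i f"
  have kp: "?k * p \<le> 1" "(?k - 1) * p \<le> 1"
    using Cons.prems by (auto simp: algebra_simps)
  have pb: "pos_bdd (marg m j f)" for j
    using Cons.prems by (intro pos_bdd_marg) auto
  have step: "marg m i (\<lambda>x. f x powr (1 - ?k * p) * (\<Prod>j\<in>insert i (set xs). marg m j f x powr p)) x
     \<le> ?A x powr (1 - (?k - 1) * p) * (\<Prod>j\<in>set xs. marg m j ?A x powr p)" for x
  proof -
    \<comment> \<open>\<open>marg m i f\<close> is constant in coordinate \<open>i\<close>, so its
      power leaves the integral; only the remaining marginals have to pass through
      \<open>marg_Holder\<close>.\<close>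
    have "marg m i (\<lambda>x. f x powr (1 - ?k * p) * (\<Prod>j\<in>insert i (set xs). marg m j f x powr p)) x
      = ?A x powr p * marg m i ?g x"
      using Cons.prems by (simp add: marg_def mult.assoc mult.left_commute[of _ "_ powr p"] flip: Bochner_Integration.integral_mult_right_zero)
    also have "\<dots> \<le> ?A x powr p * (?A x powr (1 - ?k * p) * (\<Prod>j\<in>set xs. marg m i (marg m j f) x powr p))"
      using marg_Holder[of f "set xs" "\<lambda>j. marg m j f" p m i x] Cons.prems pb kp
      by (intro mult_left_mono) (auto simp: card)
    also have "\<dots> = ?A x powr (1 - (?k - 1) * p) * (\<Prod>j\<in>set xs. marg m i (marg m j f) x powr p)"
      by (simp add: powr_add[symmetric] algebra_simps flip: mult.assoc)
    also have "\<dots> = ?A x powr (1 - (?k - 1) * p) * (\<Prod>j\<in>set xs. marg m j ?A x powr p)"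
      using Cons.prems by (simp add: marg_commute[of f m i])
    finally show ?thesis .
  qed
  have "margs m (i # xs) (\<lambda>x. f x powr (1 - (real (length (i # xs)) - 1) * p) * (\<Prod>j\<in>set (i # xs). marg m j f x powr p)) x
     = margs m xs (marg m i (\<lambda>x. f x powr (1 - ?k * p) * (\<Prod>j\<in>insert i (set xs). marg m j f x powr p))) x"
    by simp
  also have "\<dots> \<le> margs m xs (\<lambda>x. ?A x powr (1 - (?k - 1) * p) * (\<Prod>j\<in>set xs. marg m j ?A x powr p)) x"
    using step Cons.prems kp
    by (intro margs_mono pos_bdd_marg pos_bdd_mult pos_bdd_powr pos_bdd_prod) auto
  also have "\<dots> \<le> margs m xs ?A x powr (1 + p)"
    using Cons.prems kp pb by (intro Cons.IH) auto
  finally show ?case by simp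
qed

text \<open>Fubini, with the list fixing the order of integration. The base point
  \<open>\<lambda>_. undefined\<close> is the only point of the empty product, where the induction
  ends.\<close>

lemma PiM_box_integral_eq_margs:
  fixes f :: "('i \<Rightarrow> real) \<Rightarrow> real"
  assumes "pos_bdd f" "distinct xs" "0 < m"
  shows "(\<integral>x. (\<Prod>i\<in>set xs. indicator {-m..m} (x i)) * f x \<partial>PiM (set xs) (\<lambda>_. lborel)) = margs m xs f (\<lambda>_. undefined)"
proof -
  interpret product_sigma_finite "\<lambda>_. lborel :: real measure" ..
  have int: "integrable (PiM I (\<lambda>_. lborel)) (\<lambda>x. (\<Prod>i\<in>I. indicator {-m..m} (x i)) * f x)"
    if "finite I" "pos_bdd f" for I :: "'i set" and f
  proof -
    obtain c C where c: "c > 0" "\<And>x. c \<le> f x" "\<And>x. f x \<le> C"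
      and f[measurable]: "f \<in> borel_measurable (PiM UNIV (\<lambda>_. borel))"
      using \<open>pos_bdd f\<close> by (auto simp: pos_bdd_def)
    \<comment> \<open>Points of \<open>PiM I\<close> are \<open>undefined\<close> off
      \<open>I\<close>, so the coordinate functions outside \<open>I\<close> are constant there and
      hence measurable.\<close>
    have id: "(\<lambda>x. x) \<in> PiM I (\<lambda>_. lborel) \<rightarrow>\<^sub>M PiM UNIV (\<lambda>_. borel :: real measure)"
    proof (rule measurable_PiM_single')
      show "(\<lambda>x. x i) \<in> PiM I (\<lambda>_. lborel) \<rightarrow>\<^sub>M (borel :: real measure)" for i
      proof (cases "i \<in> I")
        case False
        then show ?thesis
          by (subst measurable_cong[where g = "\<lambda>_. undefined"]) (auto simp: space_PiM PiE_def extensional_def)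
      qed simp
    qed auto
    show ?thesis
    proof (rule Bochner_Integration.integrable_bound)
      show "(\<lambda>x. (\<Prod>i\<in>I. indicator {-m..m} (x i)) * f x) \<in> borel_measurable (PiM I (\<lambda>_. lborel))"
        using measurable_compose[OF id f] by measurable
      show "integrable (PiM I (\<lambda>_. lborel)) (\<lambda>x. (\<Prod>i\<in>I. indicator {-m..m} (x i)) * C :: real)"
        using that by (intro integrable_mult_left product_integrable_prod integrable_real_indicator)
          (auto simp: emeasure_lborel_Icc_eq)
      have "\<bar>f y\<bar> \<le> \<bar>C\<bar>" for y using c(1) c(2)[of y] c(3)[of y] by simp
      then show "AE x in PiM I (\<lambda>_. lborel). norm ((\<Prod>i\<in>I. indicator {-m..m} (x i)) * f x) \<le>
         norm ((\<Prod>i\<in>I. indicator {-m..m} (x i)) * C :: real)"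
        by (auto simp: abs_mult intro!: mult_left_mono)
    qed
  qed
  show "(\<integral>x. (\<Prod>i\<in>set xs. indicator {-m..m} (x i)) * f x \<partial>PiM (set xs) (\<lambda>_. lborel)) = margs m xs f (\<lambda>_. undefined)"
    using assms
  proof (induction xs arbitrary: f)
    case Nil
    then show ?case by (simp add: PiM_empty lebesgue_integral_count_space_finite)
  next
    case (Cons i xs)
    let ?I = "set xs"
    have "(\<integral>x. (\<Prod>i\<in>insert i ?I. indicator {-m..m} (x i)) * f x \<partial>PiM (insert i ?I) (\<lambda>_. lborel))
      = (\<integral>x. (\<integral>y. (\<Prod>k\<in>insert i ?I. indicator {-m..m} ((x(i := y)) k)) * f (x(i := y)) \<partial>lborel) \<partial>PiM ?I (\<lambda>_. lborel))"
      using Cons.prems by (intro product_integral_insert int) auto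
    also have "\<dots> = (\<integral>x. (\<Prod>k\<in>?I. indicator {-m..m} (x k)) * marg m i f x \<partial>PiM ?I (\<lambda>_. lborel))"
    proof (intro Bochner_Integration.integral_cong refl)
      fix x
      have "(\<Prod>k\<in>insert i ?I. indicator {-m..m} ((x(i := y)) k)) * f (x(i := y)) =
        (\<Prod>k\<in>?I. indicator {-m..m} (x k)) * (indicator {-m..m} y * f (x(i := y)))" for y
      proof -
        have "(\<Prod>k\<in>?I. indicator {-m..m} ((x(i := y)) k)) = (\<Prod>k\<in>?I. indicator {-m..m} (x k) :: real)"
          using Cons.prems by (intro prod.cong) auto
        then show ?thesis using Cons.prems by (simp add: mult_ac)
      qed
      then show "(\<integral>y. (\<Prod>k\<in>insert i ?I. indicator {-m..m} ((x(i := y)) k)) * f (x(i := y)) \<partial>lborel) =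
        (\<Prod>k\<in>?I. indicator {-m..m} (x k)) * marg m i f x"
        by (simp only: marg_def integral_mult_right_zero)
    qed
    also have "\<dots> = margs m xs (marg m i f) (\<lambda>_. undefined)"
      using Cons by (intro Cons.IH pos_bdd_marg) auto
    finally show ?case by simp
  qed
qed

lemma lborel_box_integral_eq_margs:
  fixes F :: "'a::euclidean_space \<Rightarrow> real"
  assumes F: "F \<in> borel_measurable borel" and c: "0 < c" "\<And>x. c \<le> F x" "\<And>x. F x \<le> C"
    and xs: "set xs = (Basis :: 'a set)" "distinct xs" and m: "0 < m"
  shows "(\<integral>x. indicator (cbox ((-m) *\<^sub>R One) (m *\<^sub>R One)) x * F x \<partial>lborel) = margs m xs (\<lambda>y. F (\<Sum>b\<in>Basis. y b *\<^sub>R b)) (\<lambda>_. undefined)"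
proof -
  have [measurable]: "F \<in> borel_measurable borel" by fact
  have meas: "(\<lambda>y. \<Sum>b\<in>Basis. y b *\<^sub>R b) \<in> (\<Pi>\<^sub>M b\<in>Basis. lborel) \<rightarrow>\<^sub>M (borel :: 'a measure)"
    by measurable
  have "(\<lambda>y. \<Sum>b\<in>Basis. y b *\<^sub>R b) \<in> (\<Pi>\<^sub>M b\<in>UNIV. borel) \<rightarrow>\<^sub>M (borel :: 'a measure)"
    by measurable
  from measurable_compose[OF this F]
  have pb: "pos_bdd (\<lambda>y. F (\<Sum>b\<in>Basis. y b *\<^sub>R b))"
    using c unfolding pos_bdd_def by blast
  have ind: "indicator (cbox ((-m) *\<^sub>R One) (m *\<^sub>R One)) (\<Sum>b\<in>Basis. y b *\<^sub>R b :: 'a) = (\<Prod>b\<in>Basis. indicator {-m..m} (y b) :: real)" for y :: "'a \<Rightarrow> real"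
  proof (cases "\<forall>b\<in>Basis. y b \<in> {-m..m}")
    case True
    then have "(\<Sum>b\<in>Basis. y b *\<^sub>R b :: 'a) \<in> cbox ((-m) *\<^sub>R One) (m *\<^sub>R One)"
      by (auto simp: mem_box)
    with True show ?thesis by (simp add: indicator_def)
  next
    case False
    then have "(\<Sum>b\<in>Basis. y b *\<^sub>R b :: 'a) \<notin> cbox ((-m) *\<^sub>R One) (m *\<^sub>R One)"
      by (auto simp: mem_box)
    moreover have "(\<Prod>b\<in>Basis. indicator {-m..m} (y b) :: real) = 0"
      using False by (intro prod_zero) (auto simp: indicator_def)
    ultimately show ?thesis by (simp add: indicator_def)
  qed
  have "(\<integral>x. indicator (cbox ((-m) *\<^sub>R One) (m *\<^sub>R One)) x * F x \<partial>lborel) =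
    (\<integral>x. indicator (cbox ((-m) *\<^sub>R One) (m *\<^sub>R One)) x * F x \<partial>(distr (\<Pi>\<^sub>M b\<in>Basis. lborel) borel (\<lambda>f. \<Sum>b\<in>Basis. f b *\<^sub>R b)))"
    by (subst lborel_eq) (rule refl)
  also have "\<dots> = (\<integral>y. (\<Prod>b\<in>Basis. indicator {-m..m} (y b)) * F (\<Sum>b\<in>Basis. y b *\<^sub>R b) \<partial>(\<Pi>\<^sub>M b\<in>Basis. lborel))"
    by (subst integral_distr[OF meas]) (simp_all add: ind del: scaleR_minus_left)
  also have "\<dots> = margs m xs (\<lambda>y. F (\<Sum>b\<in>Basis. y b *\<^sub>R b)) (\<lambda>_. undefined)"
    using PiM_box_integral_eq_margs[OF pb xs(2) m] xs(1) by simp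
  finally show ?thesis .
qed

text \<open>Each of the \<open>n\<close> directions bounds \<open>\<phi> x\<close> by a line
  integral of \<open>F\<close>. Raising these bounds to the power \<open>1 / (n - 1)\<close> and
  multiplying them yields \<open>\<phi> x powr (n / (n - 1))\<close> below a product of marginals,
  which \<open>margs_prod_le\<close> integrates. \<open>F\<close> will be a gradient norm plus a
  positive constant.\<close>

lemma Gagliardo_Nirenberg_lines:
  fixes \<phi> F :: "'a::euclidean_space \<Rightarrow> real"
  assumes F: "F \<in> borel_measurable borel" and c: "0 < c" "\<And>x. c \<le> F x" "\<And>x. F x \<le> C"
    and \<phi>: "\<phi> \<in> borel_measurable borel" "\<And>x. 0 \<le> \<phi> x"
    and line: "\<And>x b. b \<in> Basis \<Longrightarrow> x \<in> cbox ((-m) *\<^sub>R One) (m *\<^sub>R One) \<Longrightarrow>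
       \<phi> x \<le> (\<integral>t. indicator {-m..m} t * F (x + (t - x \<bullet> b) *\<^sub>R b) \<partial>lborel)"
    and m: "0 < m" and dim: "DIM('a) \<ge> 2"
  defines "n \<equiv> real DIM('a)"
  shows "(\<integral>x. indicator (cbox ((-m) *\<^sub>R One) (m *\<^sub>R One)) x * \<phi> x powr (n / (n - 1)) \<partial>lborel)
    \<le> (\<integral>x. indicator (cbox ((-m) *\<^sub>R One) (m *\<^sub>R One)) x * F x \<partial>lborel) powr (n / (n - 1))"
proof -
  let ?B = "cbox ((-m) *\<^sub>R One) (m *\<^sub>R One) :: 'a set"
  let ?e = "\<lambda>y. (\<Sum>b\<in>Basis. y b *\<^sub>R b) :: 'a"
  \<comment> \<open>With this \<open>p\<close> the exponent \<open>1 - (length xs - 1) * p\<close>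
    of \<open>f\<close> in \<open>margs_prod_le\<close> is 0, so only the marginals remain, and
    \<open>1 + p\<close> is the required power.\<close>
  define p where "p = 1 / (n - 1)"
  obtain xs where xs: "set xs = (Basis :: 'a set)" "distinct xs"
    using finite_distinct_list[OF finite_Basis] by blast
  have n: "n > 1" using dim by (simp add: n_def)
  have np: "(n - 1) * p = 1" "1 + p = n / (n - 1)" "0 \<le> p"
    using n by (auto simp: p_def field_simps)
  have len: "real (length xs) = n"
    using xs by (metis distinct_card n_def)
  define f where "f = (\<lambda>y. F (?e y))"
  have em: "?e \<in> (\<Pi>\<^sub>M b\<in>UNIV. borel) \<rightarrow>\<^sub>M (borel :: 'a measure)"
    by measurable
  have pb: "pos_bdd f"
    using measurable_compose[OF em F] c unfolding pos_bdd_def f_def by blast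
  note F[measurable]
  define L where "L b x = (\<integral>t. indicator {-m..m} t * F (x + (t - x \<bullet> b) *\<^sub>R b) \<partial>lborel)" for b x :: 'a
  have upd: "?e (y(b := t)) = ?e y + (t - ?e y \<bullet> b) *\<^sub>R b" if "b \<in> Basis" for y b t
  proof (rule euclidean_eqI)
    fix d :: 'a assume "d \<in> Basis"
    then show "?e (y(b := t)) \<bullet> d = (?e y + (t - ?e y \<bullet> b) *\<^sub>R b) \<bullet> d"
      using that by (auto simp: inner_add_left inner_Basis)
  qed
  have margL: "marg m b f y = L b (?e y)" if "b \<in> Basis" for b y
    unfolding marg_def L_def f_def upd[OF that] ..
  have Lb: "\<exists>c'>0. \<exists>C'. \<forall>x. c' \<le> L b x \<and> L b x \<le> C'" if "b \<in> Basis" for b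
  proof -
    have *: "L b x = marg m b f (\<lambda>d. x \<bullet> d)" for x
      by (simp add: margL[OF that] euclidean_representation)
    show ?thesis using pos_bdd_marg[OF pb m, of b] unfolding * pos_bdd_def by blast
  qed
  have [measurable]: "L b \<in> borel_measurable borel" for b
    unfolding L_def by (intro lborel.borel_measurable_lebesgue_integral) measurable
  define P where "P x = (\<Prod>b\<in>Basis. L b x powr p)" for x
  have Pf: "P (?e y) = f y powr (1 - (real (length xs) - 1) * p) * (\<Prod>j\<in>set xs. marg m j f y powr p)" for y
    using pos_bdd_pos[OF pb, of y] by (simp add: len np P_def xs margL)
  have pbP: "pos_bdd (\<lambda>y. P (?e y))"
    unfolding Pf using pb np m len by (intro pos_bdd_mult pos_bdd_powr pos_bdd_prod pos_bdd_marg) auto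
  have "\<forall>x. \<exists>y. x = ?e y"
    by (metis euclidean_representation)
  then obtain c' C' where c': "0 < c'" "\<And>x. c' \<le> P x" "\<And>x. P x \<le> C'"
    using pbP unfolding pos_bdd_def by metis
  have [measurable]: "P \<in> borel_measurable borel"
    unfolding P_def by measurable
  have ii: "integrable lborel (\<lambda>x. indicator ?B x * h x)" if "h \<in> borel_measurable borel" "\<And>x. x \<in> ?B \<Longrightarrow> \<bar>h x\<bar> \<le> K" for h :: "'a \<Rightarrow> real" and K
  proof (rule Bochner_Integration.integrable_bound)
    show "integrable lborel (\<lambda>x. indicator ?B x * K :: real)"
      by (intro integrable_mult_left integrable_real_indicator) (auto simp: emeasure_lborel_cbox_eq)
    show "AE x in lborel. norm (indicator ?B x * h x) \<le> norm (indicator ?B x * K :: real)"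
      using that(2) by (auto simp: indicator_def intro!: AE_I2 order_trans[OF _ abs_ge_self])
  qed (use that in measurable)
  have le: "\<phi> x powr (n / (n - 1)) \<le> P x" if "x \<in> ?B" for x
  proof -
    have "\<phi> x powr (n / (n - 1)) = (\<Prod>b\<in>(Basis :: 'a set). \<phi> x powr p)"
    proof (cases "\<phi> x = 0")
      case False
      then have "(\<Prod>b\<in>(Basis :: 'a set). \<phi> x powr p) = \<phi> x powr (p * n)"
        using \<phi>(2)[of x] by (simp add: n_def powr_powr flip: powr_realpow)
      then show ?thesis by (simp add: p_def)
    qed (simp add: prod_zero_iff)
    also have "\<dots> \<le> P x"
      unfolding P_def using line[OF _ that] \<phi>(2)[of x] np by (intro prod_mono) (auto intro!: powr_mono2 simp: L_def)
    finally show ?thesis .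
  qed
  have "(\<integral>x. indicator ?B x * \<phi> x powr (n / (n - 1)) \<partial>lborel) \<le> (\<integral>x. indicator ?B x * P x \<partial>lborel)"
  proof (intro integral_mono)
    show "integrable lborel (\<lambda>x. indicator ?B x * \<phi> x powr (n / (n - 1)))"
    proof (rule ii)
      show "\<bar>\<phi> x powr (n / (n - 1))\<bar> \<le> C'" if "x \<in> ?B" for x
        using le[OF that] c'(3)[of x] by simp
    qed (use \<phi> in measurable)
    show "integrable lborel (\<lambda>x. indicator ?B x * P x)"
      by (rule ii[of _ "C'"]) (use c' in \<open>auto intro!: abs_leI intro: order_trans[OF _ order_trans[OF less_imp_le[OF c'(1)]]]\<close>, smt (verit))
    show "indicator ?B x * \<phi> x powr (n / (n - 1)) \<le> indicator ?B x * P x" for x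
      using le[of x] by (auto simp: indicator_def)
  qed
  also have "\<dots> = margs m xs (\<lambda>y. P (?e y)) (\<lambda>_. undefined)"
    using c' xs m by (intro lborel_box_integral_eq_margs) auto
  also have "\<dots> \<le> margs m xs f (\<lambda>_. undefined) powr (1 + p)"
    unfolding Pf using pb xs np m len by (intro margs_prod_le) auto
  also have "margs m xs f (\<lambda>_. undefined) = (\<integral>x. indicator ?B x * F x \<partial>lborel)"
    unfolding f_def using assms xs by (intro lborel_box_integral_eq_margs[symmetric]) auto
  finally show ?thesis
    by (simp add: np)
qed

section \<open>Test functions and the Gagliardo-Nirenberg inequality for them\<close>

lemma test_funD:
  assumes "test_fun \<Omega> \<phi> D"
  shows "continuous_on UNIV \<phi>" "continuous_on UNIV D"
    "\<And>x. x \<notin> closure {x. \<phi> x \<noteq> 0} \<Longrightarrow> \<phi> x = 0" "\<And>x. x \<notin> closure {x. \<phi> x \<noteq> 0} \<Longrightarrow> D x = 0"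
    "\<And>x. x \<notin> \<Omega> \<Longrightarrow> \<phi> x = 0" "\<And>x. x \<notin> \<Omega> \<Longrightarrow> D x = 0"
    "\<And>x. (\<phi> has_derivative (\<lambda>h. D x \<bullet> h)) (at x)" "compact (closure {x. \<phi> x \<noteq> 0})"
proof -
  have d: "\<And>x. (\<phi> has_derivative (\<lambda>h. D x \<bullet> h)) (at x)"
    and sub: "closure {x. \<phi> x \<noteq> 0} \<subseteq> \<Omega>"
    using assms unfolding test_fun_def by blast+
  from d show "continuous_on UNIV \<phi>"
    by (intro continuous_at_imp_continuous_on ballI has_derivative_continuous)
  show z: "\<phi> x = 0" if "x \<notin> closure {x. \<phi> x \<noteq> 0}" for x
    using that closure_subset[of "{x. \<phi> x \<noteq> 0}"] by blast
  show zD: "D x = 0" if x: "x \<notin> closure {x. \<phi> x \<noteq> 0}" for x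
  proof -
    \<comment> \<open>\<open>\<phi>\<close> is 0 on the open complement of its closed support, so
      the derivative at \<open>x\<close> is that of a constant.\<close>
    have "((\<lambda>x. 0) has_derivative (\<lambda>h. D x \<bullet> h)) (at x)"
      by (rule has_derivative_transform_within_open[OF d, of "- closure {x. \<phi> x \<noteq> 0}"])
         (use x in \<open>auto dest: z\<close>)
    then have "(\<lambda>h. D x \<bullet> h) = (\<lambda>h. 0)"
      by (intro has_derivative_unique[of "\<lambda>_. 0" _ x]) auto
    then show ?thesis
      by (simp add: fun_eq_iff)
  qed
  show "\<And>x. x \<notin> \<Omega> \<Longrightarrow> \<phi> x = 0" "\<And>x. x \<notin> \<Omega> \<Longrightarrow> D x = 0"
    using sub z zD by blast+
qed (use assms in \<open>unfold test_fun_def, blast+\<close>)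

lemma integrable_compact_support:
  fixes h :: "'a::euclidean_space \<Rightarrow> 'b::{banach, second_countable_topology}"
  assumes "continuous_on UNIV h" "compact K" "\<And>x. x \<notin> K \<Longrightarrow> h x = 0"
  shows "integrable lborel h"
proof -
  have "integrable lborel (\<lambda>x. indicator K x *\<^sub>R h x)"
    using assms by (intro borel_integrable_compact) (auto intro: continuous_on_subset)
  moreover have "(\<lambda>x. indicator K x *\<^sub>R h x) = h"
    using assms(3) by (auto simp: indicator_def)
  ultimately show ?thesis by simp
qed

lemma test_fun_comp:
  assumes \<phi>: "test_fun \<Omega> \<phi> D" and T: "\<And>s. (T has_real_derivative T' s) (at s)"
    and T': "continuous_on UNIV T'" and T0: "T 0 = 0"
  shows "test_fun \<Omega> (\<lambda>x. T (\<phi> x)) (\<lambda>x. T' (\<phi> x) *\<^sub>R D x)"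
  unfolding test_fun_def
proof (intro conjI allI)
  note tf = test_funD[OF \<phi>]
  show "((\<lambda>x. T (\<phi> x)) has_derivative (\<lambda>h. (T' (\<phi> x) *\<^sub>R D x) \<bullet> h)) (at x)" for x
    using diff_chain_at[OF tf(7)[of x], of T "(*) (T' (\<phi> x))"] T[of "\<phi> x"]
    by (simp add: has_field_derivative_def o_def inner_scaleR_left)
  show "continuous_on UNIV (\<lambda>x. T' (\<phi> x) *\<^sub>R D x)"
    using tf(1,2) by (intro continuous_intros continuous_on_compose2[OF T']) auto
  have sub: "closure {x. T (\<phi> x) \<noteq> 0} \<subseteq> closure {x. \<phi> x \<noteq> 0}"
    using T0 by (intro closure_mono) auto
  then show "compact (closure {x. T (\<phi> x) \<noteq> 0})"
    using tf(8) bounded_subset by (metis closed_closure compact_eq_bounded_closed)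
  show "closure {x. T (\<phi> x) \<noteq> 0} \<subseteq> \<Omega>"
    using sub \<phi> by (auto simp: test_fun_def)
qed

text \<open>Integrating the directional derivative from a face of a box around the support gives the
  line bounds. Because \<open>Gagliardo_Nirenberg_lines\<close> wants \<open>F\<close> bounded away
  from 0, it is applied to \<open>norm (D x) + e\<close>, and \<open>e\<close> then tends to
  0.\<close>

lemma Gagliardo_Nirenberg_test_fun:
  fixes \<phi> :: "real^'n \<Rightarrow> real"
  assumes \<phi>: "test_fun \<Omega> \<phi> D" and dim: "CARD('n) \<ge> 2"
  defines "n \<equiv> real CARD('n)"
  shows "(\<integral>x. \<bar>\<phi> x\<bar> powr (n / (n - 1)) \<partial>lborel) \<le> (\<integral>x. norm (D x) \<partial>lborel) powr (n / (n - 1))"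
proof -
  note tf = test_funD[OF \<phi>]
  let ?K = "closure {x. \<phi> x \<noteq> 0}"
  obtain m0 where m0: "\<And>x. x \<in> ?K \<Longrightarrow> norm x \<le> m0"
    using compact_imp_bounded[OF tf(8)] by (auto simp: bounded_iff)
  \<comment> \<open>The added 1 puts the support strictly inside the box, so every line enters the
    box at a point where \<open>\<phi>\<close> vanishes.\<close>
  define m where "m = \<bar>m0\<bar> + 1"
  have m: "0 < m" "\<And>x. x \<in> ?K \<Longrightarrow> norm x < m"
    by (auto simp: m_def dest!: m0)
  let ?B = "cbox ((-m) *\<^sub>R One) (m *\<^sub>R One) :: (real^'n) set"
  have KB: "?K \<subseteq> ?B"
  proof
    fix x assume "x \<in> ?K"
    then have "\<bar>x \<bullet> b\<bar> \<le> m" if "b \<in> Basis" for b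
      using m(2) Basis_le_norm[OF that, of x] by fastforce
    then show "x \<in> ?B" by (auto simp: mem_box abs_le_iff minus_le_iff)
  qed
  have cn: "continuous_on UNIV (\<lambda>x. norm (D x))"
    using tf(2) by (intro continuous_intros) auto
  have "compact ((\<lambda>x. norm (D x)) ` ?K)"
    using tf(8) by (intro compact_continuous_image) (auto intro: continuous_on_subset[OF cn])
  then have "bounded ((\<lambda>x. norm (D x)) ` ?K)"
    by (rule compact_imp_bounded)
  then obtain C0 where "\<forall>x\<in>?K. norm (D x) \<le> C0"
    by (auto simp: bounded_iff)
  then have C: "norm (D x) \<le> \<bar>C0\<bar>" for x
    using tf(4)[of x] by (cases "x \<in> ?K") (auto intro: order_trans)
  have [measurable]: "\<phi> \<in> borel_measurable borel" "D \<in> borel_measurable borel"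
    using tf(1,2) by (auto intro: borel_measurable_continuous_onI)
  have outside: "\<phi> x = 0" "D x = 0" if "x \<notin> ?B" for x
    using that KB tf(3,4) by blast+
  have nD: "n = real DIM(real^'n)"
    by (simp add: n_def)
  let ?q = "n / (n - 1)"
  have q: "?q > 0" using dim by (simp add: n_def)
  define A where "A = (\<integral>x. indicator ?B x * norm (D x) \<partial>lborel)"
  define V where "V = (\<integral>x. indicator ?B x \<partial>lborel :: real)"
  have A0: "A \<ge> 0" unfolding A_def by (intro Bochner_Integration.integral_nonneg) auto
  have V0: "V \<ge> 0" unfolding V_def by (intro Bochner_Integration.integral_nonneg) auto
  define X where "X = (\<integral>x. indicator ?B x * \<bar>\<phi> x\<bar> powr ?q \<partial>lborel)"
  have iB: "integrable lborel (indicat_real ?B)"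
    by (intro integrable_real_indicator) (auto simp: emeasure_lborel_cbox_eq)
  have *: "X \<le> (A + e * V) powr ?q" if e: "0 < e" for e
  proof -
    have "X \<le> (\<integral>x. indicator ?B x * (norm (D x) + e) \<partial>lborel) powr ?q"
      unfolding X_def nD
    proof (rule Gagliardo_Nirenberg_lines[where C = "\<bar>C0\<bar> + e" and c = e])
      fix x b :: "real^'n" assume b: "b \<in> Basis" and x: "x \<in> ?B"
      define h where "h t = \<phi> (x + (t - x \<bullet> b) *\<^sub>R b)" for t
      define h' where "h' t = D (x + (t - x \<bullet> b) *\<^sub>R b) \<bullet> b" for t
      have xb: "-m \<le> x \<bullet> b" "x \<bullet> b \<le> m" using x b by (auto simp: mem_box)
      have b1: "b \<bullet> b = 1" using b by simp
      have dh: "(h has_real_derivative h' t) (at t)" for t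
      proof -
        have "((\<lambda>t. x + (t - x \<bullet> b) *\<^sub>R b) has_derivative (\<lambda>d. d *\<^sub>R b)) (at t)"
          by (auto intro!: derivative_eq_intros)
        from diff_chain_at[OF this tf(7)] show ?thesis
          by (simp add: h_def[abs_def] h'_def has_field_derivative_def o_def mult_commute_abs)
      qed
      have ch: "continuous_on UNIV (\<lambda>t. norm (D (x + (t - x \<bullet> b) *\<^sub>R b)))"
        by (intro continuous_on_compose2[OF cn] continuous_intros) auto
      have ch': "continuous_on UNIV h'"
        unfolding h'_def by (intro continuous_intros continuous_on_compose2[OF tf(2)]) auto
      have hm: "h (-m) = 0"
      proof -
        have "\<bar>(x + (- m - x \<bullet> b) *\<^sub>R b) \<bullet> b\<bar> = m"
          using b1 m by (simp add: inner_add_left)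
        then have "m \<le> norm (x + (- m - x \<bullet> b) *\<^sub>R b)"
          using Basis_le_norm[OF b] by metis
        then have "x + (- m - x \<bullet> b) *\<^sub>R b \<notin> ?K" using m(2) by fastforce
        then show ?thesis unfolding h_def by (rule tf(3))
      qed
      have "(\<integral>t. h' t * indicator {-m..x \<bullet> b} t \<partial>lborel) = h (x \<bullet> b) - h (-m)"
        using xb dh ch' by (intro integral_FTC_Icc_real) (auto simp: continuous_on_eq_continuous_at)
      then have "\<bar>\<phi> x\<bar> = \<bar>\<integral>t. h' t * indicator {-m..x \<bullet> b} t \<partial>lborel\<bar>"
        using hm by (simp add: h_def)
      also have "\<dots> \<le> (\<integral>t. \<bar>h' t * indicator {-m..x \<bullet> b} t\<bar> \<partial>lborel)"
        by (rule integral_abs_bound)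
      also have "\<dots> \<le> (\<integral>t. indicator {- m..m} t * (norm (D (x + (t - x \<bullet> b) *\<^sub>R b)) + e) \<partial>lborel)"
      proof (rule integral_mono)
        have i: "integrable lborel (\<lambda>t. indicator {u..v} t *\<^sub>R k t)" if "continuous_on UNIV k" for u v and k :: "real \<Rightarrow> real"
          using that by (intro borel_integrable_compact) (auto intro: continuous_on_subset)
        show "integrable lborel (\<lambda>t. \<bar>h' t * indicator {-m..x \<bullet> b} t\<bar>)"
          using i[OF ch', of "-m" "x \<bullet> b"] by (simp add: mult.commute)
        show "integrable lborel (\<lambda>t. indicator {- m..m} t * (norm (D (x + (t - x \<bullet> b) *\<^sub>R b)) + e))"
          using i[OF continuous_on_add[OF ch continuous_on_const], of "-m" m e] by simp
        fix t
        have "\<bar>h' t\<bar> \<le> norm (D (x + (t - x \<bullet> b) *\<^sub>R b))"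
          unfolding h'_def using Cauchy_Schwarz_ineq2[of _ b] b by simp
        then show "\<bar>h' t * indicator {-m..x \<bullet> b} t\<bar> \<le> indicator {- m..m} t * (norm (D (x + (t - x \<bullet> b) *\<^sub>R b)) + e)"
          using xb e by (auto simp: indicator_def)
      qed
      finally show "\<bar>\<phi> x\<bar> \<le> \<dots>" .
    qed (use C m(1) dim e in auto)
    also have "(\<integral>x. indicator ?B x * (norm (D x) + e) \<partial>lborel) = A + e * V"
    proof -
      have "integrable lborel (\<lambda>x. indicator ?B x * norm (D x))"
        using borel_integrable_compact[of ?B "\<lambda>x. norm (D x)"] cn by (auto intro: continuous_on_subset)
      then show ?thesis using iB
        unfolding A_def V_def distrib_left
        by (subst Bochner_Integration.integral_add) (auto simp: mult.commute[of _ e] simp del: scaleR_minus_left)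
    qed
    finally show ?thesis .
  qed
  have "X \<le> A powr ?q"
  proof (rule tendsto_lowerbound)
    have "((\<lambda>e. (A + e * V) powr ?q) \<longlongrightarrow> (A + 0 * V) powr ?q) (at_right 0)"
    proof (rule tendsto_powr')
      show "A + 0 * V \<noteq> 0 \<or> (0 < ?q \<and> (\<forall>\<^sub>F e in at_right 0. 0 \<le> A + e * V))"
        using q A0 V0 by (auto simp: eventually_at_filter intro!: always_eventually)
    qed (intro tendsto_intros)+
    then show "((\<lambda>e. (A + e * V) powr ?q) \<longlongrightarrow> A powr ?q) (at_right 0)" by simp
    show "\<forall>\<^sub>F e in at_right 0. X \<le> (A + e * V) powr ?q"
      using * by (auto simp: eventually_at_filter)
  qed simp
  moreover have "X = (\<integral>x. \<bar>\<phi> x\<bar> powr ?q \<partial>lborel)"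
    unfolding X_def by (intro Bochner_Integration.integral_cong refl) (auto simp: indicator_def dest: outside simp del: mem_box scaleR_minus_left)
  moreover have "A = (\<integral>x. norm (D x) \<partial>lborel)"
    unfolding A_def by (intro Bochner_Integration.integral_cong refl) (auto simp: indicator_def dest: outside simp del: mem_box scaleR_minus_left)
  ultimately show ?thesis by simp
qed

section \<open>Sobolev inequality and chain rule\<close>

lemma abs_powr_has_real_derivative:
  fixes s :: real
  assumes "1 < p"
  shows "((\<lambda>s. \<bar>s\<bar> powr p) has_real_derivative p * \<bar>s\<bar> powr (p - 1) * sgn s) (at s)"
proof -
  consider "s > 0" | "s < 0" | "s = 0" by linarith
  then show ?thesis
  proof cases
    case 1
    have "((\<lambda>s. s powr p) has_real_derivative p * s powr (p - 1)) (at s)"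
      using 1 by (auto intro!: derivative_eq_intros)
    then have "((\<lambda>s. \<bar>s\<bar> powr p) has_real_derivative p * s powr (p - 1)) (at s)"
      by (rule has_field_derivative_transform_within_open[where S = "{0<..}"]) (use 1 in auto)
    then show ?thesis using 1 by simp
  next
    case 2
    have "((\<lambda>s. (-s) powr p) has_real_derivative p * (-s) powr (p - 1) * (-1)) (at s)"
      using 2 by (auto intro!: derivative_eq_intros)
    then have "((\<lambda>s. \<bar>s\<bar> powr p) has_real_derivative p * (-s) powr (p - 1) * (-1)) (at s)"
      by (rule has_field_derivative_transform_within_open[where S = "{..<0}"]) (use 2 in auto)
    then show ?thesis using 2 by simp
  next
    case 3
    have "((\<lambda>h. \<bar>h\<bar> powr (p - 1)) \<longlongrightarrow> \<bar>0::real\<bar> powr (p - 1)) (at 0)"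
      using assms by (intro tendsto_powr' tendsto_rabs tendsto_ident_at tendsto_const) auto
    then have "((\<lambda>h. norm ((\<bar>0 + h\<bar> powr p - \<bar>0\<bar> powr p) / h)) \<longlongrightarrow> 0) (at 0)"
    proof (rule Lim_transform_eventually[THEN tendsto_eq_rhs])
      show "\<forall>\<^sub>F h in at 0. \<bar>h\<bar> powr (p - 1) = norm ((\<bar>0 + h\<bar> powr p - \<bar>0\<bar> powr p) / h)"
        using assms by (auto simp: eventually_at_filter powr_diff)
    qed simp
    then have "((\<lambda>h. (\<bar>0 + h\<bar> powr p - \<bar>0\<bar> powr p) / h) \<longlongrightarrow> (0::real)) (at 0)"
      by (rule tendsto_norm_zero_cancel)
    then show ?thesis using 3 by (simp add: DERIV_def)
  qed
qed

lemma continuous_abs_powr_sgn: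
  fixes p :: real
  assumes "0 < p"
  shows "continuous_on UNIV (\<lambda>s::real. \<bar>s\<bar> powr p * sgn s)"
proof -
  have "isCont (\<lambda>s::real. \<bar>s\<bar> powr p * sgn s) s" for s :: real
  proof (cases "s = 0")
    case True
    have "((\<lambda>h. \<bar>h\<bar> powr p) \<longlongrightarrow> \<bar>0::real\<bar> powr p) (at 0)"
      using assms by (intro tendsto_powr' tendsto_rabs tendsto_ident_at tendsto_const) auto
    then have "((\<lambda>h::real. norm (\<bar>h\<bar> powr p * sgn h)) \<longlongrightarrow> 0) (at 0)"
      using assms by (auto simp: abs_mult intro: Lim_transform_eventually simp: eventually_at_filter sgn_if)
    then have "((\<lambda>h::real. \<bar>h\<bar> powr p * sgn h) \<longlongrightarrow> 0) (at 0)"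
      by (rule tendsto_norm_zero_cancel)
    then show ?thesis using True by (simp add: isCont_def)
  next
    case False
    have "isCont sgn s"
      using False by (rule isCont_sgn[OF continuous_ident])
    then show ?thesis using False
      by (intro continuous_intros) auto
  qed
  then show ?thesis by (simp add: continuous_on_eq_continuous_at)
qed

text \<open>Gagliardo-Nirenberg for \<open>\<bar>\<phi>\<bar> powr \<gamma>\<close>, followed by
  Cauchy-Schwarz. The exponent \<open>\<gamma>\<close> is determined by
  \<open>\<gamma> * n / (n - 1) = 2 * (\<gamma> - 1)\<close>: then the same integral
  \<open>A\<close> of the critical power appears on both sides, on the right only to the power
  \<open>q / 2 < 1\<close>, and can be divided out.\<close>

lemma Sobolev_test_fun:
  fixes \<phi> :: "real^'n \<Rightarrow> real"
  assumes \<phi>: "test_fun \<Omega> \<phi> D" and dim: "CARD('n) \<ge> 3"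
  defines "n \<equiv> real CARD('n)"
  shows "(\<integral>x. \<bar>\<phi> x\<bar> powr (2 * n / (n - 2)) \<partial>lborel)
    \<le> ((2 * (n - 1) / (n - 2))\<^sup>2 * (\<integral>x. (norm (D x))\<^sup>2 \<partial>lborel)) powr (n / (n - 2))"
proof -
  note tf = test_funD[OF \<phi>]
  define \<gamma> where "\<gamma> = 2 * (n - 1) / (n - 2)"
  define s where "s = 2 * n / (n - 2)"
  define q where "q = n / (n - 1)"
  have n: "n \<ge> 3" using dim by (simp add: n_def)
  have \<gamma>1: "\<gamma> > 1" and s0: "s > 0" and \<gamma>s: "\<gamma> - 1 = s / 2" and q: "0 < q" "q < 2"
    using n by (auto simp: \<gamma>_def s_def q_def field_simps)
  have \<gamma>q: "\<gamma> * q = s"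
    using n by (simp add: \<gamma>_def s_def q_def divide_simps)
  define A where "A = (\<integral>x. \<bar>\<phi> x\<bar> powr s \<partial>lborel)"
  define B where "B = (\<integral>x. (norm (D x))\<^sup>2 \<partial>lborel)"
  have [continuous_intros]: "continuous_on UNIV (\<lambda>x. \<bar>\<phi> x\<bar> powr t)" if "t > 0" for t
    using tf(1) that by (intro continuous_on_powr') (auto intro!: continuous_intros)
  have Z: "\<phi> x = 0" "D x = 0" if "x \<notin> closure {x. \<phi> x \<noteq> 0}" for x
    using tf(3,4) that by blast+
  have iA: "integrable lborel (\<lambda>x. \<bar>\<phi> x\<bar> powr s)"
    by (rule integrable_compact_support[OF _ tf(8)]) (auto intro!: continuous_intros s0 dest: Z)
  have iB: "integrable lborel (\<lambda>x. (norm (D x))\<^sup>2)"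
    by (rule integrable_compact_support[OF _ tf(8)]) (auto intro!: continuous_intros tf(2) dest: Z)
  have A0: "A \<ge> 0" and B0: "B \<ge> 0" unfolding A_def B_def by (auto intro!: Bochner_Integration.integral_nonneg)
  let ?T' = "\<lambda>s. \<gamma> * \<bar>s\<bar> powr (\<gamma> - 1) * sgn s"
  have tf\<gamma>: "test_fun \<Omega> (\<lambda>x. \<bar>\<phi> x\<bar> powr \<gamma>) (\<lambda>x. ?T' (\<phi> x) *\<^sub>R D x)"
  proof (rule test_fun_comp[OF \<phi>, where T = "\<lambda>s. \<bar>s\<bar> powr \<gamma>"])
    show "((\<lambda>s. \<bar>s\<bar> powr \<gamma>) has_real_derivative ?T' s) (at s)" for s
      by (rule abs_powr_has_real_derivative[OF \<gamma>1])
    show "continuous_on UNIV ?T'"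
      unfolding mult.assoc using \<gamma>1 by (intro continuous_on_mult continuous_on_const continuous_abs_powr_sgn) auto
  qed auto
  have nrm: "norm (?T' (\<phi> x) *\<^sub>R D x) = \<gamma> * ((\<bar>\<phi> x\<bar> powr s) powr (1/2) * ((norm (D x))\<^sup>2) powr (1/2))" for x
    using \<gamma>1 unfolding \<gamma>s by (auto simp: abs_mult sgn_if powr_powr powr_half_sqrt)
  have "A = (\<integral>x. \<bar>\<bar>\<phi> x\<bar> powr \<gamma>\<bar> powr q \<partial>lborel)"
    by (simp add: A_def powr_powr \<gamma>q)
  also have "\<dots> \<le> (\<integral>x. norm (?T' (\<phi> x) *\<^sub>R D x) \<partial>lborel) powr q"
    using Gagliardo_Nirenberg_test_fun[OF tf\<gamma>] dim by (simp add: q_def n_def)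
  also have "\<dots> \<le> (\<gamma> * (A powr (1/2) * B powr (1/2))) powr q"
  proof (rule powr_mono2)
    have "(\<integral>x. norm (?T' (\<phi> x) *\<^sub>R D x) \<partial>lborel) = \<gamma> * (\<integral>x. (\<bar>\<phi> x\<bar> powr s) powr (1/2) * ((norm (D x))\<^sup>2) powr (1/2) \<partial>lborel)"
      unfolding nrm by simp
    also have "\<dots> \<le> \<gamma> * (A powr (1/2) * B powr (1/2))"
      unfolding A_def B_def using \<gamma>1 by (intro mult_left_mono Holder_two iA iB) auto
    finally show "(\<integral>x. norm (?T' (\<phi> x) *\<^sub>R D x) \<partial>lborel) \<le> \<gamma> * (A powr (1/2) * B powr (1/2))" .
  qed (use q in auto)
  finally have main: "A \<le> (\<gamma> * (A powr (1/2) * B powr (1/2))) powr q" .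
  have "A \<le> (\<gamma>\<^sup>2 * B) powr (s / 2)"
  proof (cases "A = 0")
    case False
    then have Ap: "A > 0" using A0 by simp
    have "A \<le> A powr (q / 2) * (\<gamma>\<^sup>2 * B) powr (q / 2)"
    proof -
      have "\<gamma> = (\<gamma>\<^sup>2) powr (1/2)" using \<gamma>1 by (simp add: powr_half_sqrt)
      then have "\<gamma> * (A powr (1/2) * B powr (1/2)) = A powr (1/2) * (\<gamma>\<^sup>2 * B) powr (1/2)"
        using \<gamma>1 B0 by (subst powr_mult) (auto simp: mult_ac)
      then have "A \<le> (A powr (1/2) * (\<gamma>\<^sup>2 * B) powr (1/2)) powr q"
        using main by (simp only:)
      also have "\<dots> = (A powr (1/2)) powr q * ((\<gamma>\<^sup>2 * B) powr (1/2)) powr q"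
        by (rule powr_mult)
      finally show ?thesis
        by (simp add: powr_powr)
    qed
    then have "A powr (1 - q / 2) \<le> (\<gamma>\<^sup>2 * B) powr (q / 2)"
      using Ap by (simp add: powr_diff divide_le_eq mult.commute)
    then have "(A powr (1 - q / 2)) powr (s / q) \<le> ((\<gamma>\<^sup>2 * B) powr (q / 2)) powr (s / q)"
      using s0 q by (intro powr_mono2) auto
    moreover have "(1 - q / 2) * (s / q) = 1"
    proof -
      have "s / q = \<gamma>" using \<gamma>q q by (simp add: field_simps)
      moreover have "1 - q / 2 = 1 / \<gamma>" using n by (simp add: q_def \<gamma>_def field_simps)
      ultimately show ?thesis using \<gamma>1 by simp
    qed
    ultimately show ?thesis
      using Ap q by (simp add: powr_powr)
  qed (use s0 in auto)
  moreover have "s / 2 = n / (n - 2)"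
    using n by (simp add: s_def field_simps)
  ultimately show ?thesis
    unfolding A_def B_def \<gamma>_def by (simp only: s_def)
qed

section \<open>Integrals over the domain: Fatou's lemma and limits in L^2\<close>

lemma lebesgue_on_eq_lborel:
  fixes h :: "'a::euclidean_space \<Rightarrow> 'b::{banach, second_countable_topology}"
  assumes "h \<in> borel_measurable borel" "open \<Omega>" "\<And>x. x \<notin> \<Omega> \<Longrightarrow> h x = 0"
  shows "integral\<^sup>L (lebesgue_on \<Omega>) h = integral\<^sup>L lborel h"
    and "integrable (lebesgue_on \<Omega>) h \<longleftrightarrow> integrable lborel h"
proof -
  have *: "(\<lambda>x. indicator \<Omega> x *\<^sub>R h x) = h"
    using assms(3) by (auto simp: indicator_def)
  have "\<Omega> \<inter> space lebesgue \<in> sets lebesgue"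
    using assms(2) by auto
  then show "integral\<^sup>L (lebesgue_on \<Omega>) h = integral\<^sup>L lborel h"
    "integrable (lebesgue_on \<Omega>) h \<longleftrightarrow> integrable lborel h"
    using assms(1) by (simp_all add: integral_restrict_space integrable_restrict_space * integral_completion integrable_completion)
qed

lemma borel_measurable_lebesgue_onI:
  "h \<in> borel_measurable borel \<Longrightarrow> h \<in> borel_measurable (lebesgue_on \<Omega>)"
  by (intro measurable_restrict_space1 measurable_completion) simp

lemma borel_measurable_vec_nth [measurable (raw)]:
  fixes f :: "'a \<Rightarrow> real^'n"
  shows "f \<in> borel_measurable M \<Longrightarrow> (\<lambda>x. f x $ i) \<in> borel_measurable M"
  unfolding cart_eq_inner_axis by (intro borel_measurable_inner) auto

text \<open>Fatou's lemma. It carries the Sobolev inequality from test functions to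
  \<open>H01\<close> and later removes the truncation of the powers of \<open>u\<close>.\<close>

lemma integral_limit_le:
  fixes f :: "'a \<Rightarrow> real"
  assumes i: "\<And>k. integrable M (f' k)" and nn: "\<And>k x. 0 \<le> f' k x"
    and lim: "AE x in M. (\<lambda>k. f' k x) \<longlonglongrightarrow> f x" and f: "f \<in> borel_measurable M"
    and le: "\<And>k. (\<integral>x. f' k x \<partial>M) \<le> c' k" and c: "c' \<longlonglongrightarrow> c"
  shows "integrable M f" "(\<integral>x. f x \<partial>M) \<le> c"
proof -
  have nnf: "AE x in M. 0 \<le> f x"
    using lim by eventually_elim (rule LIMSEQ_le_const, auto simp: nn)
  have c'0: "0 \<le> c' k" for k
    using le[of k] Bochner_Integration.integral_nonneg[of M "f' k"] nn by (meson order_trans)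
  then have c0: "0 \<le> c"
    using c by (intro LIMSEQ_le_const) auto
  have "(\<integral>\<^sup>+x. ennreal (f x) \<partial>M) = (\<integral>\<^sup>+x. liminf (\<lambda>k. ennreal (f' k x)) \<partial>M)"
    using lim by (intro nn_integral_cong_AE, eventually_elim)
      (auto intro!: lim_imp_Liminf[symmetric] tendsto_ennrealI)
  also have "\<dots> \<le> liminf (\<lambda>k. \<integral>\<^sup>+x. ennreal (f' k x) \<partial>M)"
    using i by (intro nn_integral_liminf) auto
  also have "\<dots> \<le> liminf (\<lambda>k. ennreal (c' k))"
    using i nn le by (intro Liminf_mono always_eventually allI) (auto simp: nn_integral_eq_integral intro!: ennreal_leI)
  also have "\<dots> = ennreal c"
    using c by (intro lim_imp_Liminf tendsto_ennrealI) auto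
  finally have *: "(\<integral>\<^sup>+x. ennreal (f x) \<partial>M) \<le> ennreal c" .
  then show int: "integrable M f"
    using f nnf by (intro integrableI_nonneg) (auto intro: le_less_trans)
  show "(\<integral>x. f x \<partial>M) \<le> c"
    using * c0 nnf int by (simp add: nn_integral_eq_integral)
qed

lemma Cauchy_Schwarz_integral:
  fixes f g :: "'a \<Rightarrow> real"
  assumes "f \<in> borel_measurable M" "g \<in> borel_measurable M"
    and "integrable M (\<lambda>x. (f x)\<^sup>2)" "integrable M (\<lambda>x. (g x)\<^sup>2)"
  shows "integrable M (\<lambda>x. f x * g x)"
    and "(\<integral>x. \<bar>f x * g x\<bar> \<partial>M) \<le> sqrt (\<integral>x. (f x)\<^sup>2 \<partial>M) * sqrt (\<integral>x. (g x)\<^sup>2 \<partial>M)"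
proof -
  note H = Holder_two[OF assms(3,4), of "1/2" "1/2"]
  have eq: "((f x)\<^sup>2) powr (1/2) * ((g x)\<^sup>2) powr (1/2) = \<bar>f x * g x\<bar>" for x
    by (simp add: powr_half_sqrt abs_mult)
  show "integrable M (\<lambda>x. f x * g x)"
    using H(1)[unfolded eq] assms(1,2) by (intro integrable_abs_cancel[of M "\<lambda>x. f x * g x"]) auto
  have "0 \<le> (\<integral>x. (f x)\<^sup>2 \<partial>M)" "0 \<le> (\<integral>x. (g x)\<^sup>2 \<partial>M)"
    by auto
  then show "(\<integral>x. \<bar>f x * g x\<bar> \<partial>M) \<le> sqrt (\<integral>x. (f x)\<^sup>2 \<partial>M) * sqrt (\<integral>x. (g x)\<^sup>2 \<partial>M)"
    using H(2)[unfolded eq] by (simp add: powr_half_sqrt)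
qed

lemma integrable_square_diff:
  fixes f g :: "'a \<Rightarrow> 'b::euclidean_space"
  assumes [measurable]: "f \<in> borel_measurable M" "g \<in> borel_measurable M"
    and i: "integrable M (\<lambda>x. (norm (f x))\<^sup>2)" "integrable M (\<lambda>x. (norm (g x))\<^sup>2)"
  shows "integrable M (\<lambda>x. (norm (f x - g x))\<^sup>2)"
proof -
  have *: "(norm (a + b))\<^sup>2 \<le> 2 * (norm a)\<^sup>2 + 2 * (norm b)\<^sup>2" for a b :: 'b
  proof -
    have "(norm (a + b))\<^sup>2 \<le> (norm a + norm b)\<^sup>2"
      by (intro power_mono norm_triangle_ineq) auto
    also have "\<dots> \<le> 2 * (norm a)\<^sup>2 + 2 * (norm b)\<^sup>2"
      using sum_squares_bound[of "norm a" "norm b"] by (simp add: power2_sum)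
    finally show ?thesis .
  qed
  have I: "integrable M (\<lambda>x. 2 * (norm (f x))\<^sup>2 + 2 * (norm (g x))\<^sup>2)"
    using i by auto
  show "integrable M (\<lambda>x. (norm (f x - g x))\<^sup>2)"
    by (rule Bochner_Integration.integrable_bound[OF I]) (use *[of _ "- _"] in auto)
qed

lemma tendsto_integral_L2:
  fixes f :: "'a \<Rightarrow> real"
  assumes [measurable]: "\<And>k. f' k \<in> borel_measurable M" "f \<in> borel_measurable M" "h \<in> borel_measurable M"
    and i: "\<And>k. integrable M (\<lambda>x. (f' k x)\<^sup>2)" "integrable M (\<lambda>x. (f x)\<^sup>2)" "integrable M (\<lambda>x. (h x)\<^sup>2)"
    and lim: "(\<lambda>k. \<integral>x. (f' k x - f x)\<^sup>2 \<partial>M) \<longlonglongrightarrow> 0"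
  shows "(\<lambda>k. \<integral>x. f' k x * h x \<partial>M) \<longlonglongrightarrow> (\<integral>x. f x * h x \<partial>M)"
proof -
  have d: "integrable M (\<lambda>x. (f' k x - f x)\<^sup>2)" for k
    using integrable_square_diff[of "f' k" M f] i by simp
  have "(\<lambda>k. (\<integral>x. f' k x * h x \<partial>M) - (\<integral>x. f x * h x \<partial>M)) \<longlonglongrightarrow> 0"
  proof (rule tendsto_rabs_zero_cancel[OF tendsto_sandwich[OF _ _ tendsto_const]])
    have "(\<lambda>k. sqrt (\<integral>x. (f' k x - f x)\<^sup>2 \<partial>M) * sqrt (\<integral>x. (h x)\<^sup>2 \<partial>M)) \<longlonglongrightarrow> sqrt 0 * sqrt (\<integral>x. (h x)\<^sup>2 \<partial>M)"
      by (intro tendsto_intros lim)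
    then show "(\<lambda>k. sqrt (\<integral>x. (f' k x - f x)\<^sup>2 \<partial>M) * sqrt (\<integral>x. (h x)\<^sup>2 \<partial>M)) \<longlonglongrightarrow> 0"
      by simp
    show "\<forall>\<^sub>F k in sequentially. \<bar>(\<integral>x. f' k x * h x \<partial>M) - (\<integral>x. f x * h x \<partial>M)\<bar> \<le> sqrt (\<integral>x. (f' k x - f x)\<^sup>2 \<partial>M) * sqrt (\<integral>x. (h x)\<^sup>2 \<partial>M)"
    proof (intro always_eventually allI)
      fix k
      have "(\<integral>x. f' k x * h x \<partial>M) - (\<integral>x. f x * h x \<partial>M) = (\<integral>x. (f' k x - f x) * h x \<partial>M)"
        using i by (subst Bochner_Integration.integral_diff[symmetric])
          (auto intro!: Cauchy_Schwarz_integral simp: left_diff_distrib)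
      also have "\<bar>\<dots>\<bar> \<le> (\<integral>x. \<bar>(f' k x - f x) * h x\<bar> \<partial>M)"
        by (rule integral_abs_bound)
      also have "\<dots> \<le> sqrt (\<integral>x. (f' k x - f x)\<^sup>2 \<partial>M) * sqrt (\<integral>x. (h x)\<^sup>2 \<partial>M)"
        using i d by (intro Cauchy_Schwarz_integral) auto
      finally show "\<bar>(\<integral>x. f' k x * h x \<partial>M) - (\<integral>x. f x * h x \<partial>M)\<bar> \<le> sqrt (\<integral>x. (f' k x - f x)\<^sup>2 \<partial>M) * sqrt (\<integral>x. (h x)\<^sup>2 \<partial>M)" .
    qed
  qed auto
  then show ?thesis
    by (rule LIM_zero_cancel)
qed

section \<open>Integration by parts; closure of \<open>H01\<close> under limits and
  composition\<close>

lemma integral_gradient_test_fun_eq_0: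
  fixes \<phi> :: "real^'n \<Rightarrow> real"
  assumes \<phi>: "test_fun \<Omega> \<phi> D"
  shows "(\<integral>x. D x $ i \<partial>lborel) = 0"
proof -
  note tf = test_funD[OF \<phi>]
  let ?K = "closure {x. \<phi> x \<noteq> 0}"
  let ?e = "axis i 1 :: real^'n"
  obtain m where m: "\<And>x. x \<in> ?K \<Longrightarrow> norm x \<le> m"
    using compact_imp_bounded[OF tf(8)] by (auto simp: bounded_iff)
  have Z: "\<phi> x = 0" "D x = 0" if "x \<notin> ?K" for x
    using tf(3,4) that by blast+
  have cn: "continuous_on UNIV (\<lambda>x. norm (D x))"
    using tf(2) by (intro continuous_intros) auto
  have "compact ((\<lambda>x. norm (D x)) ` ?K)"
    using tf(8) by (intro compact_continuous_image) (auto intro: continuous_on_subset[OF cn])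
  then have "bounded ((\<lambda>x. norm (D x)) ` ?K)"
    by (rule compact_imp_bounded)
  then obtain C0 where "\<forall>x\<in>?K. norm (D x) \<le> C0"
    by (auto simp: bounded_iff)
  then have C: "norm (D x) \<le> \<bar>C0\<bar>" for x
    using Z(2)[of x] by (cases "x \<in> ?K") (auto intro: order_trans)
  have lip: "\<bar>\<phi> y - \<phi> x\<bar> \<le> \<bar>C0\<bar> * norm (y - x)" for x y
  proof -
    have "norm (\<phi> y - \<phi> x) \<le> \<bar>C0\<bar> * norm (y - x)"
    proof (rule differentiable_bound[of UNIV \<phi> "\<lambda>x h. D x \<bullet> h"])
      show "onorm ((\<bullet>) (D x)) \<le> \<bar>C0\<bar>" for x
      proof (rule onorm_le)
        show "norm (D x \<bullet> h) \<le> \<bar>C0\<bar> * norm h" for h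
          using Cauchy_Schwarz_ineq2[of "D x" h] mult_right_mono[OF C[of x] norm_ge_zero[of h]] by simp
      qed
    qed (use tf(7) in auto)
    then show ?thesis by simp
  qed
  define h where "h k = 1 / real (Suc k)" for k
  have h0: "0 < h k" "h k \<le> 1" for k by (auto simp: h_def)
  have hlim: "filterlim h (at 0) sequentially"
    using LIMSEQ_Suc[OF lim_inverse_n'] h0 by (auto simp: filterlim_at h_def[abs_def] intro!: always_eventually)
  have i\<phi>: "integrable lborel \<phi>"
    by (rule integrable_compact_support[OF tf(1) tf(8)]) (auto dest: Z)
  have [measurable]: "\<phi> \<in> borel_measurable borel" "D \<in> borel_measurable borel"
    using tf(1,2) by (auto intro: borel_measurable_continuous_onI)
  \<comment> \<open>These difference quotients integrate to 0 by translation invariance. They are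
    bounded by the Lipschitz constant and, as \<open>h k \<le> 1\<close>, vanish outside the ball of
    radius \<open>m + 1\<close>, so dominated convergence passes to the partial derivative.\<close>
  define q where "q k x = (\<phi> (h k *\<^sub>R ?e + x) - \<phi> x) / h k" for k x
  have q0: "(\<integral>x. q k x \<partial>lborel) = 0" for k
  proof -
    have d: "distr lborel borel ((+) (h k *\<^sub>R ?e)) = (lborel :: (real^'n) measure)"
      by (rule lborel_distr_plus)
    have "integrable lborel (\<lambda>x. \<phi> (h k *\<^sub>R ?e + x))"
      using integrable_distr_eq[of "(+) (h k *\<^sub>R ?e)" lborel borel \<phi>] i\<phi> d by simp
    moreover have "(\<integral>x. \<phi> (h k *\<^sub>R ?e + x) \<partial>lborel) = (\<integral>x. \<phi> x \<partial>lborel)"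
      using integral_distr[of "(+) (h k *\<^sub>R ?e)" lborel borel \<phi>] d by simp
    ultimately show ?thesis
      using i\<phi> by (simp add: q_def)
  qed
  have "(\<lambda>k. \<integral>x. q k x \<partial>lborel) \<longlonglongrightarrow> (\<integral>x. D x $ i \<partial>lborel)"
  proof (rule integral_dominated_convergence[where w = "\<lambda>x. indicator (cball 0 (m + 1)) x * \<bar>C0\<bar>"])
    show "integrable lborel (\<lambda>x::real^'n. indicator (cball 0 (m + 1)) x * \<bar>C0\<bar>)"
      by (intro integrable_mult_left integrable_real_indicator) (use emeasure_lborel_cball_finite in auto)
    show "AE x in lborel. (\<lambda>k. q k x) \<longlonglongrightarrow> D x $ i"
    proof (rule AE_I2)
      fix x
      have "((\<lambda>t. x + t *\<^sub>R ?e) has_derivative (\<lambda>t. t *\<^sub>R ?e)) (at 0)"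
        by (auto intro!: derivative_eq_intros)
      from diff_chain_at[OF this tf(7)]
      have "((\<lambda>t. \<phi> (x + t *\<^sub>R ?e)) has_real_derivative D x $ i) (at 0)"
        by (simp add: o_def has_field_derivative_def inner_axis mult_commute_abs)
      then have "(\<lambda>t. (\<phi> (x + (0 + t) *\<^sub>R ?e) - \<phi> (x + 0 *\<^sub>R ?e)) / t) \<midarrow>0\<rightarrow> D x $ i"
        by (simp add: DERIV_def)
      from filterlim_compose[OF this hlim] show "(\<lambda>k. q k x) \<longlonglongrightarrow> D x $ i"
        by (simp add: q_def add.commute)
    qed
    show "AE x in lborel. norm (q k x) \<le> indicator (cball 0 (m + 1)) x * \<bar>C0\<bar>" for k
    proof (rule AE_I2)
      fix x :: "real^'n"
      show "norm (q k x) \<le> indicator (cball 0 (m + 1)) x * \<bar>C0\<bar>"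
      proof (cases "norm x \<le> m + 1")
        case True
        have "\<bar>\<phi> (h k *\<^sub>R ?e + x) - \<phi> x\<bar> \<le> \<bar>C0\<bar> * h k"
          using lip[of "h k *\<^sub>R ?e + x" x] h0(1)[of k] by simp
        then show ?thesis using True h0(1)[of k] by (simp add: q_def field_simps)
      next
        case False
        have "norm x \<le> norm (h k *\<^sub>R ?e + x) + norm (h k *\<^sub>R ?e)"
          using norm_triangle_ineq4[of "h k *\<^sub>R ?e + x" "h k *\<^sub>R ?e"] by simp
        then have "norm x \<le> norm (h k *\<^sub>R ?e + x) + 1"
          using h0[of k] by simp
        then have "x \<notin> ?K" "h k *\<^sub>R ?e + x \<notin> ?K"
          using m[of x] m[of "h k *\<^sub>R ?e + x"] False by auto
        then have "\<phi> x = 0" "\<phi> (h k *\<^sub>R ?e + x) = 0" by (blast intro: Z(1))+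
        then show ?thesis by (simp add: q_def)
      qed
    qed
  qed (auto simp: q_def)
  then show ?thesis
    unfolding q0 by (simp add: LIMSEQ_const_iff)
qed

lemma test_fun_mult:
  assumes \<phi>: "test_fun \<Omega> \<phi> D" and \<psi>: "test_fun \<Omega> \<psi> E"
  shows "test_fun \<Omega> (\<lambda>x. \<phi> x * \<psi> x) (\<lambda>x. \<phi> x *\<^sub>R E x + \<psi> x *\<^sub>R D x)"
  unfolding test_fun_def
proof (intro conjI allI)
  note tf = test_funD[OF \<phi>] and tf2 = test_funD[OF \<psi>]
  show "((\<lambda>x. \<phi> x * \<psi> x) has_derivative (\<lambda>h. (\<phi> x *\<^sub>R E x + \<psi> x *\<^sub>R D x) \<bullet> h)) (at x)" for x
    using has_derivative_mult[OF tf(7)[of x] tf2(7)[of x]]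
    by (simp add: inner_add_left algebra_simps)
  show "continuous_on UNIV (\<lambda>x. \<phi> x *\<^sub>R E x + \<psi> x *\<^sub>R D x)"
    using tf(1,2) tf2(1,2) by (intro continuous_intros) auto
  have sub: "closure {x. \<phi> x * \<psi> x \<noteq> 0} \<subseteq> closure {x. \<phi> x \<noteq> 0}"
    by (rule closure_mono) auto
  show "compact (closure {x. \<phi> x * \<psi> x \<noteq> 0})"
    using bounded_subset[OF compact_imp_bounded[OF tf(8)] sub] by (simp add: compact_eq_bounded_closed)
  show "closure {x. \<phi> x * \<psi> x \<noteq> 0} \<subseteq> \<Omega>"
    using sub \<phi> unfolding test_fun_def by blast
qed

lemma test_fun_L2:
  fixes \<phi> :: "real^'n \<Rightarrow> real"
  assumes \<phi>: "test_fun \<Omega> \<phi> D" and \<Omega>: "open \<Omega>"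
  shows "\<phi> \<in> borel_measurable (lebesgue_on \<Omega>)" "D \<in> borel_measurable (lebesgue_on \<Omega>)"
    "integrable (lebesgue_on \<Omega>) (\<lambda>x. (\<phi> x)\<^sup>2)" "integrable (lebesgue_on \<Omega>) (\<lambda>x. (norm (D x))\<^sup>2)"
    "integrable (lebesgue_on \<Omega>) (\<lambda>x. (D x $ i)\<^sup>2)"
    "\<And>h :: (real^'n \<Rightarrow> real). continuous_on UNIV h \<Longrightarrow> integrable (lebesgue_on \<Omega>) (\<lambda>x. h x * \<phi> x)"
    "\<And>h :: (real^'n \<Rightarrow> real). continuous_on UNIV h \<Longrightarrow> integrable (lebesgue_on \<Omega>) (\<lambda>x. h x * D x $ i)"
proof -
  note tf = test_funD[OF \<phi>]
  have [measurable]: "\<phi> \<in> borel_measurable borel" "D \<in> borel_measurable borel"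
    using tf(1,2) by (auto intro: borel_measurable_continuous_onI)
  show "\<phi> \<in> borel_measurable (lebesgue_on \<Omega>)" "D \<in> borel_measurable (lebesgue_on \<Omega>)"
    by (auto intro: borel_measurable_lebesgue_onI)
  have Z: "\<phi> x = 0" "D x = 0" if "x \<notin> closure {x. \<phi> x \<noteq> 0}" for x
    using tf(3,4) that by blast+
  have *: "integrable (lebesgue_on \<Omega>) h" if "continuous_on UNIV h" "\<And>x. \<phi> x = 0 \<Longrightarrow> D x = 0 \<Longrightarrow> h x = 0" for h :: "real^'n \<Rightarrow> real"
  proof -
    have "integrable lborel h"
      using that by (intro integrable_compact_support[OF _ tf(8)]) (auto dest: Z)
    then show ?thesis
      using that tf(5,6) \<Omega> by (subst lebesgue_on_eq_lborel) (auto intro: borel_measurable_continuous_onI)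
  qed
  show "integrable (lebesgue_on \<Omega>) (\<lambda>x. (\<phi> x)\<^sup>2)" "integrable (lebesgue_on \<Omega>) (\<lambda>x. (norm (D x))\<^sup>2)"
    "integrable (lebesgue_on \<Omega>) (\<lambda>x. (D x $ i)\<^sup>2)"
    by (rule *; use tf(1,2) in \<open>auto intro!: continuous_intros\<close>)+
  show "integrable (lebesgue_on \<Omega>) (\<lambda>x. h x * \<phi> x)" "integrable (lebesgue_on \<Omega>) (\<lambda>x. h x * D x $ i)" if "continuous_on UNIV h" for h
    by (rule *; use tf(1,2) that in \<open>auto intro!: continuous_intros\<close>)+
qed

lemma test_fun_weak_grad:
  fixes \<phi> :: "real^'n \<Rightarrow> real"
  assumes \<phi>: "test_fun \<Omega> \<phi> D" and \<Omega>: "open \<Omega>"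
  shows "weak_grad \<Omega> \<phi> D"
  unfolding weak_grad_def
proof (intro allI impI)
  fix \<psi> E i assume \<psi>: "test_fun \<Omega> \<psi> E"
  note m = test_fun_mult[OF \<phi> \<psi>]
  have c: "continuous_on UNIV \<phi>" "continuous_on UNIV (\<lambda>x. D x $ i)"
    using test_funD(1,2)[OF \<phi>] by (auto intro!: continuous_intros)
  have "0 = (\<integral>x. (\<phi> x *\<^sub>R E x + \<psi> x *\<^sub>R D x) $ i \<partial>lborel)"
    using integral_gradient_test_fun_eq_0[OF m] by simp
  also have "\<dots> = (\<integral>x. (\<phi> x *\<^sub>R E x + \<psi> x *\<^sub>R D x) $ i \<partial>lebesgue_on \<Omega>)"
    using test_funD(6)[OF m] \<Omega>
    by (intro lebesgue_on_eq_lborel(1)[symmetric] borel_measurable_continuous_onI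
        continuous_on_component[OF test_funD(2)[OF m]]) auto
  also have "\<dots> = (\<integral>x. \<phi> x * E x $ i \<partial>lebesgue_on \<Omega>) + (\<integral>x. D x $ i * \<psi> x \<partial>lebesgue_on \<Omega>)"
    using test_fun_L2(7)[OF \<psi> \<Omega> c(1), of i] test_fun_L2(6)[OF \<psi> \<Omega> c(2)]
    by (simp add: mult.commute[of "\<psi> _"])
  finally show "(\<integral>x. \<phi> x * E x $ i \<partial>lebesgue_on \<Omega>) = - (\<integral>x. D x $ i * \<psi> x \<partial>lebesgue_on \<Omega>)"
    by simp
qed

text \<open>The conjunct \<open>weak_grad\<close> is obtained by passing to the L^2 limit, component
  by component, in the integration by parts that holds for each \<open>\<phi> k\<close>.\<close>

lemma H01_limitI:
  fixes v :: "real^'n \<Rightarrow> real"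
  assumes \<Omega>: "open \<Omega>" and tf: "\<And>k. test_fun \<Omega> (\<phi> k) (D k)"
    and [measurable]: "v \<in> borel_measurable (lebesgue_on \<Omega>)" "H \<in> borel_measurable (lebesgue_on \<Omega>)"
    and iv: "integrable (lebesgue_on \<Omega>) (\<lambda>x. (v x)\<^sup>2)" and iH: "integrable (lebesgue_on \<Omega>) (\<lambda>x. (norm (H x))\<^sup>2)"
    and lv: "(\<lambda>k. \<integral>x. (\<phi> k x - v x)\<^sup>2 \<partial>lebesgue_on \<Omega>) \<longlonglongrightarrow> 0"
    and lH: "(\<lambda>k. \<integral>x. (norm (D k x - H x))\<^sup>2 \<partial>lebesgue_on \<Omega>) \<longlonglongrightarrow> 0"
  shows "H01 \<Omega> v H"
proof -
  let ?M = "lebesgue_on \<Omega>"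
  note [measurable] = test_fun_L2(1,2)[OF tf \<Omega>]
  have comp: "integrable ?M (\<lambda>x. (f x $ i)\<^sup>2)" "(\<integral>x. (f x $ i)\<^sup>2 \<partial>?M) \<le> (\<integral>x. (norm (f x))\<^sup>2 \<partial>?M)"
    if [measurable]: "f \<in> borel_measurable ?M" and i: "integrable ?M (\<lambda>x. (norm (f x))\<^sup>2)" for f :: "real^'n \<Rightarrow> real^'n" and i
  proof -
    have le: "(f x $ i)\<^sup>2 \<le> (norm (f x))\<^sup>2" for x
      using component_le_norm_cart[of "f x" i] by (metis abs_ge_zero power2_abs power_mono)
    show *: "integrable ?M (\<lambda>x. (f x $ i)\<^sup>2)"
      by (rule Bochner_Integration.integrable_bound[OF i]) (use le in auto)
    show "(\<integral>x. (f x $ i)\<^sup>2 \<partial>?M) \<le> (\<integral>x. (norm (f x))\<^sup>2 \<partial>?M)"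
      by (rule integral_mono[OF * i le])
  qed
  have "weak_grad \<Omega> v H"
    unfolding weak_grad_def
  proof (intro allI impI)
    fix \<psi> E i assume \<psi>: "test_fun \<Omega> \<psi> E"
    note [measurable] = test_fun_L2(1,2)[OF \<psi> \<Omega>]
    have "(\<lambda>k. \<integral>x. \<phi> k x * E x $ i \<partial>?M) \<longlonglongrightarrow> (\<integral>x. v x * E x $ i \<partial>?M)"
      by (intro tendsto_integral_L2 lv iv test_fun_L2[OF tf \<Omega>] test_fun_L2[OF \<psi> \<Omega>]) measurable
    moreover have lD: "(\<lambda>k. \<integral>x. D k x $ i * \<psi> x \<partial>?M) \<longlonglongrightarrow> (\<integral>x. H x $ i * \<psi> x \<partial>?M)"
    proof (intro tendsto_integral_L2 comp iH test_fun_L2[OF tf \<Omega>] test_fun_L2[OF \<psi> \<Omega>])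
      show "(\<lambda>k. \<integral>x. (D k x $ i - H x $ i)\<^sup>2 \<partial>?M) \<longlonglongrightarrow> 0"
      proof (rule tendsto_sandwich[OF _ _ tendsto_const lH])
        show "\<forall>\<^sub>F k in sequentially. (\<integral>x. (D k x $ i - H x $ i)\<^sup>2 \<partial>?M) \<le> (\<integral>x. (norm (D k x - H x))\<^sup>2 \<partial>?M)"
        proof (intro always_eventually allI)
          fix k
          show "(\<integral>x. (D k x $ i - H x $ i)\<^sup>2 \<partial>?M) \<le> (\<integral>x. (norm (D k x - H x))\<^sup>2 \<partial>?M)"
            using comp(2)[of "\<lambda>x. D k x - H x" i] integrable_square_diff[OF _ _ test_fun_L2(4)[OF tf \<Omega>] iH, of k]
            by simp
        qed
      qed auto
    qed measurable
    moreover have "(\<integral>x. \<phi> k x * E x $ i \<partial>?M) = - (\<integral>x. D k x $ i * \<psi> x \<partial>?M)" for k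
      using test_fun_weak_grad[OF tf \<Omega>, of k] \<psi> by (auto simp: weak_grad_def)
    ultimately show "(\<integral>x. v x * E x $ i \<partial>?M) = - (\<integral>x. H x $ i * \<psi> x \<partial>?M)"
      using LIMSEQ_unique[OF _ tendsto_minus[OF lD]] by simp
  qed
  then show ?thesis
    unfolding H01_def Lp_mem_def using assms by auto
qed

text \<open>A subsequence of an L^2-convergent sequence converges almost everywhere. Dominated
  convergence in \<open>H01_comp\<close> and Fatou's lemma in \<open>Sobolev_H01\<close> depend on
  this.\<close>

lemma H01_approx:
  fixes u :: "real^'n \<Rightarrow> real"
  assumes \<Omega>: "open \<Omega>" and u: "H01 \<Omega> u G"
  obtains \<phi> D where "\<And>k. test_fun \<Omega> (\<phi> k) (D k)" "AE x in lebesgue_on \<Omega>. (\<lambda>k. \<phi> k x) \<longlonglongrightarrow> u x"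
    "(\<lambda>k. \<integral>x. (\<phi> k x - u x)\<^sup>2 \<partial>lebesgue_on \<Omega>) \<longlonglongrightarrow> 0"
    "(\<lambda>k. \<integral>x. (norm (D k x - G x))\<^sup>2 \<partial>lebesgue_on \<Omega>) \<longlonglongrightarrow> 0"
proof -
  let ?M = "lebesgue_on \<Omega>"
  have [measurable]: "u \<in> borel_measurable ?M" and iu: "integrable ?M (\<lambda>x. (u x)\<^sup>2)"
    using u by (auto simp: H01_def Lp_mem_def)
  obtain \<phi> D where tf: "\<And>k. test_fun \<Omega> (\<phi> k) (D k)"
    and l: "(\<lambda>k. \<integral>x. (\<phi> k x - u x)\<^sup>2 \<partial>?M) \<longlonglongrightarrow> 0"
    "(\<lambda>k. \<integral>x. (norm (D k x - G x))\<^sup>2 \<partial>?M) \<longlonglongrightarrow> 0"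
    using u unfolding H01_def by blast
  note [measurable] = test_fun_L2(1,2)[OF tf \<Omega>]
  have "integrable ?M (\<lambda>x. (\<phi> k x - u x)\<^sup>2)" for k
    using integrable_square_diff[of "\<phi> k" ?M u] test_fun_L2(3)[OF tf \<Omega>, of k] iu by simp
  then have "\<exists>r. strict_mono r \<and> (AE x in ?M. (\<lambda>k. (\<phi> (r k) x - u x)\<^sup>2) \<longlonglongrightarrow> 0)"
    by (rule tendsto_L1_AE_subseq) (use l(1) in simp)
  then obtain r where r: "strict_mono r" "AE x in ?M. (\<lambda>k. (\<phi> (r k) x - u x)\<^sup>2) \<longlonglongrightarrow> 0"
    by blast
  have "AE x in ?M. (\<lambda>k. \<phi> (r k) x) \<longlonglongrightarrow> u x"
    using r(2)
  proof eventually_elim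
    case (elim x)
    have "(\<lambda>k. \<bar>\<phi> (r k) x - u x\<bar>) \<longlonglongrightarrow> 0"
      using tendsto_real_sqrt[OF elim] by simp
    then have "(\<lambda>k. \<phi> (r k) x - u x) \<longlonglongrightarrow> 0"
      by (rule tendsto_rabs_zero_cancel)
    then show ?case by (rule LIM_zero_cancel)
  qed
  then show ?thesis
    using LIMSEQ_subseq_LIMSEQ[OF l(1) r(1)] LIMSEQ_subseq_LIMSEQ[OF l(2) r(1)] unfolding o_def
    by (intro that[of "\<lambda>k. \<phi> (r k)" "\<lambda>k. D (r k)"] tf)
qed

text \<open>The functions \<open>T (\<phi> k x)\<close> are again test functions, and
  \<open>T\<close> is Lipschitz. The error of the gradients splits into
  \<open>T' (\<phi> k x) *\<^sub>R (D k x - G x)\<close>, small in L^2 because \<open>T'\<close> is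
  bounded, and \<open>(T' (\<phi> k x) - T' (u x)) *\<^sub>R G x\<close>, small by dominated
  convergence because \<open>T'\<close> is continuous.\<close>

lemma H01_comp:
  fixes u :: "real^'n \<Rightarrow> real"
  assumes \<Omega>: "open \<Omega>" and u: "H01 \<Omega> u G" and T: "\<And>s. (T has_real_derivative T' s) (at s)"
    and T': "continuous_on UNIV T'" and T0: "T 0 = 0" and M: "\<And>s. \<bar>T' s\<bar> \<le> M"
  shows "H01 \<Omega> (\<lambda>x. T (u x)) (\<lambda>x. T' (u x) *\<^sub>R G x)"
proof -
  let ?M = "lebesgue_on \<Omega>"
  have [measurable]: "u \<in> borel_measurable ?M" "G \<in> borel_measurable ?M" and iu: "integrable ?M (\<lambda>x. (u x)\<^sup>2)"
    and iG: "integrable ?M (\<lambda>x. (norm (G x))\<^sup>2)"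
    using u by (auto simp: H01_def Lp_mem_def)
  obtain \<phi> D where tf: "\<And>k. test_fun \<Omega> (\<phi> k) (D k)" and ae: "AE x in ?M. (\<lambda>k. \<phi> k x) \<longlonglongrightarrow> u x"
    and lu: "(\<lambda>k. \<integral>x. (\<phi> k x - u x)\<^sup>2 \<partial>?M) \<longlonglongrightarrow> 0"
    and lG: "(\<lambda>k. \<integral>x. (norm (D k x - G x))\<^sup>2 \<partial>?M) \<longlonglongrightarrow> 0"
    using H01_approx[OF \<Omega> u] by blast
  note [measurable] = test_fun_L2(1,2)[OF tf \<Omega>]
  have cT: "continuous_on UNIV T"
    using T by (intro continuous_at_imp_continuous_on ballI DERIV_isCont)
  have [measurable]: "T \<in> borel_measurable borel" "T' \<in> borel_measurable borel"
    using T' cT by (auto intro: borel_measurable_continuous_onI)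
  have M0: "0 \<le> M" using M[of 0] by linarith
  have lip: "\<bar>T a - T b\<bar> \<le> M * \<bar>a - b\<bar>" for a b
    using field_differentiable_bound[of UNIV T T' M a b] T M by simp
  have sq: "(T a - T b)\<^sup>2 \<le> M\<^sup>2 * (a - b)\<^sup>2" for a b
    using power_mono[OF lip abs_ge_zero, of a b 2] by (simp add: power_mult_distrib)
  have iu\<phi>: "integrable ?M (\<lambda>x. (\<phi> k x - u x)\<^sup>2)" for k
    using integrable_square_diff[of "\<phi> k" ?M u] test_fun_L2(3)[OF tf \<Omega>, of k] iu by simp
  have iG\<phi>: "integrable ?M (\<lambda>x. (norm (D k x - G x))\<^sup>2)" for k
    using integrable_square_diff[OF _ _ test_fun_L2(4)[OF tf \<Omega>] iG, of k] by simp
  have T'G: "(norm (T' s *\<^sub>R y))\<^sup>2 \<le> M\<^sup>2 * (norm y)\<^sup>2" for s and y :: "real^'n"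
    using M[of s] M0 abs_le_square_iff[of "T' s" M] by (auto simp: power_mult_distrib intro!: mult_right_mono)
  show ?thesis
  proof (rule H01_limitI[OF \<Omega> test_fun_comp[OF tf T T' T0]])
    show "(\<lambda>x. T (u x)) \<in> borel_measurable ?M" "(\<lambda>x. T' (u x) *\<^sub>R G x) \<in> borel_measurable ?M"
      by measurable
    show "integrable ?M (\<lambda>x. (T (u x))\<^sup>2)"
      by (rule Bochner_Integration.integrable_bound[OF integrable_mult_right[OF iu, of "M\<^sup>2"]])
         (use sq[of _ 0] T0 in auto)
    show "integrable ?M (\<lambda>x. (norm (T' (u x) *\<^sub>R G x))\<^sup>2)"
      by (rule Bochner_Integration.integrable_bound[OF integrable_mult_right[OF iG, of "M\<^sup>2"]])
         (use T'G in \<open>auto simp del: norm_scaleR\<close>)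
    have iT: "integrable ?M (\<lambda>x. (T (\<phi> k x) - T (u x))\<^sup>2)" for k
      by (rule Bochner_Integration.integrable_bound[OF integrable_mult_right[OF iu\<phi>[of k], of "M\<^sup>2"]])
         (use sq in auto)
    have lT: "(\<lambda>k. M\<^sup>2 * (\<integral>x. (\<phi> k x - u x)\<^sup>2 \<partial>?M)) \<longlonglongrightarrow> 0"
      using tendsto_mult_right_zero[OF lu] by simp
    show "(\<lambda>k. \<integral>x. (T (\<phi> k x) - T (u x))\<^sup>2 \<partial>?M) \<longlonglongrightarrow> 0"
    proof (rule tendsto_sandwich[OF _ _ tendsto_const lT])
      show "\<forall>\<^sub>F k in sequentially. (\<integral>x. (T (\<phi> k x) - T (u x))\<^sup>2 \<partial>?M) \<le> M\<^sup>2 * (\<integral>x. (\<phi> k x - u x)\<^sup>2 \<partial>?M)"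
        using iT iu\<phi> sq by (intro always_eventually allI)
          (subst Bochner_Integration.integral_mult_right_zero[symmetric], intro integral_mono, auto)
    qed auto
    let ?r = "\<lambda>k x. (T' (\<phi> k x) - T' (u x))\<^sup>2 * (norm (G x))\<^sup>2"
    have bd: "(T' a - T' b)\<^sup>2 \<le> (2 * M)\<^sup>2" for a b
      using M[of a] M[of b] by (intro power2_le_iff_abs_le[THEN iffD2]) auto
    have ir: "integrable ?M (?r k)" for k
      by (rule Bochner_Integration.integrable_bound[OF integrable_mult_right[OF iG, of "(2*M)\<^sup>2"]])
         (use bd in \<open>auto simp: abs_mult intro!: mult_right_mono\<close>)
    have lr: "(\<lambda>k. \<integral>x. ?r k x \<partial>?M) \<longlonglongrightarrow> (\<integral>x. 0 \<partial>?M)"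
    proof (rule integral_dominated_convergence[where w = "\<lambda>x. (2*M)\<^sup>2 * (norm (G x))\<^sup>2"])
      show "AE x in ?M. (\<lambda>k. ?r k x) \<longlonglongrightarrow> 0"
        using ae
      proof eventually_elim
        case (elim x)
        have "isCont T' (u x)" using T' by (simp add: continuous_on_eq_continuous_at)
        then have "(\<lambda>k. T' (\<phi> k x)) \<longlonglongrightarrow> T' (u x)"
          using elim by (rule isCont_tendsto_compose)
        then have "(\<lambda>k. ?r k x) \<longlonglongrightarrow> (T' (u x) - T' (u x))\<^sup>2 * (norm (G x))\<^sup>2"
          by (intro tendsto_intros)
        then show ?case by simp
      qed
      show "integrable ?M (\<lambda>x. (2*M)\<^sup>2 * (norm (G x))\<^sup>2)" using iG by simp
      show "AE x in ?M. norm (?r k x) \<le> (2*M)\<^sup>2 * (norm (G x))\<^sup>2" for k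
        using bd by (auto simp: abs_mult intro!: mult_right_mono)
    qed auto
    have pw: "(norm (T' (\<phi> k x) *\<^sub>R D k x - T' (u x) *\<^sub>R G x))\<^sup>2 \<le> 2 * M\<^sup>2 * (norm (D k x - G x))\<^sup>2 + 2 * ?r k x" for k x
    proof -
      let ?a = "T' (\<phi> k x) *\<^sub>R (D k x - G x)" and ?b = "(T' (\<phi> k x) - T' (u x)) *\<^sub>R G x"
      have "T' (\<phi> k x) *\<^sub>R D k x - T' (u x) *\<^sub>R G x = ?a + ?b"
        by (simp add: algebra_simps)
      then have "(norm (T' (\<phi> k x) *\<^sub>R D k x - T' (u x) *\<^sub>R G x))\<^sup>2 \<le> (norm ?a + norm ?b)\<^sup>2"
        by (simp only: power_mono norm_triangle_ineq norm_ge_zero)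
      also have "\<dots> \<le> 2 * (norm ?a)\<^sup>2 + 2 * (norm ?b)\<^sup>2"
        using sum_squares_bound[of "norm ?a" "norm ?b"] by (simp only: power2_sum)
      also have "\<dots> \<le> 2 * (M\<^sup>2 * (norm (D k x - G x))\<^sup>2) + 2 * ?r k x"
        using T'G[of "\<phi> k x" "D k x - G x"] by (simp add: power_mult_distrib)
      finally show ?thesis by simp
    qed
    have "(\<lambda>k. 2 * M\<^sup>2 * (\<integral>x. (norm (D k x - G x))\<^sup>2 \<partial>?M) + 2 * (\<integral>x. ?r k x \<partial>?M)) \<longlonglongrightarrow> 2 * M\<^sup>2 * 0 + 2 * (\<integral>x. 0 \<partial>?M)"
      by (intro tendsto_intros lG lr)
    then have lim: "(\<lambda>k. 2 * M\<^sup>2 * (\<integral>x. (norm (D k x - G x))\<^sup>2 \<partial>?M) + 2 * (\<integral>x. ?r k x \<partial>?M)) \<longlonglongrightarrow> 0"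
      by simp
    show "(\<lambda>k. \<integral>x. (norm (T' (\<phi> k x) *\<^sub>R D k x - T' (u x) *\<^sub>R G x))\<^sup>2 \<partial>?M) \<longlonglongrightarrow> 0"
    proof (rule tendsto_sandwich[OF _ _ tendsto_const lim])
      show "\<forall>\<^sub>F k in sequentially. (\<integral>x. (norm (T' (\<phi> k x) *\<^sub>R D k x - T' (u x) *\<^sub>R G x))\<^sup>2 \<partial>?M)
         \<le> 2 * M\<^sup>2 * (\<integral>x. (norm (D k x - G x))\<^sup>2 \<partial>?M) + 2 * (\<integral>x. ?r k x \<partial>?M)"
      proof (intro always_eventually allI)
        fix k
        have I: "integrable ?M (\<lambda>x. 2 * M\<^sup>2 * (norm (D k x - G x))\<^sup>2 + 2 * ?r k x)"
          by (intro Bochner_Integration.integrable_add integrable_mult_right iG\<phi> ir)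
        have "integrable ?M (\<lambda>x. (norm (T' (\<phi> k x) *\<^sub>R D k x - T' (u x) *\<^sub>R G x))\<^sup>2)"
          by (rule Bochner_Integration.integrable_bound[OF I])
             (auto intro!: AE_I2 order_trans[OF pw])
        then have "(\<integral>x. (norm (T' (\<phi> k x) *\<^sub>R D k x - T' (u x) *\<^sub>R G x))\<^sup>2 \<partial>?M) \<le> (\<integral>x. 2 * M\<^sup>2 * (norm (D k x - G x))\<^sup>2 + 2 * ?r k x \<partial>?M)"
          by (intro integral_mono I pw)
        also have "\<dots> = 2 * M\<^sup>2 * (\<integral>x. (norm (D k x - G x))\<^sup>2 \<partial>?M) + 2 * (\<integral>x. ?r k x \<partial>?M)"
          using iG\<phi>[of k] ir[of k]
          by (subst Bochner_Integration.integral_add)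
             (auto intro!: integrable_mult_right simp only: Bochner_Integration.integral_mult_right_zero)
        finally show "(\<integral>x. (norm (T' (\<phi> k x) *\<^sub>R D k x - T' (u x) *\<^sub>R G x))\<^sup>2 \<partial>?M)
         \<le> 2 * M\<^sup>2 * (\<integral>x. (norm (D k x - G x))\<^sup>2 \<partial>?M) + 2 * (\<integral>x. ?r k x \<partial>?M)" .
      qed
    qed auto
  qed
qed

lemma Sobolev_H01:
  fixes u :: "real^'n \<Rightarrow> real"
  assumes \<Omega>: "open \<Omega>" and u: "H01 \<Omega> u G" and dim: "CARD('n) \<ge> 3"
  defines "n \<equiv> real CARD('n)"
  shows "integrable (lebesgue_on \<Omega>) (\<lambda>x. \<bar>u x\<bar> powr (2 * n / (n - 2)))"
    "(\<integral>x. \<bar>u x\<bar> powr (2 * n / (n - 2)) \<partial>lebesgue_on \<Omega>)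
    \<le> ((2 * (n - 1) / (n - 2))\<^sup>2 * (\<integral>x. (norm (G x))\<^sup>2 \<partial>lebesgue_on \<Omega>)) powr (n / (n - 2))"
proof -
  let ?M = "lebesgue_on \<Omega>"
  let ?s = "2 * n / (n - 2)" and ?\<gamma> = "2 * (n - 1) / (n - 2)"
  have n: "n \<ge> 3" using dim by (simp add: n_def)
  then have s0: "?s > 0" and p0: "n / (n - 2) > 0" by auto
  have [measurable]: "u \<in> borel_measurable ?M" "G \<in> borel_measurable ?M" and iu: "integrable ?M (\<lambda>x. (u x)\<^sup>2)"
    and iG: "integrable ?M (\<lambda>x. (norm (G x))\<^sup>2)"
    using u by (auto simp: H01_def Lp_mem_def)
  obtain \<phi> D where tf: "\<And>k. test_fun \<Omega> (\<phi> k) (D k)" and ae: "AE x in ?M. (\<lambda>k. \<phi> k x) \<longlonglongrightarrow> u x"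
    and lG: "(\<lambda>k. \<integral>x. (norm (D k x - G x))\<^sup>2 \<partial>?M) \<longlonglongrightarrow> 0"
    using H01_approx[OF \<Omega> u] by blast
  note [measurable] = test_fun_L2(1,2)[OF tf \<Omega>]
  define g where "g = (\<integral>x. (norm (G x))\<^sup>2 \<partial>?M)"
  define d where "d k = (\<integral>x. (norm (D k x - G x))\<^sup>2 \<partial>?M)" for k
  \<comment> \<open>This is the square of \<open>sqrt g + sqrt (d k)\<close>: by the triangle
    inequality in L^2 it bounds the squared gradient norm of \<open>\<phi> k\<close>, and it tends
    to \<open>g\<close>.\<close>
  define c where "c k = g + 2 * (sqrt g * sqrt (d k)) + d k" for k
  have iG\<phi>: "integrable ?M (\<lambda>x. (norm (D k x - G x))\<^sup>2)" for k
    using integrable_square_diff[OF _ _ test_fun_L2(4)[OF tf \<Omega>] iG, of k] by simp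
  have Dc: "(\<integral>x. (norm (D k x))\<^sup>2 \<partial>?M) \<le> c k" for k
  proof -
    have pw: "(norm (D k x))\<^sup>2 \<le> (norm (G x))\<^sup>2 + 2 * (norm (G x) * norm (D k x - G x)) + (norm (D k x - G x))\<^sup>2" for x
    proof -
      have "norm (D k x) \<le> norm (G x) + norm (D k x - G x)"
        by (rule norm_triangle_sub)
      then have "(norm (D k x))\<^sup>2 \<le> (norm (G x) + norm (D k x - G x))\<^sup>2"
        by (rule power_mono) simp
      then show ?thesis by (simp add: power2_sum)
    qed
    note CS = Cauchy_Schwarz_integral[of "\<lambda>x. norm (G x)" ?M "\<lambda>x. norm (D k x - G x)"]
    have iP: "integrable ?M (\<lambda>x. norm (G x) * norm (D k x - G x))"
      using iG iG\<phi>[of k] by (intro CS(1)) auto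
    have "(\<integral>x. (norm (D k x))\<^sup>2 \<partial>?M) \<le> (\<integral>x. (norm (G x))\<^sup>2 + 2 * (norm (G x) * norm (D k x - G x)) + (norm (D k x - G x))\<^sup>2 \<partial>?M)"
      using iG iG\<phi>[of k] iP pw test_fun_L2(4)[OF tf \<Omega>, of k] by (intro integral_mono) auto
    also have "\<dots> = g + 2 * (\<integral>x. norm (G x) * norm (D k x - G x) \<partial>?M) + d k"
      using iG iG\<phi>[of k] iP by (simp add: g_def d_def)
    also have "\<dots> \<le> c k"
      using CS(2) iG iG\<phi>[of k] by (simp add: c_def g_def d_def)
    finally show ?thesis .
  qed
  have "c \<longlonglongrightarrow> g + 2 * (sqrt g * sqrt 0) + 0"
    unfolding c_def using lG by (intro tendsto_intros) (auto simp: d_def)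
  then have cl: "c \<longlonglongrightarrow> g" by simp
  have c0: "0 \<le> c k" for k
    by (rule order_trans[OF _ Dc[of k]]) simp
  have g0: "0 \<le> g" by (simp add: g_def)
  have L: "integrable ?M (\<lambda>x. \<bar>\<phi> k x\<bar> powr ?s)"
    "(\<integral>x. \<bar>\<phi> k x\<bar> powr ?s \<partial>?M) \<le> (?\<gamma>\<^sup>2 * c k) powr (n / (n - 2))" for k
  proof -
    note t = test_funD[OF tf[of k]]
    have cs: "continuous_on UNIV (\<lambda>x. \<bar>\<phi> k x\<bar> powr ?s)"
      using t(1) s0 by (intro continuous_on_powr') (auto intro!: continuous_intros)
    have cD: "continuous_on UNIV (\<lambda>x. (norm (D k x))\<^sup>2)"
      using t(2) by (intro continuous_intros) auto
    have Z: "\<phi> k x = 0" "D k x = 0" if "x \<notin> closure {x. \<phi> k x \<noteq> 0}" for x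
      using t(3,4) that by blast+
    have "integrable lborel (\<lambda>x. \<bar>\<phi> k x\<bar> powr ?s)"
      by (rule integrable_compact_support[OF cs t(8)]) (auto dest: Z)
    then show "integrable ?M (\<lambda>x. \<bar>\<phi> k x\<bar> powr ?s)"
      using t(5) \<Omega> by (subst lebesgue_on_eq_lborel) (auto intro!: borel_measurable_continuous_onI[OF cs])
    have "(\<integral>x. \<bar>\<phi> k x\<bar> powr ?s \<partial>?M) = (\<integral>x. \<bar>\<phi> k x\<bar> powr ?s \<partial>lborel)"
      using t(5) \<Omega> by (subst lebesgue_on_eq_lborel) (auto intro!: borel_measurable_continuous_onI[OF cs])
    also have "\<dots> \<le> (?\<gamma>\<^sup>2 * (\<integral>x. (norm (D k x))\<^sup>2 \<partial>lborel)) powr (n / (n - 2))"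
      using Sobolev_test_fun[OF tf dim] unfolding n_def .
    also have "(\<integral>x. (norm (D k x))\<^sup>2 \<partial>lborel) = (\<integral>x. (norm (D k x))\<^sup>2 \<partial>?M)"
      using t(6) \<Omega> by (subst lebesgue_on_eq_lborel) (auto intro!: borel_measurable_continuous_onI[OF cD])
    also have "(?\<gamma>\<^sup>2 * \<dots>) powr (n / (n - 2)) \<le> (?\<gamma>\<^sup>2 * c k) powr (n / (n - 2))"
      using p0 Dc[of k] by (intro powr_mono2 mult_left_mono) auto
    finally show "(\<integral>x. \<bar>\<phi> k x\<bar> powr ?s \<partial>?M) \<le> (?\<gamma>\<^sup>2 * c k) powr (n / (n - 2))" .
  qed
  have AE: "AE x in ?M. (\<lambda>k. \<bar>\<phi> k x\<bar> powr ?s) \<longlonglongrightarrow> \<bar>u x\<bar> powr ?s"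
    using ae
  proof eventually_elim
    case (elim x)
    show ?case
      using s0 by (intro tendsto_powr' tendsto_rabs elim tendsto_const) auto
  qed
  have lim: "(\<lambda>k. (?\<gamma>\<^sup>2 * c k) powr (n / (n - 2))) \<longlonglongrightarrow> (?\<gamma>\<^sup>2 * g) powr (n / (n - 2))"
    using p0 c0 by (intro tendsto_powr' tendsto_mult tendsto_const cl) auto
  note R = integral_limit_le[OF L(1) _ AE _ L(2) lim]
  show "integrable ?M (\<lambda>x. \<bar>u x\<bar> powr ?s)"
    by (rule R(1)) auto
  show "(\<integral>x. \<bar>u x\<bar> powr ?s \<partial>?M) \<le> (?\<gamma>\<^sup>2 * (\<integral>x. (norm (G x))\<^sup>2 \<partial>?M)) powr (n / (n - 2))"
    unfolding g_def[symmetric] by (rule R(2)) auto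
qed

section \<open>The energy inequality\<close>

lemma continuous_antiderivative:
  fixes f :: "real \<Rightarrow> real"
  assumes "continuous_on UNIV f"
  obtains F where "F 0 = 0" "\<And>t. (F has_real_derivative f t) (at t)"
proof -
  have "\<exists>F. \<forall>x :: real. -\<infinity> < ereal x \<longrightarrow> ereal x < \<infinity> \<longrightarrow> (F has_vector_derivative f x) (at x)"
    using assms by (intro einterval_antiderivative) (auto simp: continuous_on_eq_continuous_at)
  then obtain F where "\<forall>x :: real. -\<infinity> < ereal x \<longrightarrow> ereal x < \<infinity> \<longrightarrow> (F has_vector_derivative f x) (at x)"
    by blast
  then have F: "(F has_real_derivative f x) (at x)" for x
    by (simp add: has_real_derivative_iff_has_vector_derivative)
  have "((\<lambda>t. F t - F 0) has_real_derivative f t) (at t)" for t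
    using DERIV_diff[OF F[of t] DERIV_const[of "F 0"]] by simp
  then show ?thesis
    by (rule that[of "\<lambda>t. F t - F 0", rotated]) simp
qed

text \<open>Boundedness of \<open>\<phi>\<close> makes the resulting test function admissible,
  continuity makes it a C^1 function of \<open>u\<close> as \<open>H01_comp\<close> requires, and
  monotonicity gives \<open>\<Phi> t \<le> \<phi> t * t\<close> for \<open>t \<ge> 0\<close>.
  Vanishing on all of the line below \<open>R\<close>, negative numbers included, allows even and
  odd extensions to be written as sums and differences of reflections.\<close>

definition cutoff :: "real \<Rightarrow> (real \<Rightarrow> real) \<Rightarrow> (real \<Rightarrow> real) \<Rightarrow> bool" where
  "cutoff R \<phi> \<Phi> \<longleftrightarrow> continuous_on UNIV \<phi> \<and> mono \<phi> \<and> (\<exists>M. \<forall>t. \<phi> t \<le> M) \<and> (\<forall>t\<le>R. \<phi> t = 0) \<and>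
     (\<forall>t. (\<Phi> has_real_derivative \<phi> t) (at t)) \<and> \<Phi> 0 = 0"

lemma cutoffD:
  assumes c: "cutoff R \<phi> \<Phi>" and R: "0 < R"
  shows "0 \<le> \<phi> t" "t \<le> R \<Longrightarrow> \<phi> t = 0" "t \<le> R \<Longrightarrow> \<Phi> t = 0" "0 \<le> \<Phi> t" "0 \<le> t \<Longrightarrow> \<Phi> t \<le> \<phi> t * t"
    "(\<Phi> has_real_derivative \<phi> t) (at t)" "continuous_on UNIV \<phi>" "continuous_on UNIV \<Phi>" "s \<le> t \<Longrightarrow> \<phi> s \<le> \<phi> t"
proof -
  show z: "\<And>t. t \<le> R \<Longrightarrow> \<phi> t = 0" and d: "\<And>t. (\<Phi> has_real_derivative \<phi> t) (at t)"
    and cphi: "continuous_on UNIV \<phi>" and mono: "\<And>s t. s \<le> t \<Longrightarrow> \<phi> s \<le> \<phi> t"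
    using c unfolding cutoff_def mono_def by blast+
  show nn: "0 \<le> \<phi> t" for t
    using z[of t] z[of R] mono[of R t] by (cases "t \<le> R") auto
  show "continuous_on UNIV \<Phi>"
    using d by (intro continuous_at_imp_continuous_on ballI DERIV_isCont)
  have \<Phi>0: "\<Phi> 0 = 0" using c by (simp add: cutoff_def)
  have incr: "\<Phi> s \<le> \<Phi> t" if "s \<le> t" for s t
    by (rule DERIV_nonneg_imp_nondecreasing[OF that]) (use d nn in blast)
  have upto: "\<Phi> t \<le> \<phi> t * t" if "0 \<le> t" for t
  proof -
    have "\<phi> t * 0 - \<Phi> 0 \<le> \<phi> t * t - \<Phi> t"
    proof (rule DERIV_nonneg_imp_nondecreasing[OF that, where f = "\<lambda>s. \<phi> t * s - \<Phi> s"])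
      fix s assume "0 \<le> s" "s \<le> t"
      then show "\<exists>y. ((\<lambda>s. \<phi> t * s - \<Phi> s) has_real_derivative y) (at s) \<and> 0 \<le> y"
        using mono[of s t] DERIV_diff[OF DERIV_cmult_Id[of "\<phi> t"] d[of s]] by (intro exI[of _ "\<phi> t - \<phi> s"]) simp
    qed
    then show ?thesis using \<Phi>0 by simp
  qed
  then show "0 \<le> t \<Longrightarrow> \<Phi> t \<le> \<phi> t * t" .
  show zP: "\<Phi> t = 0" if "t \<le> R" for t
  proof (cases "0 \<le> t")
    case True
    then show ?thesis using upto[of t] incr[of 0 t] z[OF that] \<Phi>0 by simp
  next
    case False
    have "- \<Phi> t \<le> - \<Phi> 0"
    proof (rule DERIV_nonneg_imp_nondecreasing[where f = "\<lambda>t. - \<Phi> t"])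
      fix s assume "t \<le> s" "s \<le> 0"
      then have "\<phi> s = 0" using z[of s] R by simp
      then show "\<exists>y. ((\<lambda>t. - \<Phi> t) has_real_derivative y) (at s) \<and> 0 \<le> y"
        using DERIV_minus[OF d[of s]] by (intro exI[of _ 0]) simp
    qed (use False in simp)
    then show ?thesis using incr[of t 0] False \<Phi>0 by simp
  qed
  show "0 \<le> \<Phi> t"
    using incr[of R t] zP[of R] zP[of t] by (cases "t \<le> R") auto
qed

text \<open>\<open>f (t *\<^sub>R \<xi>) - t * f \<xi>\<close> is at most 0 for t in (0,1) and
  equals 0 at 1. Its derivative at 1 is \<open>Df \<bullet> \<xi> - f \<xi>\<close>; were this
  negative, the function would be positive just to the left of 1.\<close>

lemma convex_gradient_coercive:
  fixes f :: "'a::real_inner \<Rightarrow> real"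
  assumes d: "(f has_derivative (\<lambda>h. Df \<bullet> h)) (at \<xi>)" and f0: "f 0 = 0"
    and cv: "\<And>\<xi> t. 0 < t \<Longrightarrow> t < 1 \<Longrightarrow> f (t *\<^sub>R \<xi>) \<le> t * f \<xi>"
  shows "f \<xi> \<le> Df \<bullet> \<xi>"
proof (rule ccontr)
  assume "\<not> f \<xi> \<le> Df \<bullet> \<xi>"
  then have neg: "Df \<bullet> \<xi> - f \<xi> < 0" by simp
  have "((\<lambda>t. t *\<^sub>R \<xi>) has_derivative (\<lambda>t. t *\<^sub>R \<xi>)) (at 1)"
    by (auto intro!: derivative_eq_intros)
  then have "((\<lambda>t. f (t *\<^sub>R \<xi>)) has_real_derivative Df \<bullet> \<xi>) (at 1)"
    using diff_chain_at[of "\<lambda>t. t *\<^sub>R \<xi>" "\<lambda>t. t *\<^sub>R \<xi>" 1 f "\<lambda>h. Df \<bullet> h"] d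
    by (simp add: o_def has_field_derivative_def mult_commute_abs)
  then have "((\<lambda>t. f (t *\<^sub>R \<xi>) - t * f \<xi>) has_real_derivative Df \<bullet> \<xi> - f \<xi>) (at 1)"
    by (auto intro!: derivative_eq_intros)
  from DERIV_neg_dec_left[OF this neg] obtain e where e: "e > 0"
    "\<And>h. h > 0 \<Longrightarrow> h < e \<Longrightarrow> 0 < f ((1 - h) *\<^sub>R \<xi>) - (1 - h) * f \<xi>"
    by auto
  define h where "h = min (e / 2) (1 / 2)"
  have "0 < h" "h < e" "h < 1" using e(1) by (auto simp: h_def)
  then show False
    using e(2)[of h] cv[of "1 - h" \<xi>] by auto
qed

text \<open>\<open>A\<close>, \<open>B\<close> and \<open>h\<close> stand for \<open>jxi\<close>,
  \<open>js\<close> and \<open>g\<close> evaluated along the solution, and \<open>f\<close> is a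
  majorant of |h|. The constant on the right is the squared Sobolev constant divided by the
  ellipticity constant.\<close>

lemma energy_inequality:
  fixes \<Omega> :: "(real^'n) set" and f :: "real^'n \<Rightarrow> real"
  assumes dim: "CARD('n) \<ge> 3" and \<Omega>: "open \<Omega>" and \<alpha>0: "\<alpha>0 > 0" and R: "0 < R"
    and u: "H01 \<Omega> u G"
    and ell: "AE x in lebesgue_on \<Omega>. \<alpha>0 * (norm (G x))\<^sup>2 \<le> A x \<bullet> G x"
    and sgn: "AE x in lebesgue_on \<Omega>. R \<le> \<bar>u x\<bar> \<longrightarrow> 0 \<le> B x * u x"
    and iA: "integrable (lebesgue_on \<Omega>) (\<lambda>x. A x \<bullet> G x)"
    and iB: "integrable (lebesgue_on \<Omega>) (\<lambda>x. B x * u x)"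
    and eq: "\<And>v H. H01 \<Omega> v H \<Longrightarrow> integrable (lebesgue_on \<Omega>) (\<lambda>x. A x \<bullet> H x) \<Longrightarrow>
        integrable (lebesgue_on \<Omega>) (\<lambda>x. B x * v x) \<Longrightarrow>
        (\<integral>x. A x \<bullet> H x \<partial>lebesgue_on \<Omega>) + (\<integral>x. B x * v x \<partial>lebesgue_on \<Omega>) = (\<integral>x. h x * v x \<partial>lebesgue_on \<Omega>)"
    and f: "f \<in> borel_measurable (lebesgue_on \<Omega>)" "\<And>x. 0 \<le> f x"
    and ifu: "integrable (lebesgue_on \<Omega>) (\<lambda>x. f x * \<bar>u x\<bar>)"
    and hf: "AE x in lebesgue_on \<Omega>. \<bar>h x\<bar> \<le> f x"
    and c: "cutoff R \<phi> \<Phi>"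
  defines "n \<equiv> real CARD('n)"
  shows "integrable (lebesgue_on \<Omega>) (\<lambda>x. \<Phi> \<bar>u x\<bar> powr (2 * n / (n - 2)))" (is ?I1)
    and "integrable (lebesgue_on \<Omega>) (\<lambda>x. f x * (\<phi> \<bar>u x\<bar> * \<Phi> \<bar>u x\<bar>))" (is ?I2)
    and "(\<integral>x. \<Phi> \<bar>u x\<bar> powr (2 * n / (n - 2)) \<partial>lebesgue_on \<Omega>) powr ((n - 2) / n)
      \<le> (2 * (n - 1) / (n - 2))\<^sup>2 / \<alpha>0 * (\<integral>x. f x * (\<phi> \<bar>u x\<bar> * \<Phi> \<bar>u x\<bar>) \<partial>lebesgue_on \<Omega>)" (is ?le)
proof -
  let ?M = "lebesgue_on \<Omega>"
  note cd = cutoffD[OF c R]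
  have [measurable]: "u \<in> borel_measurable ?M" "G \<in> borel_measurable ?M" "f \<in> borel_measurable ?M"
    and iG: "integrable ?M (\<lambda>x. (norm (G x))\<^sup>2)"
    using u f by (auto simp: H01_def Lp_mem_def)
  have [measurable]: "\<phi> \<in> borel_measurable borel" "\<Phi> \<in> borel_measurable borel"
    using cd(7,8) by (auto intro: borel_measurable_continuous_onI)
  obtain M where M: "\<And>t. \<phi> t \<le> M" using c by (auto simp: cutoff_def)
  have M0: "0 \<le> M" using M[of 0] cd(1)[of 0] by simp
  have contsq: "continuous_on UNIV (\<lambda>t. (\<phi> t)\<^sup>2)"
    using cd(7) by (intro continuous_intros)
  obtain Q where Q0: "Q 0 = 0" and Q: "\<And>t. (Q has_real_derivative (\<phi> t)\<^sup>2) (at t)"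
    using continuous_antiderivative[OF contsq] by blast
  have csq: "cutoff R (\<lambda>t. (\<phi> t)\<^sup>2) Q"
    unfolding cutoff_def mono_def using contsq Q Q0 cd(1,2,9) M by (auto intro!: power_mono exI[of _ "M\<^sup>2"])
  note cq = cutoffD[OF csq R]
  \<comment> \<open>With \<open>\<phi> t\<close> frozen, both sides vanish at 0 and their
    derivatives compare: \<open>\<phi> s * \<phi> s \<le> \<phi> t * \<phi> s\<close> for
    \<open>s \<le> t\<close>.\<close>
  have QP: "Q t \<le> \<phi> t * \<Phi> t" if "0 \<le> t" for t
  proof -
    have "\<phi> t * \<Phi> 0 - Q 0 \<le> \<phi> t * \<Phi> t - Q t"
    proof (rule DERIV_nonneg_imp_nondecreasing[OF that, where f = "\<lambda>s. \<phi> t * \<Phi> s - Q s"])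
      fix s assume "0 \<le> s" "s \<le> t"
      then show "\<exists>y. ((\<lambda>s. \<phi> t * \<Phi> s - Q s) has_real_derivative y) (at s) \<and> 0 \<le> y"
        using cd(9)[of s t] cd(1)[of s] DERIV_diff[OF DERIV_cmult[OF cd(6)[of s], of "\<phi> t"] Q[of s]]
        by (intro exI[of _ "\<phi> t * \<phi> s - (\<phi> s)\<^sup>2"]) (auto intro: mult_right_mono simp: power2_eq_square)
    qed
    then show ?thesis using cd(3)[of 0] R Q0 by simp
  qed
  \<comment> \<open>All ingredients vanish on the negative half line, so at each \<open>s\<close> at
    most one of the two terms is nonzero. Thus \<open>F\<close> is the even and \<open>T\<close> the
    odd extension, and both are C^1 across 0.\<close>
  define F where "F s = \<Phi> s + \<Phi> (- s)" for s
  define F' where "F' s = \<phi> s - \<phi> (- s)" for s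
  define T where "T s = Q s - Q (- s)" for s
  define T' where "T' s = (\<phi> s)\<^sup>2 + (\<phi> (- s))\<^sup>2" for s
  have neg: "\<phi> (- \<bar>s\<bar>) = 0" "\<Phi> (- \<bar>s\<bar>) = 0" "Q (- \<bar>s\<bar>) = 0" for s
    using cd(2)[of "- \<bar>s\<bar>"] cd(3)[of "- \<bar>s\<bar>"] cq(3)[of "- \<bar>s\<bar>"] R by auto
  have F: "F s = \<Phi> \<bar>s\<bar>" and F': "\<bar>F' s\<bar> = \<phi> \<bar>s\<bar>" and T: "T s = sgn s * Q \<bar>s\<bar>" and T': "T' s = (\<phi> \<bar>s\<bar>)\<^sup>2" for s
    using neg[of s] cd(1)[of s] cd(1)[of "-s"] cd(3)[of 0] Q0 R
    by (cases "s > 0"; cases "s = 0"; simp add: F_def F'_def T_def T'_def)+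
  have reflect: "((\<lambda>s. k (- s)) has_real_derivative - k' (- s)) (at s)"
    if "\<And>s. (k has_real_derivative k' s) (at s)" for k k' and s :: real
    using that[of "-s"] unfolding DERIV_mirror .
  have dF: "(F has_real_derivative F' s) (at s)" for s
    unfolding F_def[abs_def] F'_def using DERIV_add[OF cd(6) reflect[OF cd(6)]] by simp
  have dT: "(T has_real_derivative T' s) (at s)" for s
    unfolding T_def[abs_def] T'_def using DERIV_diff[OF Q reflect[OF Q]] by simp
  have cF': "continuous_on UNIV F'" "continuous_on UNIV T'"
    unfolding F'_def T'_def by (intro continuous_intros continuous_on_compose2[OF cd(7)]; auto)+
  have bF': "\<bar>F' s\<bar> \<le> M" and bT': "\<bar>T' s\<bar> \<le> M\<^sup>2" for s
    using M[of "\<bar>s\<bar>"] cd(1)[of "\<bar>s\<bar>"] by (auto simp: F' T' intro!: power_mono)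
  have F0: "F 0 = 0" and T0: "T 0 = 0" using cd(3)[of 0] R Q0 by (auto simp: F T)
  have HF: "H01 \<Omega> (\<lambda>x. F (u x)) (\<lambda>x. F' (u x) *\<^sub>R G x)"
    by (rule H01_comp[OF \<Omega> u dF cF'(1) F0 bF'])
  have HT: "H01 \<Omega> (\<lambda>x. T (u x)) (\<lambda>x. T' (u x) *\<^sub>R G x)"
    by (rule H01_comp[OF \<Omega> u dT cF'(2) T0 bT'])
  have [measurable]: "T \<in> borel_measurable borel" "T' \<in> borel_measurable borel"
    using cF'(2) dT by (auto intro!: borel_measurable_continuous_onI continuous_at_imp_continuous_on DERIV_isCont)
  \<comment> \<open>This identity is the reason for the square in \<open>T'\<close>: testing with
    \<open>T (u x)\<close> produces exactly the gradient integral that the Sobolev inequality for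
    \<open>F (u x)\<close> needs.\<close>
  have nF': "(norm (F' (u x) *\<^sub>R G x))\<^sup>2 = T' (u x) * (norm (G x))\<^sup>2" for x
    by (simp add: power_mult_distrib F' T')
  have Tbd: "\<bar>T s\<bar> \<le> M\<^sup>2 * \<bar>s\<bar>" for s
  proof -
    have "\<bar>T s\<bar> \<le> Q \<bar>s\<bar>" using cq(4)[of "\<bar>s\<bar>"] by (simp add: T abs_mult abs_sgn_eq Q0)
    also have "\<dots> \<le> (\<phi> \<bar>s\<bar>)\<^sup>2 * \<bar>s\<bar>" using cq(5)[of "\<bar>s\<bar>"] by simp
    also have "\<dots> \<le> M\<^sup>2 * \<bar>s\<bar>" using M cd(1) by (intro mult_right_mono power_mono) auto
    finally show ?thesis .
  qed
  \<comment> \<open>Only the scalar \<open>A x \<bullet> G x\<close> is known to be integrable; this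
    suffices because the gradient of the test function is a bounded multiple of
    \<open>G x\<close>.\<close>
  have jA: "integrable ?M (\<lambda>x. A x \<bullet> (T' (u x) *\<^sub>R G x))"
    by (rule Bochner_Integration.integrable_bound[OF integrable_mult_right[OF iA, of "M\<^sup>2"]])
       (use iA bT' in \<open>auto simp: abs_mult intro!: mult_right_mono\<close>)
  \<comment> \<open>Nothing is assumed about the measurability of \<open>B\<close>; the quotient reduces it to that of \<open>B x * u x\<close>.\<close>
  have BT: "B x * T (u x) = (B x * u x) * (T (u x) / u x)" for x
    using T0 by (cases "u x = 0") auto
  have jB: "integrable ?M (\<lambda>x. B x * T (u x))"
    unfolding BT
  proof (rule Bochner_Integration.integrable_bound[OF integrable_mult_right[OF iB, of "M\<^sup>2"]])
    have [measurable]: "(\<lambda>x. B x * u x) \<in> borel_measurable ?M" using iB by auto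
    show "(\<lambda>x. (B x * u x) * (T (u x) / u x)) \<in> borel_measurable ?M" by measurable
    have "\<bar>T s / s\<bar> \<le> M\<^sup>2" for s
      using Tbd[of s] by (cases "s = 0") (auto simp: abs_divide field_simps)
    then show "AE x in ?M. norm ((B x * u x) * (T (u x) / u x)) \<le> norm (M\<^sup>2 * (B x * u x))"
      by (intro AE_I2) (metis abs_ge_zero abs_mult abs_of_nonneg mult.commute mult_left_mono real_norm_def zero_le_power2)
  qed
  have E: "(\<integral>x. A x \<bullet> (T' (u x) *\<^sub>R G x) \<partial>?M) + (\<integral>x. B x * T (u x) \<partial>?M) = (\<integral>x. h x * T (u x) \<partial>?M)"
    by (rule eq[OF HT jA jB])
  have B0: "0 \<le> (\<integral>x. B x * T (u x) \<partial>?M)"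
  proof (rule integral_nonneg_AE)
    show "AE x in ?M. 0 \<le> B x * T (u x)"
      using sgn
    proof eventually_elim
      case (elim x)
      show ?case
      proof (cases "R \<le> \<bar>u x\<bar>")
        case True
        have "0 \<le> T (u x) / u x"
          using cq(4)[of "\<bar>u x\<bar>"]
          by (cases "u x" "0 :: real" rule: linorder_cases) (auto simp: T divide_nonneg_neg)
        moreover have "0 \<le> B x * u x" using elim True by simp
        ultimately show ?thesis unfolding BT by (intro mult_nonneg_nonneg[of "B x * u x"])
      next
        case False
        then show ?thesis using cq(3)[of "\<bar>u x\<bar>"] by (simp add: T)
      qed
    qed
  qed
  have iT'G: "integrable ?M (\<lambda>x. T' (u x) * (norm (G x))\<^sup>2)"
    using HF unfolding H01_def nF' by blast
  have low: "\<alpha>0 * (\<integral>x. T' (u x) * (norm (G x))\<^sup>2 \<partial>?M) \<le> (\<integral>x. A x \<bullet> (T' (u x) *\<^sub>R G x) \<partial>?M)"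
  proof -
    have "(\<integral>x. \<alpha>0 * (T' (u x) * (norm (G x))\<^sup>2) \<partial>?M) \<le> (\<integral>x. A x \<bullet> (T' (u x) *\<^sub>R G x) \<partial>?M)"
    proof (rule integral_mono_AE)
      show "AE x in ?M. \<alpha>0 * (T' (u x) * (norm (G x))\<^sup>2) \<le> A x \<bullet> (T' (u x) *\<^sub>R G x)"
        using ell
      proof eventually_elim
        case (elim x)
        have "T' (u x) * (\<alpha>0 * (norm (G x))\<^sup>2) \<le> T' (u x) * (A x \<bullet> G x)"
          using elim by (intro mult_left_mono) (auto simp: T')
        then show ?case by (simp add: mult_ac)
      qed
    qed (use iT'G jA in auto)
    then show ?thesis by simp
  qed
  have \<phi>\<Phi>: "\<phi> \<bar>s\<bar> * \<Phi> \<bar>s\<bar> \<le> M\<^sup>2 * \<bar>s\<bar>" for s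
  proof -
    have "\<phi> \<bar>s\<bar> * \<Phi> \<bar>s\<bar> \<le> \<phi> \<bar>s\<bar> * (\<phi> \<bar>s\<bar> * \<bar>s\<bar>)"
      using cd(1,5) by (intro mult_left_mono) auto
    also have "\<dots> = (\<phi> \<bar>s\<bar>)\<^sup>2 * \<bar>s\<bar>" by (simp add: power2_eq_square)
    also have "\<dots> \<le> M\<^sup>2 * \<bar>s\<bar>" using M cd(1) by (intro mult_right_mono power_mono) auto
    finally show ?thesis .
  qed
  show I2: ?I2
  proof (rule Bochner_Integration.integrable_bound[OF integrable_mult_right[OF ifu, of "M\<^sup>2"]])
    show "AE x in ?M. norm (f x * (\<phi> \<bar>u x\<bar> * \<Phi> \<bar>u x\<bar>)) \<le> norm (M\<^sup>2 * (f x * \<bar>u x\<bar>))"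
    proof (rule AE_I2)
      fix x
      have "f x * (\<phi> \<bar>u x\<bar> * \<Phi> \<bar>u x\<bar>) \<le> f x * (M\<^sup>2 * \<bar>u x\<bar>)"
        using f \<phi>\<Phi> by (intro mult_left_mono) auto
      then show "norm (f x * (\<phi> \<bar>u x\<bar> * \<Phi> \<bar>u x\<bar>)) \<le> norm (M\<^sup>2 * (f x * \<bar>u x\<bar>))"
        using f cd(1,4) by (simp add: abs_mult mult_ac)
    qed
  qed measurable
  have up: "(\<integral>x. h x * T (u x) \<partial>?M) \<le> (\<integral>x. f x * (\<phi> \<bar>u x\<bar> * \<Phi> \<bar>u x\<bar>) \<partial>?M)"
  proof (cases "integrable ?M (\<lambda>x. h x * T (u x))")
    case True
    show ?thesis
    proof (rule integral_mono_AE[OF True I2])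
      show "AE x in ?M. h x * T (u x) \<le> f x * (\<phi> \<bar>u x\<bar> * \<Phi> \<bar>u x\<bar>)"
        using hf
      proof eventually_elim
        case (elim x)
        have "\<bar>T (u x)\<bar> \<le> Q \<bar>u x\<bar>" using cq(4)[of "\<bar>u x\<bar>"] by (simp add: T abs_mult abs_sgn_eq Q0)
        also have "\<dots> \<le> \<phi> \<bar>u x\<bar> * \<Phi> \<bar>u x\<bar>" by (rule QP) simp
        finally have "\<bar>h x\<bar> * \<bar>T (u x)\<bar> \<le> f x * (\<phi> \<bar>u x\<bar> * \<Phi> \<bar>u x\<bar>)"
          using elim f by (intro mult_mono) auto
        then show ?case by (metis abs_ge_self abs_mult order_trans)
      qed
    qed
  next
    case False
    \<comment> \<open>The Bochner integral of a non-integrable function is 0 by convention.\<close>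
    then have "(\<integral>x. h x * T (u x) \<partial>?M) = 0" by (rule not_integrable_integral_eq)
    also have "0 \<le> (\<integral>x. f x * (\<phi> \<bar>u x\<bar> * \<Phi> \<bar>u x\<bar>) \<partial>?M)"
      using f cd(1,4) by (intro Bochner_Integration.integral_nonneg mult_nonneg_nonneg) auto
    finally show ?thesis .
  qed
  let ?X = "\<integral>x. T' (u x) * (norm (G x))\<^sup>2 \<partial>?M"
  let ?\<gamma> = "2 * (n - 1) / (n - 2)"
  have X: "?X \<le> (\<integral>x. f x * (\<phi> \<bar>u x\<bar> * \<Phi> \<bar>u x\<bar>) \<partial>?M) / \<alpha>0"
    using low E B0 up \<alpha>0 by (simp add: field_simps)
  have X0: "0 \<le> ?X" by (intro Bochner_Integration.integral_nonneg mult_nonneg_nonneg) (auto simp: T')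
  have n: "n \<ge> 3" using dim by (simp add: n_def)
  note S = Sobolev_H01[OF \<Omega> HF dim, folded n_def, unfolded nF' F]
  have abs\<Phi>: "\<bar>\<Phi> t\<bar> = \<Phi> t" for t using cd(4)[of t] by simp
  show ?I1 using S(1) unfolding abs\<Phi> .
  have "(\<integral>x. \<Phi> \<bar>u x\<bar> powr (2 * n / (n - 2)) \<partial>?M) powr ((n - 2) / n)
     \<le> ((?\<gamma>\<^sup>2 * ?X) powr (n / (n - 2))) powr ((n - 2) / n)"
    using S(2) n unfolding abs\<Phi> by (intro powr_mono2) (auto intro!: Bochner_Integration.integral_nonneg)
  also have "\<dots> = ?\<gamma>\<^sup>2 * ?X"
    using X0 n by (simp add: powr_powr)
  also have "\<dots> \<le> ?\<gamma>\<^sup>2 / \<alpha>0 * (\<integral>x. f x * (\<phi> \<bar>u x\<bar> * \<Phi> \<bar>u x\<bar>) \<partial>?M)"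
    using mult_left_mono[OF X, of "?\<gamma>\<^sup>2"] by simp
  finally show ?le .
qed

section \<open>Integrability and boundedness from the energy inequality\<close>

text \<open>For \<open>X > 1\<close> the constant \<open>B\<close> is at most
  \<open>B * X powr \<tau>\<close>, and the lower power can be divided out. The bound is explicit so
  that it can be seen not to depend on a truncation level.\<close>

lemma powr_inequality_bound:
  fixes X :: real
  assumes "X powr \<theta> \<le> A * X powr \<tau> + B" "0 \<le> X" "0 \<le> A" "0 \<le> B" "0 \<le> \<tau>" "\<tau> < \<theta>"
  shows "X \<le> 1 + (A + B) powr (1 / (\<theta> - \<tau>))"
proof (cases "X \<le> 1")
  case True
  then show ?thesis by (simp add: add_increasing2)
next
  case False
  then have X: "X > 1" by simp
  have "1 \<le> X powr \<tau>" using X assms by (simp add: ge_one_powr_ge_zero)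
  then have "B * 1 \<le> B * X powr \<tau>" using assms by (intro mult_left_mono) auto
  then have "X powr \<theta> \<le> (A + B) * X powr \<tau>"
    using assms(1) by (simp add: algebra_simps)
  then have "X powr (\<theta> - \<tau>) \<le> A + B"
    using X by (simp add: powr_diff divide_le_eq)
  then have "(X powr (\<theta> - \<tau>)) powr (1 / (\<theta> - \<tau>)) \<le> (A + B) powr (1 / (\<theta> - \<tau>))"
    using assms by (intro powr_mono2) auto
  then show ?thesis using X assms by (simp add: powr_powr)
qed

text \<open>The equation and the gradient of \<open>u\<close> enter the regularity argument only
  through these inequalities. Here \<open>s\<close> is the critical exponent and
  \<open>\<theta> = 2 / s\<close>; \<open>K\<close> will be the constant of
  \<open>energy_inequality\<close>.\<close>

locale energy_bound = finite_measure M for M :: "'a measure" +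
  fixes n R K s \<theta> :: real and u f :: "'a \<Rightarrow> real"
  assumes n: "n \<ge> 3" and R: "0 < R" and K: "0 \<le> K"
    and s: "s = 2 * n / (n - 2)" and \<theta>: "\<theta> = (n - 2) / n"
    and u_meas [measurable]: "u \<in> borel_measurable M" and f_meas [measurable]: "f \<in> borel_measurable M"
    and f_nonneg: "\<And>x. 0 \<le> f x"
    and u_int: "integrable M (\<lambda>x. \<bar>u x\<bar> powr s)"
    and energy_int: "\<And>\<phi> \<Phi>. cutoff R \<phi> \<Phi> \<Longrightarrow> integrable M (\<lambda>x. \<Phi> \<bar>u x\<bar> powr s)"
      "\<And>\<phi> \<Phi>. cutoff R \<phi> \<Phi> \<Longrightarrow> integrable M (\<lambda>x. f x * (\<phi> \<bar>u x\<bar> * \<Phi> \<bar>u x\<bar>))"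
    and energy: "\<And>\<phi> \<Phi>. cutoff R \<phi> \<Phi> \<Longrightarrow>
      (\<integral>x. \<Phi> \<bar>u x\<bar> powr s \<partial>M) powr \<theta> \<le> K * (\<integral>x. f x * (\<phi> \<bar>u x\<bar> * \<Phi> \<bar>u x\<bar>) \<partial>M)"
begin

lemma exponents: "s > 2" "0 < \<theta>" "\<theta> < 1" "s * \<theta> = 2"
  using n by (auto simp: s \<theta> field_simps)

section \<open>Brezis-Kato absorption with truncated powers\<close>

lemma tail_tendsto_0:
  "(\<lambda>k. \<integral>x. \<bar>u x\<bar> powr s * indicator {x \<in> space M. \<bar>u x\<bar> > real k} x \<partial>M) \<longlonglongrightarrow> 0"
proof -
  have "(\<lambda>k. \<integral>x. \<bar>u x\<bar> powr s * indicator {x \<in> space M. \<bar>u x\<bar> > real k} x \<partial>M) \<longlonglongrightarrow> (\<integral>x. 0 \<partial>M)"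
  proof (rule integral_dominated_convergence[OF _ _ u_int])
    show "AE x in M. (\<lambda>k. \<bar>u x\<bar> powr s * indicator {x \<in> space M. \<bar>u x\<bar> > real k} x) \<longlonglongrightarrow> 0"
    proof (rule AE_I2)
      fix x
      obtain k0 :: nat where "\<bar>u x\<bar> < real k0" using reals_Archimedean2 by blast
      then have "\<forall>\<^sub>F k in sequentially. \<bar>u x\<bar> powr s * indicator {x \<in> space M. \<bar>u x\<bar> > real k} x = 0"
        by (intro eventually_sequentiallyI[of k0]) (auto simp: indicator_def)
      then show "(\<lambda>k. \<bar>u x\<bar> powr s * indicator {x \<in> space M. \<bar>u x\<bar> > real k} x) \<longlonglongrightarrow> 0"
        by (rule tendsto_eventually)
    qed
  qed (auto simp: indicator_def)
  then show ?thesis by simp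
qed

text \<open>\<open>\<phi>\<close> is the derivative of \<open>(t - R) powr \<gamma>\<close>, frozen
  from \<open>R + k\<close> on; so \<open>\<Phi>\<close> is that power up to \<open>R + k\<close>
  and affine afterwards. None of the constants in the estimates involves \<open>k\<close>, which is
  what permits letting \<open>k\<close> tend to infinity.\<close>

lemma powr_cutoff:
  assumes \<gamma>: "1 < \<gamma>" and k: "0 < k"
  obtains \<phi> \<Phi> where "cutoff R \<phi> \<Phi>" "\<And>t. R \<le> t \<Longrightarrow> \<phi> t \<le> \<gamma> * (t - R) powr (\<gamma> - 1)"
    "\<And>t. R \<le> t \<Longrightarrow> (t - R) * \<phi> t \<le> \<gamma> * \<Phi> t"
    "\<And>t. R \<le> t \<Longrightarrow> min (t - R) k powr \<gamma> \<le> \<Phi> t"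
    "\<And>t. R \<le> t \<Longrightarrow> \<phi> t \<le> \<gamma> * \<Phi> t powr ((\<gamma> - 1) / \<gamma>)"
proof -
  define \<sigma> where "\<sigma> t = min (max (t - R) 0) k" for t
  define \<phi> where "\<phi> t = \<gamma> * \<sigma> t powr (\<gamma> - 1)" for t
  have \<sigma>0: "0 \<le> \<sigma> t" "\<sigma> t \<le> k" for t using k by (auto simp: \<sigma>_def)
  have c\<phi>: "continuous_on UNIV \<phi>"
    unfolding \<phi>_def \<sigma>_def using \<gamma> k by (intro continuous_intros continuous_on_powr') auto
  obtain \<Phi> where \<Phi>: "\<Phi> 0 = 0" "\<And>t. (\<Phi> has_real_derivative \<phi> t) (at t)"
    using continuous_antiderivative[OF c\<phi>] by blast
  have mono: "mono \<phi>"
    unfolding mono_def \<phi>_def using \<gamma> \<sigma>0 by (auto intro!: mult_left_mono powr_mono2 simp: \<sigma>_def)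
  have bd: "\<phi> t \<le> \<gamma> * k powr (\<gamma> - 1)" for t
    unfolding \<phi>_def using \<gamma> \<sigma>0 by (auto intro!: mult_left_mono powr_mono2)
  have c: "cutoff R \<phi> \<Phi>"
  proof -
    have "\<forall>t\<le>R. \<phi> t = 0" using k by (auto simp: \<phi>_def \<sigma>_def)
    then show ?thesis unfolding cutoff_def using c\<phi> mono bd \<Phi> by blast
  qed
  note cd = cutoffD[OF c R]
  have up: "\<phi> t \<le> \<gamma> * (t - R) powr (\<gamma> - 1)" if "R \<le> t" for t
    unfolding \<phi>_def using \<gamma> \<sigma>0 that by (auto intro!: mult_left_mono powr_mono2 simp: \<sigma>_def)
  have i: "(t - R) * \<phi> t \<le> \<gamma> * \<Phi> t" if "R \<le> t" for t
  proof (cases "t = R")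
    case True
    then show ?thesis using cd(4)[of t] \<gamma> by simp
  next
    case False
    with that have t: "R < t" by simp
    \<comment> \<open>The chord of the concave function \<open>\<sigma>\<close> from
      \<open>R\<close> to \<open>t\<close> lies below \<open>\<sigma>\<close>. This \<open>d\<close>
      makes the derivative of \<open>d * (y - R) powr \<gamma>\<close> equal to
      \<open>\<gamma>\<close> times the chord to the power \<open>\<gamma> - 1\<close>, hence at
      most \<open>\<phi> y\<close>, with equality at \<open>y = t\<close>.\<close>
    define d where "d = (\<sigma> t / (t - R)) powr (\<gamma> - 1)"
    have "\<Phi> R - d * \<bar>R - R\<bar> powr \<gamma> \<le> \<Phi> t - d * \<bar>t - R\<bar> powr \<gamma>"
    proof (rule DERIV_nonneg_imp_nondecreasing[OF that, where f = "\<lambda>y. \<Phi> y - d * \<bar>y - R\<bar> powr \<gamma>"])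
      fix y assume y: "R \<le> y" "y \<le> t"
      have "((\<lambda>y. \<bar>y - R\<bar> powr \<gamma>) has_real_derivative \<gamma> * \<bar>y - R\<bar> powr (\<gamma> - 1) * sgn (y - R) * 1) (at y)"
        by (rule DERIV_chain2[OF abs_powr_has_real_derivative[OF \<gamma>]]) (auto intro!: derivative_eq_intros)
      from DERIV_diff[OF \<Phi>(2) DERIV_cmult[OF this, of d]]
      have D: "((\<lambda>y. \<Phi> y - d * \<bar>y - R\<bar> powr \<gamma>) has_real_derivative
          \<phi> y - d * (\<gamma> * \<bar>y - R\<bar> powr (\<gamma> - 1) * sgn (y - R))) (at y)" by simp
      have "\<sigma> t / (t - R) * (y - R) \<le> \<sigma> y"
      proof -
        have "\<sigma> t * (y - R) \<le> (t - R) * (y - R)" using y by (intro mult_right_mono) (auto simp: \<sigma>_def)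
        moreover have "\<sigma> t * (y - R) \<le> k * (t - R)" using y \<sigma>0 k by (intro mult_mono) auto
        moreover have "\<sigma> y = min (y - R) k" using y by (simp add: \<sigma>_def)
        ultimately show ?thesis using t by (simp add: pos_divide_le_eq mult.commute[of "t - R"])
      qed
      then have "(\<sigma> t / (t - R) * (y - R)) powr (\<gamma> - 1) \<le> \<sigma> y powr (\<gamma> - 1)"
        using y t \<sigma>0 \<gamma> by (intro powr_mono2) auto
      then have "d * (y - R) powr (\<gamma> - 1) \<le> \<sigma> y powr (\<gamma> - 1)"
        unfolding d_def powr_mult[symmetric] .
      then have "\<gamma> * (d * (y - R) powr (\<gamma> - 1)) \<le> \<phi> y"
        unfolding \<phi>_def using \<gamma> by (intro mult_left_mono) auto
      moreover have "d * (\<gamma> * \<bar>y - R\<bar> powr (\<gamma> - 1) * sgn (y - R)) \<le> \<gamma> * (d * (y - R) powr (\<gamma> - 1))"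
        using y by (auto simp: sgn_if)
      ultimately show "\<exists>z. ((\<lambda>y. \<Phi> y - d * \<bar>y - R\<bar> powr \<gamma>) has_real_derivative z) (at y) \<and> 0 \<le> z"
        using D by (intro exI[of _ "\<phi> y - d * (\<gamma> * \<bar>y - R\<bar> powr (\<gamma> - 1) * sgn (y - R))"]) simp
    qed
    then have "d * (t - R) powr \<gamma> \<le> \<Phi> t"
      using cd(3)[of R] t \<gamma> by simp
    moreover have "\<gamma> * (d * (t - R) powr \<gamma>) = (t - R) * \<phi> t"
    proof -
      have "(t - R) powr \<gamma> = (t - R) powr (\<gamma> - 1) * (t - R)"
        using t by (simp add: powr_diff)
      moreover have "d * (t - R) powr (\<gamma> - 1) = \<sigma> t powr (\<gamma> - 1)"
        using t \<sigma>0(1)[of t] by (simp add: d_def powr_divide)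
      ultimately show ?thesis by (simp add: \<phi>_def)
    qed
    ultimately show ?thesis using \<gamma> by (metis less_imp_le less_trans mult_left_mono zero_less_one)
  qed
  have ii: "min (t - R) k powr \<gamma> \<le> \<Phi> t" if "R \<le> t" for t
  proof -
    have \<sigma>t: "\<sigma> t = min (t - R) k" using that by (simp add: \<sigma>_def)
    have "\<sigma> t powr \<gamma> = \<sigma> t powr (\<gamma> - 1) * \<sigma> t"
      using \<sigma>0(1)[of t] by (cases "\<sigma> t = 0") (auto simp: powr_diff)
    also have "\<dots> \<le> \<sigma> t powr (\<gamma> - 1) * (t - R)"
      by (intro mult_left_mono) (auto simp: \<sigma>t)
    also have "\<gamma> * \<dots> \<le> \<gamma> * \<Phi> t"
      using i[OF that] by (simp add: \<phi>_def mult_ac)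
    finally show ?thesis
      using \<gamma> by (simp add: \<sigma>t)
  qed
  have "\<phi> t \<le> \<gamma> * \<Phi> t powr ((\<gamma> - 1) / \<gamma>)" if "R \<le> t" for t
  proof -
    have "\<sigma> t powr (\<gamma> - 1) = (\<sigma> t powr \<gamma>) powr ((\<gamma> - 1) / \<gamma>)"
      using \<gamma> by (simp add: powr_powr)
    also have "\<dots> \<le> \<Phi> t powr ((\<gamma> - 1) / \<gamma>)"
      using ii[OF that] \<gamma> that by (intro powr_mono2) (auto simp: \<sigma>_def)
    finally show ?thesis unfolding \<phi>_def using \<gamma> by (intro mult_left_mono) auto
  qed
  with c up i ii show ?thesis by (rule that)
qed


text \<open>The exponent required of \<open>a\<close> satisfies
  \<open>1 / \<rho> = 1 / q + 2 / n\<close>. In the energy inequality the \<open>a\<close> term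
  yields the energy integral \<open>X\<close> to a power \<open>\<tau> < \<theta>\<close>, for which
  any constant is harmless. The critical term reproduces \<open>X powr \<theta>\<close> itself and
  must be given a coefficient small enough to be absorbed.\<close>

lemma integrable_powr_bootstrap:
  assumes f_le: "\<And>x. f x \<le> a x + b * \<bar>u x\<bar> powr ((n + 2) / (n - 2))"
    and b: "0 \<le> b" and a: "\<And>x. 0 \<le> a x" and a_meas [measurable]: "a \<in> borel_measurable M"
    and q: "s < q" and a_int: "integrable M (\<lambda>x. a x powr (q * n / (n + 2 * q)))"
  shows "integrable M (\<lambda>x. \<bar>u x\<bar> powr q)"
proof -
  define \<gamma> where "\<gamma> = q / s"
  \<comment> \<open>\<open>\<tau>\<close> is the Hoelder complement of \<open>1 / \<rho>\<close>. At
    the same time \<open>s * \<tau> = 2 - 1 / \<gamma>\<close>, which is the power of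
    \<open>\<Phi>\<close> that dominates \<open>\<phi> * \<Phi>\<close>.\<close>
  define \<tau> where "\<tau> = \<theta> - 1 / q"
  define \<rho> where "\<rho> = q * n / (n + 2 * q)"
  define p where "p = (n + 2) / (n - 2)"
  have q2: "q > 2" using q exponents(1) by linarith
  have \<gamma>: "1 < \<gamma>" using q exponents by (simp add: \<gamma>_def)
  have "1 / q < 1 / s" using q exponents by (simp add: field_simps)
  also have "1 / s = \<theta> / 2" using n by (simp add: s \<theta> field_simps)
  finally have \<tau>0: "0 < \<tau>" "\<tau> < \<theta>" "\<theta> - \<tau> = 1 / q"
    using q2 exponents(2) by (auto simp: \<tau>_def)
  have \<rho>\<tau>: "1 / \<rho> + \<tau> = 1" "0 \<le> 1 / \<rho>" "\<rho> > 0"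
    using n q2 by (auto simp: \<rho>_def \<tau>_def \<theta> field_simps)
  have s\<tau>: "s * \<tau> = 1 + (\<gamma> - 1) / \<gamma>"
  proof -
    have "(\<gamma> - 1) / \<gamma> = 1 - s / q" using exponents q2 by (simp add: \<gamma>_def field_simps)
    then show ?thesis using exponents(4) by (simp add: \<tau>_def right_diff_distrib)
  qed
  have \<gamma>s: "\<gamma> * s = q" using exponents by (simp add: \<gamma>_def)
  have p1: "p = 1 + s * (2 / n)" "2 / n + \<theta> = 1" "0 < p"
    using n by (auto simp: p_def s \<theta> field_simps)
  let ?B = "\<lambda>k::nat. {x \<in> space M. \<bar>u x\<bar> > real k}"
  let ?\<delta> = "\<lambda>k::nat. \<integral>x. \<bar>u x\<bar> powr s * indicator (?B k) x \<partial>M"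
  \<comment> \<open>This is the coefficient with which the set where |u| exceeds \<open>k\<close>
    contributes to \<open>X powr \<theta>\<close>. The level \<open>m\<close> makes it at most 1/2,
    and \<open>2 * R \<le> m\<close> ensures \<open>t \<le> 2 * (t - R)\<close> above
    \<open>m\<close>.\<close>
  have "(\<lambda>k. K * (b * (2 * \<gamma> * ?\<delta> k powr (2 / n)))) \<longlonglongrightarrow> K * (b * (2 * \<gamma> * 0 powr (2 / n)))"
    using n by (intro tendsto_intros tendsto_powr' tail_tendsto_0)
      (auto intro!: Bochner_Integration.integral_nonneg always_eventually)
  then have "\<forall>\<^sub>F k in sequentially. K * (b * (2 * \<gamma> * ?\<delta> k powr (2 / n))) < 1 / 2"
    by (rule order_tendstoD) simp
  moreover have "\<forall>\<^sub>F k in sequentially. 2 * R \<le> real k"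
    using filterlim_real_sequentially by (simp add: filterlim_at_top)
  ultimately have "\<forall>\<^sub>F k in sequentially. K * (b * (2 * \<gamma> * ?\<delta> k powr (2 / n))) < 1 / 2 \<and> 2 * R \<le> real k"
    by (rule eventually_conj)
  then obtain m where m: "K * (b * (2 * \<gamma> * ?\<delta> m powr (2 / n))) \<le> 1 / 2" "2 * R \<le> real m"
    by (metis (no_types, lifting) eventually_sequentially less_imp_le order_refl)
  \<comment> \<open>A pointwise bound for the critical term where |u| is at most \<open>m\<close>.
    There \<open>\<phi>\<close> is controlled by the untruncated power, so \<open>L\<close> is the
    same for every truncation level.\<close>
  define L where "L = b * (real m powr p * ((\<gamma> * real m powr (\<gamma> - 1)) * ((\<gamma> * real m powr (\<gamma> - 1)) * real m)))"
  have L0: "0 \<le> L" using b \<gamma> by (simp add: L_def)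
  define Y where "Y = (\<integral>x. a x powr \<rho> \<partial>M) powr (1 / \<rho>)"
  \<comment> \<open>The factors 2 in \<open>A\<close> and \<open>C\<close> compensate for moving
    half of \<open>X powr \<theta>\<close> to the left.\<close>
  define A where "A = 2 * K * (\<gamma> * Y)"
  define C where "C = 2 * K * (L * measure M (space M))"
  have A0: "0 \<le> A" and C0: "0 \<le> C" using K \<gamma> L0 by (auto simp: A_def C_def Y_def)
  define Z where "Z = 1 + (A + C) powr (1 / (\<theta> - \<tau>))"
  \<comment> \<open>\<open>Suc k\<close> keeps the truncation level positive, as
    \<open>powr_cutoff\<close> demands. The bound \<open>Z\<close> does not involve the
    level.\<close>
  have main: "integrable M (\<lambda>x. min (max (\<bar>u x\<bar> - R) 0) (real (Suc k)) powr q)"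
    "(\<integral>x. min (max (\<bar>u x\<bar> - R) 0) (real (Suc k)) powr q \<partial>M) \<le> Z" for k
  proof -
    obtain \<phi> \<Phi> where c: "cutoff R \<phi> \<Phi>" and c1: "\<And>t. R \<le> t \<Longrightarrow> \<phi> t \<le> \<gamma> * (t - R) powr (\<gamma> - 1)"
      and c2: "\<And>t. R \<le> t \<Longrightarrow> (t - R) * \<phi> t \<le> \<gamma> * \<Phi> t"
      and c3: "\<And>t. R \<le> t \<Longrightarrow> min (t - R) (real (Suc k)) powr \<gamma> \<le> \<Phi> t"
      and c4: "\<And>t. R \<le> t \<Longrightarrow> \<phi> t \<le> \<gamma> * \<Phi> t powr ((\<gamma> - 1) / \<gamma>)"
      using powr_cutoff[OF \<gamma>, of "real (Suc k)"] by auto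
    note cd = cutoffD[OF c R]
    have [measurable]: "\<phi> \<in> borel_measurable borel" "\<Phi> \<in> borel_measurable borel"
      using cd(7,8) by (auto intro: borel_measurable_continuous_onI)
    define X where "X = (\<integral>x. \<Phi> \<bar>u x\<bar> powr s \<partial>M)"
    have X0: "0 \<le> X" by (auto simp: X_def)
    note iX = energy_int(1)[OF c]
    let ?P1 = "\<lambda>x. (a x powr \<rho>) powr (1 / \<rho>) * (\<Phi> \<bar>u x\<bar> powr s) powr \<tau>"
    let ?P3 = "\<lambda>x. (\<bar>u x\<bar> powr s * indicator (?B m) x) powr (2 / n) * (\<Phi> \<bar>u x\<bar> powr s) powr \<theta>"
    have iD: "integrable M (\<lambda>x. \<bar>u x\<bar> powr s * indicator (?B m) x)"
      by (rule Bochner_Integration.integrable_bound[OF u_int]) (auto simp: indicator_def)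
    have H1: "integrable M ?P1" "(\<integral>x. ?P1 x \<partial>M) \<le> Y * X powr \<tau>"
      unfolding Y_def X_def using a_int \<rho>\<tau> \<tau>0 by (intro Holder_two iX; simp add: \<rho>_def)+
    have H3: "integrable M ?P3" "(\<integral>x. ?P3 x \<partial>M) \<le> ?\<delta> m powr (2 / n) * X powr \<theta>"
      unfolding X_def using p1 exponents n by (intro Holder_two iX iD; simp)+
    have pw: "f x * (\<phi> \<bar>u x\<bar> * \<Phi> \<bar>u x\<bar>) \<le> \<gamma> * ?P1 x + L + b * (2 * \<gamma>) * ?P3 x" if x: "x \<in> space M" for x
    proof (cases "\<bar>u x\<bar> < R")
      case True
      have "0 \<le> \<gamma> * ?P1 x" "0 \<le> b * (2 * \<gamma>) * ?P3 x" using \<gamma> b by auto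
      then show ?thesis using cd(3)[of "\<bar>u x\<bar>"] True L0 by simp
    next
      case False
      let ?t = "\<bar>u x\<bar>"
      have t: "R \<le> ?t" "0 < ?t" using False R by auto
      have p0: "0 \<le> \<phi> ?t" "0 \<le> \<Phi> ?t" using cd(1,4) by auto
      have "f x * (\<phi> ?t * \<Phi> ?t) \<le> (a x + b * ?t powr p) * (\<phi> ?t * \<Phi> ?t)"
        using f_le[of x] p0 unfolding p_def by (intro mult_right_mono) auto
      also have "\<dots> = a x * (\<phi> ?t * \<Phi> ?t) + b * (?t powr p * (\<phi> ?t * \<Phi> ?t))"
        by (simp add: algebra_simps)
      also have "a x * (\<phi> ?t * \<Phi> ?t) \<le> \<gamma> * ?P1 x"
      proof -
        have "\<phi> ?t * \<Phi> ?t \<le> \<gamma> * \<Phi> ?t powr ((\<gamma> - 1) / \<gamma>) * \<Phi> ?t"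
          using c4[OF t(1)] p0 by (intro mult_right_mono) auto
        also have "\<dots> = \<gamma> * \<Phi> ?t powr (s * \<tau>)"
          using p0 by (cases "\<Phi> ?t = 0") (auto simp: s\<tau> powr_add)
        finally have "a x * (\<phi> ?t * \<Phi> ?t) \<le> a x * (\<gamma> * \<Phi> ?t powr (s * \<tau>))"
          using a by (intro mult_left_mono) auto
        also have "\<dots> = \<gamma> * ?P1 x"
          using a[of x] \<rho>\<tau>(3) by (simp add: powr_powr)
        finally show ?thesis .
      qed
      also have "b * (?t powr p * (\<phi> ?t * \<Phi> ?t)) \<le> L + b * (2 * \<gamma>) * ?P3 x"
      proof (cases "?t \<le> real m")
        case True
        have le: "\<phi> ?t \<le> \<gamma> * real m powr (\<gamma> - 1)"
          using c1[OF t(1)] True t R \<gamma> by (auto intro!: order_trans[OF c1[OF t(1)]] mult_left_mono powr_mono2)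
        have "\<Phi> ?t \<le> \<phi> ?t * ?t" by (rule cd(5)) simp
        also have "\<dots> \<le> (\<gamma> * real m powr (\<gamma> - 1)) * real m"
          using le True p0 \<gamma> by (intro mult_mono) auto
        finally have "b * (?t powr p * (\<phi> ?t * \<Phi> ?t)) \<le> L"
          unfolding L_def using le True p0 \<gamma> b p1 by (intro mult_left_mono mult_mono powr_mono2) auto
        moreover have "0 \<le> b * (2 * \<gamma>) * ?P3 x" using \<gamma> b by auto
        ultimately show ?thesis by linarith
      next
        case False
        then have ind: "indicator (?B m) x = (1 :: real)" using x by simp
        have "?t \<le> 2 * (?t - R)" using False m(2) by simp
        then have "?t * \<phi> ?t \<le> 2 * (?t - R) * \<phi> ?t" using p0 by (intro mult_right_mono) auto
        also have "\<dots> \<le> 2 * (\<gamma> * \<Phi> ?t)" using c2[OF t(1)] by linarith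
        finally have *: "?t * \<phi> ?t * \<Phi> ?t \<le> 2 * (\<gamma> * \<Phi> ?t) * \<Phi> ?t" using p0 by (intro mult_right_mono) auto
        \<comment> \<open>Since \<open>p = 1 + s * (2 / n)\<close>, one factor \<open>?t\<close> is
          spent on turning \<open>\<phi>\<close> into \<open>\<Phi>\<close>; the rest is the weight
          that is small on the tail and pairs with \<open>\<Phi>\<close> squared under the exponents
          \<open>2 / n\<close> and \<open>\<theta>\<close>.\<close>
        have "?t powr p * (\<phi> ?t * \<Phi> ?t) = ?t powr (s * (2 / n)) * (?t * \<phi> ?t * \<Phi> ?t)"
          using t by (simp add: p1(1) powr_add)
        also have "\<dots> \<le> ?t powr (s * (2 / n)) * (2 * (\<gamma> * \<Phi> ?t) * \<Phi> ?t)"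
          by (intro mult_left_mono *) auto
        also have "\<dots> = 2 * \<gamma> * ?P3 x"
          using p0 by (simp only: ind mult_1_right powr_powr exponents(4)) (simp add: power2_eq_square powr_numeral)
        finally have "b * (?t powr p * (\<phi> ?t * \<Phi> ?t)) \<le> b * (2 * \<gamma> * ?P3 x)"
          using b by (intro mult_left_mono)
        then show ?thesis using L0 by (simp add: mult.assoc)
      qed
      finally show ?thesis by (simp add: algebra_simps)
    qed
    have iL: "integrable M (\<lambda>x. L)" by simp
    have "(\<integral>x. f x * (\<phi> \<bar>u x\<bar> * \<Phi> \<bar>u x\<bar>) \<partial>M) \<le> (\<integral>x. \<gamma> * ?P1 x + L + b * (2 * \<gamma>) * ?P3 x \<partial>M)"
      using pw energy_int(2)[OF c]
      by (intro integral_mono Bochner_Integration.integrable_add integrable_mult_right H1 H3 iL) auto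
    also have "\<dots> = \<gamma> * (\<integral>x. ?P1 x \<partial>M) + L * measure M (space M) + b * (2 * \<gamma>) * (\<integral>x. ?P3 x \<partial>M)"
      using H1(1) H3(1) iL
      by (subst Bochner_Integration.integral_add, (intro Bochner_Integration.integrable_add integrable_mult_right H1 H3 iL)+)+
         (simp only: Bochner_Integration.integral_mult_right_zero lebesgue_integral_const real_scaleR_def mult.commute)
    also have "\<dots> \<le> \<gamma> * (Y * X powr \<tau>) + L * measure M (space M) + b * (2 * \<gamma>) * (?\<delta> m powr (2 / n) * X powr \<theta>)"
      using H1(2) H3(2) \<gamma> b by (intro add_mono mult_left_mono order_refl) auto
    finally have "K * (\<integral>x. f x * (\<phi> \<bar>u x\<bar> * \<Phi> \<bar>u x\<bar>) \<partial>M) \<le> K * \<dots>"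
      using K by (rule mult_left_mono)
    then have "X powr \<theta> \<le> K * (\<gamma> * (Y * X powr \<tau>) + L * measure M (space M) + b * (2 * \<gamma>) * (?\<delta> m powr (2 / n) * X powr \<theta>))"
      using energy[OF c] unfolding X_def by linarith
    also have "\<dots> = (A * X powr \<tau> + C) / 2 + K * (b * (2 * \<gamma> * ?\<delta> m powr (2 / n))) * X powr \<theta>"
      by (simp add: A_def C_def algebra_simps)
    also have "K * (b * (2 * \<gamma> * ?\<delta> m powr (2 / n))) * X powr \<theta> \<le> 1 / 2 * X powr \<theta>"
      using m(1) by (intro mult_right_mono) auto
    finally have "X powr \<theta> \<le> (A * X powr \<tau> + C) / 2 + 1 / 2 * X powr \<theta>" by simp
    \<comment> \<open>The absorption rests on the truncation: by \<open>iX\<close> the energy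
      integral \<open>X\<close> is finite before any bound on it is known.\<close>
    then have "X powr \<theta> \<le> A * X powr \<tau> + C" by (simp add: field_simps)
    then have XZ: "X \<le> Z"
      unfolding Z_def using X0 A0 C0 \<tau>0 by (intro powr_inequality_bound) auto
    have le: "min (max (\<bar>u x\<bar> - R) 0) (real (Suc k)) powr q \<le> \<Phi> \<bar>u x\<bar> powr s" for x
    proof (cases "R \<le> \<bar>u x\<bar>")
      case True
      have "min (\<bar>u x\<bar> - R) (real (Suc k)) powr q = (min (\<bar>u x\<bar> - R) (real (Suc k)) powr \<gamma>) powr s"
        by (simp only: powr_powr \<gamma>s)
      also have "\<dots> \<le> \<Phi> \<bar>u x\<bar> powr s"
        using c3[OF True] exponents by (intro powr_mono2) auto
      finally show ?thesis using True by simp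
    qed simp
    show "integrable M (\<lambda>x. min (max (\<bar>u x\<bar> - R) 0) (real (Suc k)) powr q)"
      by (rule Bochner_Integration.integrable_bound[OF iX]) (use le in auto)
    then have "(\<integral>x. min (max (\<bar>u x\<bar> - R) 0) (real (Suc k)) powr q \<partial>M) \<le> X"
      unfolding X_def by (rule integral_mono[OF _ iX le])
    then show "(\<integral>x. min (max (\<bar>u x\<bar> - R) 0) (real (Suc k)) powr q \<partial>M) \<le> Z"
      using XZ by linarith
  qed
  have "AE x in M. (\<lambda>k. min (max (\<bar>u x\<bar> - R) 0) (real (Suc k)) powr q) \<longlonglongrightarrow> max (\<bar>u x\<bar> - R) 0 powr q"
  proof (rule AE_I2)
    fix x
    obtain k0 :: nat where k0: "max (\<bar>u x\<bar> - R) 0 < real k0" using reals_Archimedean2 by blast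
    have "\<forall>\<^sub>F k in sequentially. min (max (\<bar>u x\<bar> - R) 0) (real (Suc k)) powr q = max (\<bar>u x\<bar> - R) 0 powr q"
    proof (rule eventually_sequentiallyI[of k0])
      fix k assume "k0 \<le> k"
      then have "max (\<bar>u x\<bar> - R) 0 \<le> real (Suc k)" using k0 by linarith
      then show "min (max (\<bar>u x\<bar> - R) 0) (real (Suc k)) powr q = max (\<bar>u x\<bar> - R) 0 powr q"
        by (simp only: min_absorb1)
    qed
    then show "(\<lambda>k. min (max (\<bar>u x\<bar> - R) 0) (real (Suc k)) powr q) \<longlonglongrightarrow> max (\<bar>u x\<bar> - R) 0 powr q"
      by (rule tendsto_eventually)
  qed
  from integral_limit_le(1)[OF main(1) _ this _ main(2) tendsto_const]
  have i\<sigma>: "integrable M (\<lambda>x. max (\<bar>u x\<bar> - R) 0 powr q)" by simp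
  have iS: "integrable M (\<lambda>x. 2 powr q * (max (\<bar>u x\<bar> - R) 0 powr q + R powr q))"
    using i\<sigma> by auto
  show ?thesis
  proof (rule Bochner_Integration.integrable_bound[OF iS])
    show "AE x in M. norm (\<bar>u x\<bar> powr q) \<le> norm (2 powr q * (max (\<bar>u x\<bar> - R) 0 powr q + R powr q))"
    proof (rule AE_I2)
      fix x
      let ?\<sigma> = "max (\<bar>u x\<bar> - R) 0"
      have "\<bar>u x\<bar> powr q \<le> (?\<sigma> + R) powr q"
        using q2 by (intro powr_mono2) auto
      also have "\<dots> \<le> 2 powr q * (?\<sigma> powr q + R powr q)"
        using q2 R by (intro add_powr_le) auto
      finally show "norm (\<bar>u x\<bar> powr q) \<le> norm (2 powr q * (?\<sigma> powr q + R powr q))"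
        by (simp add: abs_of_nonneg)
    qed
  qed measurable
qed


section \<open>Stampacchia's iteration over level sets\<close>

lemma superlevel_measure_decay:
  assumes r: "r > n / 2" and f_int: "integrable M (\<lambda>x. f x powr r)"
    and kh: "R \<le> k" "k < h"
  shows "measure M {x \<in> space M. \<bar>u x\<bar> > h}
    \<le> (2 * (K * (\<integral>x. f x powr r \<partial>M) powr (1 / r)) / (h - k)) powr s
       * measure M {x \<in> space M. \<bar>u x\<bar> > k} powr (s * (1 - 1 / r) - 1)"
proof -
  \<comment> \<open>\<open>\<phi>\<close> has to be continuous, so it climbs from 0 to 1 on the
    first half of the interval from \<open>k\<close> to \<open>h\<close>. On the second half it is
    1, which gives \<open>\<Phi> \<ge> \<epsilon>\<close> beyond \<open>h\<close> and explains the
    factor 2 in the estimate.\<close>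
  define \<epsilon> where "\<epsilon> = (h - k) / 2"
  have \<epsilon>: "0 < \<epsilon>" using kh by (simp add: \<epsilon>_def)
  have k0: "0 < k" using kh R by simp
  define \<phi> where "\<phi> t = min 1 (max (t - k) 0 / \<epsilon>)" for t
  have c\<phi>: "continuous_on UNIV \<phi>"
    unfolding \<phi>_def using \<epsilon> by (intro continuous_intros) auto
  obtain \<Phi> where \<Phi>: "\<Phi> 0 = 0" "\<And>t. (\<Phi> has_real_derivative \<phi> t) (at t)"
    using continuous_antiderivative[OF c\<phi>] by blast
  have mono: "mono \<phi>"
    unfolding mono_def \<phi>_def using \<epsilon> by (intro allI impI min.mono divide_right_mono max.mono) auto
  have \<phi>1: "\<phi> t \<le> 1" for t by (simp add: \<phi>_def)
  have z: "\<phi> t = 0" if "t \<le> k" for t using that by (simp add: \<phi>_def)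
  have c: "cutoff k \<phi> \<Phi>"
    unfolding cutoff_def using c\<phi> mono \<phi>1 \<Phi> z by blast
  have cR: "cutoff R \<phi> \<Phi>"
    using c kh(1) unfolding cutoff_def by force
  note cd = cutoffD[OF c k0]
  have [measurable]: "\<phi> \<in> borel_measurable borel" "\<Phi> \<in> borel_measurable borel"
    using cd(7,8) by (auto intro: borel_measurable_continuous_onI)
  have \<Phi>h: "\<epsilon> \<le> \<Phi> t" if t: "h \<le> t" for t
  proof -
    have kt: "k + \<epsilon> \<le> t" using t kh by (simp add: \<epsilon>_def field_simps)
    have "\<Phi> (k + \<epsilon>) - (k + \<epsilon>) \<le> \<Phi> t - t"
    proof (rule DERIV_nonneg_imp_nondecreasing[OF kt, where f = "\<lambda>t. \<Phi> t - t"])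
      fix y assume "k + \<epsilon> \<le> y" "y \<le> t"
      then have "\<phi> y = 1" using \<epsilon> by (simp add: \<phi>_def min_def field_simps)
      then show "\<exists>z. ((\<lambda>t. \<Phi> t - t) has_real_derivative z) (at y) \<and> 0 \<le> z"
        using DERIV_diff[OF \<Phi>(2)[of y] DERIV_ident] by (intro exI[of _ 0]) simp
    qed
    then show ?thesis using cd(4)[of "k + \<epsilon>"] t by (simp add: \<epsilon>_def field_simps)
  qed
  let ?A = "{x \<in> space M. \<bar>u x\<bar> > k}" and ?B = "{x \<in> space M. \<bar>u x\<bar> > h}"
  \<comment> \<open>In Hoelder's inequality \<open>f\<close> takes \<open>1 / r\<close>,
    \<open>\<Phi>\<close> takes \<open>1 / s\<close>, and the indicator of the level set takes the
    rest. The condition \<open>r > n / 2\<close> even gives \<open>\<omega> > 1 / s\<close>, so the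
    final power \<open>\<omega> * s\<close> of the measure exceeds 1.\<close>
  define \<omega> where "\<omega> = 1 - 1 / r - 1 / s"
  have r0: "r > 0" using r n by simp
  have s0: "s > 0" using exponents by simp
  have "1 / r < 2 / n" using r n r0 by (simp add: field_simps)
  moreover have "2 / n = 1 - 2 / s" "2 / s = \<theta>" using n by (auto simp: s \<theta> field_simps)
  moreover have "1 / s < 2 / s" using s0 by (simp add: divide_strict_right_mono)
  ultimately have \<omega>0: "0 < \<omega>" and \<theta>s: "\<theta> - 1 / s = 1 / s"
    unfolding \<omega>_def by linarith+
  define X where "X = (\<integral>x. \<Phi> \<bar>u x\<bar> powr s \<partial>M)"
  define Y where "Y = (\<integral>x. f x powr r \<partial>M) powr (1 / r)"
  note iX = energy_int(1)[OF cR]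
  have X0: "0 \<le> X" by (simp add: X_def)
  have iA: "integrable M (indicat_real ?A)" "integrable M (indicat_real ?B)"
    by (intro integrable_real_indicator; auto simp: emeasure_eq_measure)+
  let ?F = "\<lambda>i::nat. if i = 0 then (\<lambda>x. f x powr r) else if i = 1 then (\<lambda>x. \<Phi> \<bar>u x\<bar> powr s) else indicat_real ?A"
  let ?w = "\<lambda>i::nat. if i = 0 then 1 / r else if i = 1 then 1 / s else \<omega>"
  let ?P = "\<lambda>x. (f x powr r) powr (1 / r) * ((\<Phi> \<bar>u x\<bar> powr s) powr (1 / s) * (indicat_real ?A x) powr \<omega>)"
  have prod3: "(\<Prod>i<3. g i) = g 0 * (g 1 * g 2)" for g :: "nat \<Rightarrow> real"
    by (simp add: numeral_3_eq_3 numeral_2_eq_2)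
  have Hw: "0 \<le> ?w i" for i using r0 s0 \<omega>0 by auto
  have Hs: "sum ?w {..<3} = 1"
    by (simp add: numeral_3_eq_3 \<omega>_def)
  have Hi: "integrable M (?F i)" for i using f_int iX iA by auto
  have Hn: "0 \<le> ?F i x" for i x by auto
  have H: "integrable M ?P" "(\<integral>x. ?P x \<partial>M) \<le> Y * (X powr (1 / s) * measure M ?A powr \<omega>)"
    using Holder_prod[of "{..<3}" ?w M ?F, OF _ Hw Hs Hi Hn] unfolding prod3 X_def Y_def by simp_all
  have "X powr \<theta> \<le> K * (\<integral>x. f x * (\<phi> \<bar>u x\<bar> * \<Phi> \<bar>u x\<bar>) \<partial>M)"
    using energy[OF cR] by (simp add: X_def)
  also have "(\<integral>x. f x * (\<phi> \<bar>u x\<bar> * \<Phi> \<bar>u x\<bar>) \<partial>M) \<le> (\<integral>x. ?P x \<partial>M)"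
  proof (rule integral_mono[OF energy_int(2)[OF cR] H(1)])
    fix x assume x: "x \<in> space M"
    have "\<phi> \<bar>u x\<bar> * \<Phi> \<bar>u x\<bar> \<le> indicat_real ?A x * \<Phi> \<bar>u x\<bar>"
      using z[of "\<bar>u x\<bar>"] \<phi>1[of "\<bar>u x\<bar>"] cd(4)[of "\<bar>u x\<bar>"] x by (auto simp: indicator_def intro: mult_left_le_one_le cd(1))
    then have "f x * (\<phi> \<bar>u x\<bar> * \<Phi> \<bar>u x\<bar>) \<le> f x * (indicat_real ?A x * \<Phi> \<bar>u x\<bar>)"
      using f_nonneg by (intro mult_left_mono)
    also have "\<dots> = ?P x"
      using f_nonneg[of x] cd(4)[of "\<bar>u x\<bar>"] r0 s0 \<omega>0 by (simp add: powr_powr indicator_def)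
    finally show "f x * (\<phi> \<bar>u x\<bar> * \<Phi> \<bar>u x\<bar>) \<le> ?P x" .
  qed
  also note H(2)
  finally have "X powr \<theta> \<le> K * (Y * (X powr (1 / s) * measure M ?A powr \<omega>))"
    using K by (simp add: mult_left_mono)
  \<comment> \<open>Because \<open>\<theta> = 2 / s\<close>, dividing by
    \<open>X powr (1 / s)\<close> leaves the same power on the left. The case \<open>X = 0\<close>
    is separate since it does not allow the division.\<close>
  then have XY: "X powr (1 / s) \<le> K * Y * measure M ?A powr \<omega>"
  proof (cases "X = 0")
    case False
    with X0 have "0 < X" by simp
    assume "X powr \<theta> \<le> K * (Y * (X powr (1 / s) * measure M ?A powr \<omega>))"
    then have "X powr (\<theta> - 1 / s) \<le> K * Y * measure M ?A powr \<omega>"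
      using \<open>0 < X\<close> by (simp add: powr_diff pos_divide_le_eq mult_ac)
    then show ?thesis by (simp only: \<theta>s)
  qed (use K in \<open>simp add: Y_def\<close>)
  \<comment> \<open>Chebyshev's inequality, with \<open>\<Phi> \<ge> \<epsilon>\<close> on
    \<open>?B\<close>.\<close>
  have "\<epsilon> powr s * measure M ?B \<le> X"
  proof -
    have "\<epsilon> powr s * measure M ?B = (\<integral>x. \<epsilon> powr s * indicat_real ?B x \<partial>M)" by simp
    also have "\<dots> \<le> X"
      unfolding X_def
    proof (rule integral_mono[OF _ iX])
      fix x
      show "\<epsilon> powr s * indicat_real ?B x \<le> \<Phi> \<bar>u x\<bar> powr s"
        using \<Phi>h[of "\<bar>u x\<bar>"] \<epsilon> s0 by (auto simp: indicator_def intro!: powr_mono2)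
    qed (use iA(2) in simp)
    finally show ?thesis .
  qed
  also have "X = (X powr (1 / s)) powr s" using X0 s0 by (simp add: powr_powr)
  also have "\<dots> \<le> (K * Y * measure M ?A powr \<omega>) powr s"
    using XY s0 by (intro powr_mono2) auto
  also have "\<dots> = (K * Y) powr s * measure M ?A powr (\<omega> * s)"
    using K by (simp add: powr_mult powr_powr Y_def)
  finally have "measure M ?B \<le> (K * Y) powr s / \<epsilon> powr s * measure M ?A powr (\<omega> * s)"
    using \<epsilon> by (simp add: field_simps)
  also have "(K * Y) powr s / \<epsilon> powr s = (2 * (K * Y) / (h - k)) powr s"
    using \<epsilon> K by (simp add: powr_divide[symmetric] Y_def \<epsilon>_def mult.commute)
  also have "\<omega> * s = s * (1 - 1 / r) - 1"
    using s0 by (simp add: \<omega>_def algebra_simps)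
  finally show ?thesis by (simp only: Y_def)
qed

end

text \<open>The ratio \<open>l\<close> of the geometric bound is chosen with
  \<open>B * l powr (\<beta> - 1) = 1\<close>, so that the growth of \<open>B ^ i\<close> is
  cancelled exactly by the superlinear power. The smallness of \<open>m 0\<close> then supplies the
  one further factor \<open>l\<close> that each induction step needs.\<close>

lemma fast_geometric_decay:
  fixes m :: "nat \<Rightarrow> real"
  assumes m: "\<And>i. 0 \<le> m i" and step: "\<And>i. m (Suc i) \<le> D * B ^ i * m i powr \<beta>"
    and B: "1 < B" and \<beta>: "1 < \<beta>" and D: "0 \<le> D" and small: "D * m 0 powr (\<beta> - 1) \<le> B powr (- 1 / (\<beta> - 1))"
  shows "m \<longlonglongrightarrow> 0"
proof -
  define l where "l = B powr (- 1 / (\<beta> - 1))"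
  have l0: "0 < l" using B by (simp add: l_def)
  have l1: "l < 1"
    unfolding l_def using B \<beta> powr_less_mono[of "- 1 / (\<beta> - 1)" 0 B] by simp
  have lB: "B * l powr (\<beta> - 1) = 1"
  proof -
    have "l powr (\<beta> - 1) = B powr (- 1)"
      unfolding l_def powr_powr using \<beta> by simp
    then show ?thesis using B by (simp add: powr_minus)
  qed
  have small': "D * m 0 powr (\<beta> - 1) \<le> l"
    using small by (simp add: l_def)
  have bound: "m i \<le> m 0 * l ^ i" for i
  proof (induction i)
    case (Suc i)
    have "m (Suc i) \<le> D * B ^ i * m i powr \<beta>" by (rule step)
    also have "\<dots> \<le> D * B ^ i * (m 0 * l ^ i) powr \<beta>"
      using Suc m D B \<beta> by (intro mult_left_mono powr_mono2) auto
    also have "\<dots> = (D * m 0 powr (\<beta> - 1)) * (m 0 * l ^ i) * (B * l powr (\<beta> - 1)) ^ i"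
    proof -
      have e: "y powr \<beta> = y powr (\<beta> - 1) * y" if "0 \<le> y" for y
        using that by (cases "y = 0") (auto simp: powr_diff)
      have p: "(l ^ i) powr (\<beta> - 1) = (l powr (\<beta> - 1)) ^ i"
        using l0 by (simp add: powr_realpow[symmetric] powr_powr mult.commute)
      have "(m 0 * l ^ i) powr \<beta> = m 0 powr (\<beta> - 1) * (l powr (\<beta> - 1)) ^ i * (m 0 * l ^ i)"
        using m l0 by (subst e) (auto simp: powr_mult p)
      then show ?thesis by (simp add: power_mult_distrib mult_ac)
    qed
    also have "\<dots> \<le> l * (m 0 * l ^ i)"
      using small' m l0 by (simp add: lB mult_right_mono)
    finally show ?case by (simp add: mult_ac)
  qed simp
  have "(\<lambda>i. m 0 * l ^ i) \<longlonglongrightarrow> m 0 * 0"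
    using l0 l1 by (intro tendsto_intros LIMSEQ_power_zero) auto
  then have lim: "(\<lambda>i. m 0 * l ^ i) \<longlonglongrightarrow> 0" by simp
  show ?thesis
    by (rule tendsto_sandwich[OF _ _ tendsto_const lim]) (use m bound in auto)
qed

context energy_bound
begin

text \<open>The levels rise from \<open>k0\<close> to \<open>k0 + 1\<close>. The smallness that
  \<open>fast_geometric_decay\<close> asks of the first term is obtained by starting high enough:
  the measure of the set where |u| exceeds \<open>k\<close> tends to 0 because \<open>u\<close> is
  real-valued and \<open>M\<close> is finite.\<close>

lemma essentially_bounded:
  assumes r: "r > n / 2" and f_int: "integrable M (\<lambda>x. f x powr r)"
  shows "\<exists>C. AE x in M. \<bar>u x\<bar> \<le> C"
proof -
  let ?m = "\<lambda>k. measure M {x \<in> space M. \<bar>u x\<bar> > k}"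
  define \<beta> where "\<beta> = s * (1 - 1 / r) - 1"
  define Y where "Y = K * (\<integral>x. f x powr r \<partial>M) powr (1 / r)"
  have Y0: "0 \<le> Y" using K by (simp add: Y_def)
  have r0: "r > 0" using r n by simp
  have \<beta>: "1 < \<beta>"
  proof -
    have "1 / r < 2 / n" using r n r0 by (simp add: field_simps)
    then have "1 - 2 / n < 1 - 1 / r" by simp
    then have "s * (1 - 2 / n) < s * (1 - 1 / r)" using exponents by simp
    moreover have "s * (1 - 2 / n) = 2" using n by (simp add: s field_simps)
    ultimately show ?thesis by (simp add: \<beta>_def)
  qed
  \<comment> \<open>\<open>B\<close> and \<open>D\<close> are dictated by the levels below:
    consecutive ones differ by \<open>(1 / 2) ^ Suc i\<close>, and \<open>2 * Y\<close> divided by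
    this gap is \<open>4 * Y * 2 ^ i\<close>, which is then raised to the power
    \<open>s\<close>.\<close>
  define B where "B = 2 powr s"
  define D where "D = (4 * Y) powr s"
  have B1: "1 < B" using exponents by (simp add: B_def)
  have "(\<lambda>k::nat. ?m (real k)) \<longlonglongrightarrow> measure M (\<Inter>k::nat. {x \<in> space M. \<bar>u x\<bar> > real k})"
    by (intro finite_Lim_measure_decseq) (auto simp: decseq_def intro: order_le_less_trans[OF of_nat_mono])
  moreover have "(\<Inter>k::nat. {x \<in> space M. \<bar>u x\<bar> > real k}) = {}"
  proof -
    have False if "\<And>k::nat. real k < \<bar>u x\<bar>" for x
      using reals_Archimedean2[of "\<bar>u x\<bar>"] that by (metis less_asym)
    then show ?thesis by blast
  qed
  ultimately have lim: "(\<lambda>k::nat. ?m (real k)) \<longlonglongrightarrow> 0" by simp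
  have "(\<lambda>k::nat. D * ?m (real k) powr (\<beta> - 1)) \<longlonglongrightarrow> D * 0 powr (\<beta> - 1)"
    using \<beta> by (intro tendsto_intros tendsto_powr' lim) auto
  then have "\<forall>\<^sub>F k::nat in sequentially. D * ?m (real k) powr (\<beta> - 1) < B powr (- 1 / (\<beta> - 1))"
    using B1 by (intro order_tendstoD) auto
  moreover have "\<forall>\<^sub>F k::nat in sequentially. R \<le> real k"
    using filterlim_real_sequentially by (simp add: filterlim_at_top)
  ultimately have "\<forall>\<^sub>F k::nat in sequentially. D * ?m (real k) powr (\<beta> - 1) < B powr (- 1 / (\<beta> - 1)) \<and> R \<le> real k"
    by (rule eventually_conj)
  then obtain k0 :: nat where k0: "D * ?m (real k0) powr (\<beta> - 1) \<le> B powr (- 1 / (\<beta> - 1))" "R \<le> real k0"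
    by (metis (no_types, lifting) eventually_sequentially less_imp_le order_refl)
  define t where "t i = real k0 + 1 - (1 / 2) ^ i" for i :: nat
  have "(\<lambda>i. ?m (t i)) \<longlonglongrightarrow> 0"
  proof (rule fast_geometric_decay[where B = B and D = D and \<beta> = \<beta>])
    fix i
    have d: "t (Suc i) - t i = (1 / 2) ^ Suc i" by (simp add: t_def)
    have tR: "R \<le> t i" using k0(2) power_le_one[of "1 / 2 :: real" i] by (simp add: t_def)
    have "?m (t (Suc i)) \<le> (2 * Y / (t (Suc i) - t i)) powr s * ?m (t i) powr \<beta>"
      unfolding Y_def \<beta>_def by (rule superlevel_measure_decay[OF r f_int tR]) (simp add: t_def)
    also have "2 * Y / (t (Suc i) - t i) = 4 * Y * 2 ^ i"
      unfolding d by (simp add: field_simps)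
    also have "(4 * Y * 2 ^ i) powr s = D * B ^ i"
      using Y0 by (simp add: D_def B_def powr_mult powr_realpow[symmetric] powr_powr mult.commute)
    finally show "?m (t (Suc i)) \<le> D * B ^ i * ?m (t i) powr \<beta>" .
  qed (use B1 \<beta> k0 in \<open>auto simp: D_def t_def\<close>)
  moreover have "?m (real k0 + 1) \<le> ?m (t i)" for i
    by (rule finite_measure_mono) (auto simp: t_def intro: less_trans[rotated])
  ultimately have "?m (real k0 + 1) \<le> 0"
    by (intro LIMSEQ_le_const) auto
  then have "?m (real k0 + 1) = 0" by (simp add: measure_le_0_iff)
  then have "AE x in M. \<not> real k0 + 1 < \<bar>u x\<bar>"
    by (intro AE_iff_measurable[THEN iffD2, of "{x \<in> space M. real k0 + 1 < \<bar>u x\<bar>}"]) (auto simp: emeasure_eq_measure)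
  then show ?thesis by (auto simp: not_less)
qed

end

section \<open>Regularity of generalized solutions\<close>

theorem theorem7p1:
  fixes \<Omega> :: "(real^'n) set"
    and j :: "real^'n \<Rightarrow> real \<Rightarrow> real^'n \<Rightarrow> real"
    and js :: "real^'n \<Rightarrow> real \<Rightarrow> real^'n \<Rightarrow> real"
    and jxi :: "real^'n \<Rightarrow> real \<Rightarrow> real^'n \<Rightarrow> real^'n"
    and g :: "real^'n \<Rightarrow> real \<Rightarrow> real"
    and \<alpha> \<beta> :: "real \<Rightarrow> real" and \<alpha>0 R r b :: real
    and a :: "real^'n \<Rightarrow> real" and u :: "real^'n \<Rightarrow> real"
  defines "N \<equiv> real CARD('n)"
  assumes dim: "CARD('n) \<ge> 3"
    and \<Omega>_open: "open \<Omega>" and \<Omega>_bdd: "bounded \<Omega>"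
    \<comment> \<open>j measurable in x, C^1 in (s,\<xi>) for a.e. x with partial derivatives js, jxi\<close>
    and j_meas: "\<And>s \<xi>. (\<lambda>x. j x s \<xi>) \<in> borel_measurable (lebesgue_on \<Omega>)"
    and j_C1: "AE x in lebesgue_on \<Omega>.
        (\<forall>s \<xi>. ((\<lambda>p. j x (fst p) (snd p)) has_derivative
                  (\<lambda>d. js x s \<xi> * fst d + jxi x s \<xi> \<bullet> snd d)) (at (s, \<xi>))) \<and>
        continuous_on UNIV (\<lambda>p. js x (fst p) (snd p)) \<and>
        continuous_on UNIV (\<lambda>p. jxi x (fst p) (snd p))"
    \<comment> \<open>(H1)\<close>
    and H1: "AE x in lebesgue_on \<Omega>. \<forall>s \<xi> \<eta> t. \<xi> \<noteq> \<eta> \<and> 0 < t \<and> t < 1 \<longrightarrow>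
        j x s (t *\<^sub>R \<xi> + (1 - t) *\<^sub>R \<eta>) < t * j x s \<xi> + (1 - t) * j x s \<eta>"
    \<comment> \<open>(H2)\<close>
    and \<alpha>0_pos: "\<alpha>0 > 0"
    and \<alpha>_pos: "\<And>t. t \<ge> 0 \<Longrightarrow> \<alpha> t > 0" and \<alpha>_mono: "mono_on {0..} \<alpha>"
    and \<alpha>_cont: "continuous_on {0..} \<alpha>"
    and H2: "AE x in lebesgue_on \<Omega>. \<forall>s \<xi>.
        \<alpha>0 * (norm \<xi>)\<^sup>2 \<le> j x s \<xi> \<and> j x s \<xi> \<le> \<alpha> \<bar>s\<bar> * (norm \<xi>)\<^sup>2"
    \<comment> \<open>(H3)\<close>
    and \<beta>_pos: "\<And>t. t \<ge> 0 \<Longrightarrow> \<beta> t > 0" and \<beta>_mono: "mono_on {0..} \<beta>"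
    and \<beta>_cont: "continuous_on {0..} \<beta>"
    and H3: "AE x in lebesgue_on \<Omega>. \<forall>s \<xi>. \<bar>js x s \<xi>\<bar> \<le> \<beta> \<bar>s\<bar> * (norm \<xi>)\<^sup>2"
    \<comment> \<open>(H4)\<close>
    and R_pos: "R > 0"
    and H4: "AE x in lebesgue_on \<Omega>. \<forall>s \<xi>. \<bar>s\<bar> \<ge> R \<longrightarrow> js x s \<xi> * s \<ge> 0"
    \<comment> \<open>g Carath\'eodory\<close>
    and g_meas: "\<And>s. (\<lambda>x. g x s) \<in> borel_measurable (lebesgue_on \<Omega>)"
    and g_cont: "AE x in lebesgue_on \<Omega>. continuous_on UNIV (g x)"
    \<comment> \<open>(G2)\<close>
    and G2: "\<And>\<epsilon>. \<epsilon> > 0 \<Longrightarrow> \<exists>a\<epsilon>. Lp_mem \<Omega> (2 * N / (N + 2)) a\<epsilon> \<and>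
        (AE x in lebesgue_on \<Omega>. \<forall>s. \<bar>g x s\<bar> \<le> a\<epsilon> x + \<epsilon> * \<bar>s\<bar> powr ((N + 2) / (N - 2)))"
    \<comment> \<open>growth condition with a \<in> L^r\<close>
    and r_gt: "r > 2 * N / (N + 2)" and a_Lr: "Lp_mem \<Omega> r a" and b_nonneg: "b \<ge> 0"
    and g_growth: "AE x in lebesgue_on \<Omega>. \<forall>s. \<bar>g x s\<bar> \<le> a x + b * \<bar>s\<bar> powr ((N + 2) / (N - 2))"
    and sol: "gen_solution \<Omega> js jxi g u"
  shows "(2 * N / (N + 2) < r \<and> r < N / 2 \<longrightarrow> Lp_mem \<Omega> (N * r / (N - 2 * r)) u)
       \<and> (r > N / 2 \<longrightarrow> Linf_mem \<Omega> u)"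
proof -
  let ?M = "lebesgue_on \<Omega>"
  define s where "s = 2 * N / (N - 2)"
  define p where "p = (N + 2) / (N - 2)"
  have N: "N \<ge> 3" using dim by (simp add: N_def)
  obtain G where u: "H01 \<Omega> u G"
    and iA: "integrable ?M (\<lambda>x. jxi x (u x) (G x) \<bullet> G x)"
    and iB: "integrable ?M (\<lambda>x. js x (u x) (G x) * u x)"
    and eq: "\<And>v H. H01 \<Omega> v H \<Longrightarrow> integrable ?M (\<lambda>x. jxi x (u x) (G x) \<bullet> H x) \<Longrightarrow>
           integrable ?M (\<lambda>x. js x (u x) (G x) * v x) \<Longrightarrow>
           integral\<^sup>L ?M (\<lambda>x. jxi x (u x) (G x) \<bullet> H x) + integral\<^sup>L ?M (\<lambda>x. js x (u x) (G x) * v x)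
           = integral\<^sup>L ?M (\<lambda>x. g x (u x) * v x)"
    using sol unfolding gen_solution_def by blast
  have fin: "finite_measure ?M"
    using \<Omega>_open \<Omega>_bdd by (intro finite_measure_lebesgue_on lmeasurable_open)
  interpret finite_measure ?M by (rule fin)
  have [measurable]: "u \<in> borel_measurable ?M" "a \<in> borel_measurable ?M"
    and iar: "integrable ?M (\<lambda>x. \<bar>a x\<bar> powr r)"
    using u a_Lr by (auto simp: H01_def Lp_mem_def)
  have ell: "AE x in ?M. \<alpha>0 * (norm (G x))\<^sup>2 \<le> jxi x (u x) (G x) \<bullet> G x"
    using j_C1 H1 H2
  proof eventually_elim
    case (elim x)
    let ?f = "\<lambda>\<xi>. j x (u x) \<xi>"
    have low: "\<alpha>0 * (norm \<xi>)\<^sup>2 \<le> ?f \<xi>" and upp: "?f \<xi> \<le> \<alpha> \<bar>u x\<bar> * (norm \<xi>)\<^sup>2" for \<xi>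
      using elim(3) by auto
    \<comment> \<open>Both bounds of (H2) are 0 at the origin; convexity towards the origin then
      becomes the hypothesis of \<open>convex_gradient_coercive\<close>.\<close>
    have f0: "?f 0 = 0" using low[of 0] upp[of 0] by simp
    have "((\<lambda>\<xi>. (u x, \<xi>)) has_derivative (\<lambda>\<xi>. (0, \<xi>))) (at (G x))"
      by (auto intro!: derivative_eq_intros)
    moreover have "((\<lambda>p. j x (fst p) (snd p)) has_derivative
        (\<lambda>d. js x (u x) (G x) * fst d + jxi x (u x) (G x) \<bullet> snd d)) (at (u x, G x))"
      using elim(1) by blast
    ultimately have "((\<lambda>p. j x (fst p) (snd p)) \<circ> (\<lambda>\<xi>. (u x, \<xi>)) has_derivative
        (\<lambda>d. js x (u x) (G x) * fst d + jxi x (u x) (G x) \<bullet> snd d) \<circ> (\<lambda>\<xi>. (0, \<xi>))) (at (G x))"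
      by (rule diff_chain_at)
    then have "(?f has_derivative (\<lambda>h. jxi x (u x) (G x) \<bullet> h)) (at (G x))"
      by (simp add: o_def)
    then have "?f (G x) \<le> jxi x (u x) (G x) \<bullet> G x"
    proof (rule convex_gradient_coercive[where f = ?f, OF _ f0])
      fix \<xi> t assume t: "0 < (t :: real)" "t < 1"
      show "?f (t *\<^sub>R \<xi>) \<le> t * ?f \<xi>"
      proof (cases "\<xi> = 0")
        case False
        then have "?f (t *\<^sub>R \<xi> + (1 - t) *\<^sub>R 0) < t * ?f \<xi> + (1 - t) * ?f 0"
          using elim(2) t by blast
        then show ?thesis by (simp add: f0)
      qed (simp add: f0)
    qed
    then show ?case using low[of "G x"] by linarith
  qed
  have sgn: "AE x in ?M. R \<le> \<bar>u x\<bar> \<longrightarrow> 0 \<le> js x (u x) (G x) * u x"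
    using H4 by eventually_elim auto
  \<comment> \<open>\<open>a\<close> may take negative values, whereas the energy inequality needs a
    nonnegative majorant everywhere.\<close>
  define f where "f x = \<bar>a x\<bar> + b * \<bar>u x\<bar> powr p" for x
  have f0: "0 \<le> f x" for x using b_nonneg by (simp add: f_def)
  have [measurable]: "f \<in> borel_measurable ?M" unfolding f_def by measurable
  have hf: "AE x in ?M. \<bar>g x (u x)\<bar> \<le> f x"
    using g_growth
  proof eventually_elim
    case (elim x)
    have "\<bar>g x (u x)\<bar> \<le> a x + b * \<bar>u x\<bar> powr p" using elim by (simp add: p_def)
    then show ?case unfolding f_def by linarith
  qed
  have ius: "integrable ?M (\<lambda>x. \<bar>u x\<bar> powr s)"
    using Sobolev_H01(1)[OF \<Omega>_open u dim] by (simp add: s_def N_def)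
  have ifu: "integrable ?M (\<lambda>x. f x * \<bar>u x\<bar>)"
  proof (rule Bochner_Integration.integrable_bound)
    show "integrable ?M (\<lambda>x. 1 + \<bar>a x\<bar> powr r + \<bar>u x\<bar> powr s + b * \<bar>u x\<bar> powr s)"
      using iar ius by auto
    show "AE x in ?M. norm (f x * \<bar>u x\<bar>) \<le> norm (1 + \<bar>a x\<bar> powr r + \<bar>u x\<bar> powr s + b * \<bar>u x\<bar> powr s)"
    proof (rule AE_I2)
      fix x
      \<comment> \<open>The conjugate exponent of \<open>s\<close>. As \<open>?c < r\<close> and the
        domain has finite measure, \<open>a\<close> has an integrable power \<open>?c\<close>, so
        Young's inequality handles \<open>a\<close> against \<open>u\<close>; the other term is
        exactly critical since \<open>p + 1 = s\<close>.\<close>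
      let ?c = "2 * N / (N + 2)"
      have c: "1 < ?c" "1 < s" "1 / ?c + 1 / s = 1" using N by (auto simp: s_def field_simps)
      have "\<bar>a x\<bar> * \<bar>u x\<bar> \<le> \<bar>a x\<bar> powr ?c / ?c + \<bar>u x\<bar> powr s / s"
        using c by (intro Youngs_inequality) auto
      also have "\<dots> \<le> \<bar>a x\<bar> powr ?c + \<bar>u x\<bar> powr s"
        using c by (intro add_mono divide_le_self) auto
      also have "\<bar>a x\<bar> powr ?c \<le> 1 + \<bar>a x\<bar> powr r"
        using c r_gt by (intro powr_le_one_add_powr) auto
      finally have 1: "\<bar>a x\<bar> * \<bar>u x\<bar> \<le> 1 + \<bar>a x\<bar> powr r + \<bar>u x\<bar> powr s" by simp
      have "s = p + 1" using N by (simp add: s_def p_def field_simps)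
      then have "\<bar>u x\<bar> powr p * \<bar>u x\<bar> = \<bar>u x\<bar> powr s"
        by (cases "u x = 0") (auto simp: powr_add)
      then have "f x * \<bar>u x\<bar> \<le> 1 + \<bar>a x\<bar> powr r + \<bar>u x\<bar> powr s + b * \<bar>u x\<bar> powr s"
        using 1 by (simp add: f_def distrib_right mult.assoc)
      then show "norm (f x * \<bar>u x\<bar>) \<le> norm (1 + \<bar>a x\<bar> powr r + \<bar>u x\<bar> powr s + b * \<bar>u x\<bar> powr s)"
        using f0[of x] by simp
    qed
  qed measurable
  note E = energy_inequality[OF dim \<Omega>_open \<alpha>0_pos R_pos u ell sgn iA iB eq \<open>f \<in> borel_measurable ?M\<close> f0 ifu hf, folded N_def]
  interpret energy_bound ?M N R "(2 * (N - 1) / (N - 2))\<^sup>2 / \<alpha>0" s "(N - 2) / N" u f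
  proof unfold_locales
    show "(\<integral>x. \<Phi> \<bar>u x\<bar> powr s \<partial>?M) powr ((N - 2) / N) \<le> (2 * (N - 1) / (N - 2))\<^sup>2 / \<alpha>0 * (\<integral>x. f x * (\<phi> \<bar>u x\<bar> * \<Phi> \<bar>u x\<bar>) \<partial>?M)"
      if "cutoff R \<phi> \<Phi>" for \<phi> \<Phi>
      unfolding s_def by (rule E(3)[OF _ _ _ that])
    show "integrable ?M (\<lambda>x. \<Phi> \<bar>u x\<bar> powr s)" if "cutoff R \<phi> \<Phi>" for \<phi> \<Phi>
      unfolding s_def by (rule E(1)[OF _ _ _ that])
    show "integrable ?M (\<lambda>x. f x * (\<phi> \<bar>u x\<bar> * \<Phi> \<bar>u x\<bar>))" if "cutoff R \<phi> \<Phi>" for \<phi> \<Phi>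
      by (rule E(2)[OF _ _ _ that])
  qed (use N R_pos \<alpha>0_pos f0 ius in \<open>auto simp: s_def\<close>)
  have boot: "integrable ?M (\<lambda>x. \<bar>u x\<bar> powr q)"
    if "s < q" "integrable ?M (\<lambda>x. \<bar>a x\<bar> powr (q * N / (N + 2 * q)))" for q
    by (rule integrable_powr_bootstrap[where a = "\<lambda>x. \<bar>a x\<bar>" and b = b])
       (use that b_nonneg in \<open>auto simp: f_def p_def\<close>)
  have part_a: "Lp_mem \<Omega> (N * r / (N - 2 * r)) u" if r: "2 * N / (N + 2) < r" "r < N / 2"
  proof -
    \<comment> \<open>The solution of \<open>q * N / (N + 2 * q) = r\<close>; the lower bound on
      \<open>r\<close> is equivalent to \<open>s < q\<close>.\<close>
    define q where "q = N * r / (N - 2 * r)"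
    have d: "0 < N - 2 * r" using r by simp
    have "2 * N < r * (N + 2)" using r N by (simp add: field_simps)
    then have "2 * (N - 2 * r) < r * (N - 2)" by (simp add: algebra_simps)
    then have "2 / (N - 2) < r / (N - 2 * r)" using d N by (simp add: field_simps)
    then have "N * (2 / (N - 2)) < N * (r / (N - 2 * r))" using N by (intro mult_strict_left_mono) auto
    then have sq: "s < q" by (simp add: s_def q_def mult.commute)
    have "N + 2 * q = N * N / (N - 2 * r)" using d by (simp add: q_def field_simps)
    then have "q * N / (N + 2 * q) = r" using d N by (simp add: q_def)
    then have "integrable ?M (\<lambda>x. \<bar>u x\<bar> powr q)" using boot[OF sq] iar by simp
    then show ?thesis by (simp add: Lp_mem_def q_def)
  qed
  have part_b: "Linf_mem \<Omega> u" if r: "r > N / 2"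
  proof -
    \<comment> \<open>The exponent required of \<open>a\<close> is below \<open>N / 2\<close> for
      every \<open>q\<close>, so \<open>q\<close> may be taken as large as desired:
      \<open>s + 1\<close> satisfies the bootstrap condition, and \<open>p * r\<close> puts
      \<open>f\<close> in L^r.\<close>
    define q where "q = max (s + 1) (p * r)"
    have q: "s < q" "p * r \<le> q" by (auto simp: q_def)
    have s0: "0 < s" "0 < p" "0 < r" using N r by (auto simp: s_def p_def)
    have "q * N / (N + 2 * q) \<le> N / 2" using q s0 N by (simp add: field_simps)
    then have \<rho>: "q * N / (N + 2 * q) \<le> r" using r by linarith
    have \<rho>0: "0 \<le> q * N / (N + 2 * q)" using q s0 N by simp
    have "integrable ?M (\<lambda>x. \<bar>a x\<bar> powr (q * N / (N + 2 * q)))"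
      by (rule Bochner_Integration.integrable_bound[of _ "\<lambda>x. 1 + \<bar>a x\<bar> powr r"])
         (use iar \<rho> \<rho>0 powr_le_one_add_powr[of _ "q * N / (N + 2 * q)" r] in auto)
    from boot[OF q(1) this] have iq: "integrable ?M (\<lambda>x. \<bar>u x\<bar> powr q)" .
    have ipr: "integrable ?M (\<lambda>x. \<bar>u x\<bar> powr (p * r))"
      by (rule Bochner_Integration.integrable_bound[of _ "\<lambda>x. 1 + \<bar>u x\<bar> powr q"])
         (use iq q s0 powr_le_one_add_powr[of _ "p * r" q] in auto)
    have "integrable ?M (\<lambda>x. f x powr r)"
    proof (rule Bochner_Integration.integrable_bound)
      show "integrable ?M (\<lambda>x. 2 powr r * (\<bar>a x\<bar> powr r + b powr r * \<bar>u x\<bar> powr (p * r)))"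
        using iar ipr by auto
      show "AE x in ?M. norm (f x powr r) \<le> norm (2 powr r * (\<bar>a x\<bar> powr r + b powr r * \<bar>u x\<bar> powr (p * r)))"
      proof (rule AE_I2)
        fix x
        have "f x powr r \<le> 2 powr r * (\<bar>a x\<bar> powr r + (b * \<bar>u x\<bar> powr p) powr r)"
          unfolding f_def using b_nonneg s0 by (intro add_powr_le) auto
        also have "(b * \<bar>u x\<bar> powr p) powr r = b powr r * \<bar>u x\<bar> powr (p * r)"
          by (simp add: powr_mult powr_powr)
        finally show "norm (f x powr r) \<le> norm (2 powr r * (\<bar>a x\<bar> powr r + b powr r * \<bar>u x\<bar> powr (p * r)))"
          by (simp add: abs_of_nonneg)
      qed
    qed measurable
    from essentially_bounded[OF r this] show ?thesis
      by (simp add: Linf_mem_def)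
  qed
  show ?thesis using part_a part_b by blast
qed

end
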